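(* The manifold of full-rank correlation matrices $\mathrm{Cor}^+(n)$ equipped with a poly-hyperbolic-Cholesky metric with weights $\alpha_1,\dots,\alpha_{n-1}>0$ is a Riemannian symmetric space of non-positive sectional curvature bounded by $[a,0]$ with $a=-\frac{1}{\min_{i\geq 2}\alpha_i}$. For $n\geq 3$, it is not of constant curvature. The canonical poly-hyperbolic-Cholesky metric (all weights equal to $1$) writes, for all $C\in\mathrm{Cor}^+(n)$ and $X\in T_C\mathrm{Cor}^+(n)\simeq\mathrm{Hol}(n)$, $$g^{\mathrm{CPHC}}_C(X,X)=\|\mathrm{Diag}(L)^{-1}L\,\mathrm{low}_{\mathrm{S}}(L^{-1}XL^{-\top})\|^2,$$ where $L=\mathrm{Chol}(C)\in\mathcal{L}$. The square distance between $C=LL^\top$ and $C'=L'L'^\top$, with $L'=\mathrm{Chol}(C')\in\mathcal{L}$, writes $$d_{\mathrm{CPHC}}(C,C')^2=\sum_{i=2}^n\arccos\big(-Q(L_i^\top,{L_i'}^\top)\big)^2,$$ where $L_i,L_i'$ are the $i$-th rows of $L,L'$ respectively.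
   Context: $\mathrm{Cor}^+(n)$ is the manifold of real symmetric positive definite $n\times n$ matrices with unit diagonal; $\mathrm{Hol}(n)$ is the space of symmetric matrices with zero diagonal. $\mathrm{Chol}(C)$ is the unique lower triangular matrix $L$ with positive diagonal such that $C=LL^\top$. $\mathrm{Diag}(M)$ is the diagonal matrix with the same diagonal as $M$. For a symmetric matrix $M$, $\mathrm{low}_{\mathrm{S}}(M)$ is the lower triangular matrix equal to the strictly lower triangular part of $M$ plus $\frac12\mathrm{Diag}(M)$. $\|\cdot\|$ is the Frobenius norm on matrices and the Euclidean norm on vectors. On $\mathbb{R}^{k+1}$ let $Q(x)=\sum_{i=1}^kx_i^2-x_{k+1}^2$, with associated symmetric bilinear form $Q(x,y)$. The hyperboloid $\mathbb{H}^k=\{x\in\mathbb{R}^{k+1}:Q(x)=-1,\ x_{k+1}>0\}$ with the metric $g^{\mathbb{H}}_x(v,v)=Q(v)$ is hyperbolic space. The open hemisphere is $\mathrm{H}\mathbb{S}^k=\{x\in\mathbb{R}^{k+1}:\|x\|=1,\ x_{k+1}>0\}$, with metric $g^{\mathrm{H}\mathbb{S}^k}=\varphi^*g^{\mathbb{H}}$ where $\varphi:\mathrm{H}\mathbb{S}^k\to\mathbb{H}^k$ is the diffeomorphism $\varphi(x_1,\dots,x_{k+1})=\frac{1}{x_{k+1}}(x_1,\dots,x_k,1)$. $\mathrm{Chol}$ restricts to a diffeomorphism from $\mathrm{Cor}^+(n)$ onto the set $\mathcal{L}$ of lower triangular matrices with positive diagonal whose rows all have Euclidean norm $1$. For $L\in\mathcal{L}$,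 the $k$-th row $(L_{k1},\dots,L_{kk},0,\dots,0)$ is identified with the point $(L_{k1},\dots,L_{kk})$ of $\mathrm{H}\mathbb{S}^{k-1}\subset\mathbb{R}^k$, and $L_{11}=1$; this gives a diffeomorphism $\Psi:\mathcal{L}\to\mathrm{H}\mathbb{S}^1\times\cdots\times\mathrm{H}\mathbb{S}^{n-1}$. For $\alpha_1,\dots,\alpha_{n-1}>0$, the poly-hyperbolic-Cholesky metric with weights $\alpha_1,\dots,\alpha_{n-1}$ is $(\Psi\circ\mathrm{Chol})^*(\alpha_1g^{\mathrm{H}\mathbb{S}^1}\oplus\cdots\oplus\alpha_{n-1}g^{\mathrm{H}\mathbb{S}^{n-1}})$.
   Formalization: The printed distance formula is false (for n=2, C=C′≠I it is nonzero); it is corrected to the sum of arcosh(−Q(φ(L_i),φ(L_i′)))², i.e. arccos is replaced by arcosh and the rows are first mapped to the hyperboloid by φ. *)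

theory Defs
  imports "HOL-Analysis.Analysis"
begin

section \<open>Riemannian geometry in a global affine chart\<close>

text \<open>
  A manifold is given here as a nonempty set \<open>U\<close> that is a relatively open subset of a translate of a
  linear subspace \<open>V\<close> of a Euclidean space. Every tangent space of \<open>U\<close> is then canonically \<open>V\<close>.
  Quantities are differentiated only along directions in \<open>V\<close>, since Frechet
  derivatives within \<open>U\<close> are not unique in the directions transverse to \<open>V\<close>.
\<close>

definition affine_domain :: "'a::euclidean_space set \<Rightarrow> 'a set \<Rightarrow> bool" where
  "affine_domain V U \<longleftrightarrow> subspace V \<and> U \<noteq> {} \<and> (\<forall>x\<in>U. \<forall>y\<in>U. y - x \<in> V) \<and>
     (\<forall>x\<in>U. \<exists>e>0. \<forall>v\<in>V. norm v < e \<longrightarrow> x + v \<in> U)"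

definition dir_deriv ::
    "('a::real_normed_vector \<Rightarrow> 'b::real_normed_vector) \<Rightarrow> 'a \<Rightarrow> 'a \<Rightarrow> 'b" where
  "dir_deriv f x v = vector_derivative (\<lambda>t::real. f (x + t *\<^sub>R v)) (at 0)"

primrec Ck_on ::
    "nat \<Rightarrow> 'a::euclidean_space set \<Rightarrow> 'a set \<Rightarrow> ('a \<Rightarrow> 'b::real_normed_vector) \<Rightarrow> bool" where
  "Ck_on 0 V U f \<longleftrightarrow> continuous_on U f"
| "Ck_on (Suc k) V U f \<longleftrightarrow> continuous_on U f \<and>
     (\<forall>v\<in>V. (\<forall>x\<in>U. (\<lambda>t::real. f (x + t *\<^sub>R v)) differentiable (at 0)) \<and>
            Ck_on k V U (\<lambda>x. dir_deriv f x v))"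

definition smooth_on ::
    "'a::euclidean_space set \<Rightarrow> 'a set \<Rightarrow> ('a \<Rightarrow> 'b::real_normed_vector) \<Rightarrow> bool" where
  "smooth_on V U f \<longleftrightarrow> (\<forall>k. Ck_on k V U f)"

type_synonym 'a metric_tensor = "'a \<Rightarrow> 'a \<Rightarrow> 'a \<Rightarrow> real"

definition riemannian_manifold ::
    "'a::euclidean_space set \<Rightarrow> 'a set \<Rightarrow> 'a metric_tensor \<Rightarrow> bool" where
  "riemannian_manifold V U g \<longleftrightarrow> affine_domain V U \<and>
     (\<forall>x\<in>U.
        (\<forall>u\<in>V. \<forall>v\<in>V. g x u v = g x v u) \<and>
        (\<forall>u\<in>V. \<forall>v\<in>V. \<forall>w\<in>V. \<forall>a b. g x (a *\<^sub>R u + b *\<^sub>R v) w = a * g x u w + b * g x v w) \<and>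
        (\<forall>u\<in>V. u \<noteq> 0 \<longrightarrow> 0 < g x u u)) \<and>
     (\<forall>u\<in>V. \<forall>v\<in>V. smooth_on V U (\<lambda>x. g x u v))"

definition pullback ::
    "('a::real_normed_vector \<Rightarrow> 'b::real_normed_vector) \<Rightarrow> 'b metric_tensor \<Rightarrow> 'a metric_tensor" where
  "pullback f g x u v = g (f x) (dir_deriv f x u) (dir_deriv f x v)"

definition riemannian_isometry ::
    "'a::euclidean_space set \<Rightarrow> 'a set \<Rightarrow> 'a metric_tensor \<Rightarrow> ('a \<Rightarrow> 'a) \<Rightarrow> bool" where
  "riemannian_isometry V U g s \<longleftrightarrow> bij_betw s U U \<and>
     smooth_on V U s \<and> smooth_on V U (the_inv_into U s) \<and>
     (\<forall>x\<in>U. \<forall>u\<in>V. \<forall>v\<in>V. pullback s g x u v = g x u v)"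

definition riemannian_symmetric_space ::
    "'a::euclidean_space set \<Rightarrow> 'a set \<Rightarrow> 'a metric_tensor \<Rightarrow> bool" where
  "riemannian_symmetric_space V U g \<longleftrightarrow> riemannian_manifold V U g \<and> connected U \<and>
     (\<forall>p\<in>U. \<exists>s. riemannian_isometry V U g s \<and> s p = p \<and> (\<forall>v\<in>V. dir_deriv s p v = - v))"

text \<open>Koszul's formula for constant vector fields, which commute.\<close>

definition christoffel ::
    "'a::euclidean_space set \<Rightarrow> 'a metric_tensor \<Rightarrow> 'a \<Rightarrow> 'a \<Rightarrow> 'a \<Rightarrow> 'a" where
  "christoffel V g x u v = (THE z. z \<in> V \<and> (\<forall>w\<in>V.
     2 * g x z w = dir_deriv (\<lambda>y. g y v w) x u + dir_deriv (\<lambda>y. g y u w) x v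
                   - dir_deriv (\<lambda>y. g y u v) x w))"

definition levi_civita ::
    "'a::euclidean_space set \<Rightarrow> 'a metric_tensor \<Rightarrow> ('a \<Rightarrow> 'a) \<Rightarrow> ('a \<Rightarrow> 'a) \<Rightarrow> 'a \<Rightarrow> 'a" where
  "levi_civita V g X Y x = dir_deriv Y x (X x) + christoffel V g x (X x) (Y x)"

definition lie_bracket ::
    "('a::euclidean_space \<Rightarrow> 'a) \<Rightarrow> ('a \<Rightarrow> 'a) \<Rightarrow> 'a \<Rightarrow> 'a" where
  "lie_bracket X Y x = dir_deriv Y x (X x) - dir_deriv X x (Y x)"

definition curvature_tensor ::
    "'a::euclidean_space set \<Rightarrow> 'a metric_tensor \<Rightarrow>
     ('a \<Rightarrow> 'a) \<Rightarrow> ('a \<Rightarrow> 'a) \<Rightarrow> ('a \<Rightarrow> 'a) \<Rightarrow> 'a \<Rightarrow> 'a" where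
  "curvature_tensor V g X Y Z x =
     levi_civita V g X (levi_civita V g Y Z) x - levi_civita V g Y (levi_civita V g X Z) x
     - levi_civita V g (lie_bracket X Y) Z x"

text \<open>The vectors \<open>u\<close>, \<open>v\<close> are extended to constant vector fields; round spheres have positive
  sectional curvature in this sign convention.\<close>

definition sectional_curvature ::
    "'a::euclidean_space set \<Rightarrow> 'a metric_tensor \<Rightarrow> 'a \<Rightarrow> 'a \<Rightarrow> 'a \<Rightarrow> real" where
  "sectional_curvature V g x u v =
     g x (curvature_tensor V g (\<lambda>_. u) (\<lambda>_. v) (\<lambda>_. v) x) u /
     (g x u u * g x v v - (g x u v)\<^sup>2)"

definition sectional_curvatures ::
    "'a::euclidean_space set \<Rightarrow> 'a set \<Rightarrow> 'a metric_tensor \<Rightarrow> real set" where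
  "sectional_curvatures V U g =
     {sectional_curvature V g x u v | x u v. x \<in> U \<and> u \<in> V \<and> v \<in> V \<and> u \<noteq> v \<and> independent {u, v}}"

definition constant_curvature ::
    "'a::euclidean_space set \<Rightarrow> 'a set \<Rightarrow> 'a metric_tensor \<Rightarrow> bool" where
  "constant_curvature V U g \<longleftrightarrow> (\<exists>c. sectional_curvatures V U g \<subseteq> {c})"

text \<open>
  The speed of a path is required to have an integral: a \<^const>\<open>valid_path\<close> may have infinite length, and
  \<^const>\<open>integral\<close> would assign it length 0. Two-sided derivatives at the finitely many break and end
  points do not affect the integral.
\<close>

definition riemannian_dist ::
    "'a::euclidean_space set \<Rightarrow> 'a metric_tensor \<Rightarrow> 'a \<Rightarrow> 'a \<Rightarrow> real" where
  "riemannian_dist U g x y = Inf {l. \<exists>c. valid_path c \<and> path_image c \<subseteq> U \<and>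
     pathstart c = x \<and> pathfinish c = y \<and>
     ((\<lambda>t. sqrt (g (c t) (vector_derivative c (at t)) (vector_derivative c (at t)))) has_integral l)
       {0..1}}"


section \<open>Correlation matrices and the Cholesky map\<close>

definition Cor_pos :: "(real^'n^'n) set" where
  "Cor_pos = {C. transpose C = C \<and> (\<forall>x. x \<noteq> 0 \<longrightarrow> 0 < x \<bullet> (C *v x)) \<and> (\<forall>i. C $ i $ i = 1)}"

definition Hol :: "(real^'n^'n) set" where
  "Hol = {X. transpose X = X \<and> (\<forall>i. X $ i $ i = 0)}"

definition lower_triangular ::
    "real^'n::{finite,linorder}^'n::{finite,linorder} \<Rightarrow> bool" where
  "lower_triangular L \<longleftrightarrow> (\<forall>i j. i < j \<longrightarrow> L $ i $ j = 0)"

definition Chol ::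
    "real^'n::{finite,linorder}^'n::{finite,linorder} \<Rightarrow>
     real^'n::{finite,linorder}^'n::{finite,linorder}" where
  "Chol C = (THE L. lower_triangular L \<and> (\<forall>i. 0 < L $ i $ i) \<and> C = L ** transpose L)"

definition unit_row_factors :: "(real^'n::{finite,linorder}^'n::{finite,linorder}) set" where
  "unit_row_factors =
     {L. lower_triangular L \<and> (\<forall>i. 0 < L $ i $ i) \<and> (\<forall>i. norm (row i L) = 1)}"

definition Diag :: "real^'n^'n \<Rightarrow> real^'n^'n" where
  "Diag M = (\<chi> i j. if i = j then M $ i $ j else 0)"

definition low_S ::
    "real^'n::{finite,linorder}^'n::{finite,linorder} \<Rightarrow>
     real^'n::{finite,linorder}^'n::{finite,linorder}" where
  "low_S M = (\<chi> i j. if j < i then M $ i $ j else if i = j then M $ i $ i / 2 else 0)"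


section \<open>Poly-hyperbolic-Cholesky metrics\<close>

text \<open>
  With \<open>k\<close> the number of indices below \<open>i\<close>, the space of \<open>(k+1)\<close>-vectors is identified with the vectors
  supported on \<open>{..i}\<close>, so that \<open>x $ i\<close> is the last coordinate. In this identification \<open>hyp_form i\<close> is
  \<open>Q\<close>, \<open>hs_to_hyp i\<close> is the diffeomorphism from the open hemisphere of dimension \<open>k\<close>
  onto the hyperboloid of dimension \<open>k\<close>, and \<open>hs_metric i\<close> is the hemisphere metric. The formula for
  \<open>hs_to_hyp i\<close> makes sense whenever \<open>x $ i \<noteq> 0\<close>, so on tangent vectors of the hemisphere its ambient
  directional derivative is its differential.
\<close>

definition index_pos :: "'n::{finite,linorder} \<Rightarrow> nat" where
  "index_pos i = card {..<i}"

definition hyp_form ::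
    "'n::{finite,linorder} \<Rightarrow> real^'n::{finite,linorder} \<Rightarrow> real^'n::{finite,linorder} \<Rightarrow> real" where
  "hyp_form i x y = (\<Sum>j\<in>{..<i}. x $ j * y $ j) - x $ i * y $ i"

definition hs_to_hyp ::
    "'n::{finite,linorder} \<Rightarrow> real^'n::{finite,linorder} \<Rightarrow> real^'n::{finite,linorder}" where
  "hs_to_hyp i x = (1 / x $ i) *\<^sub>R (\<chi> j. if j < i then x $ j else if j = i then 1 else 0)"

definition hs_metric ::
    "'n::{finite,linorder} \<Rightarrow> (real^'n::{finite,linorder}) metric_tensor" where
  "hs_metric i = pullback (hs_to_hyp i) (\<lambda>_. hyp_form i)"

text \<open>
  A point of the product of hemispheres is a vector of vectors. The entry at the least
  index is the one-point hemisphere of dimension 0, which is omitted; the factor of dimension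
  \<open>k \<ge> 1\<close> carries the weight \<open>\<alpha> k\<close>.
\<close>

definition hs_product_metric ::
    "(nat \<Rightarrow> real) \<Rightarrow> (real^'n::{finite,linorder}^'n::{finite,linorder}) metric_tensor" where
  "hs_product_metric \<alpha> p u v =
     (\<Sum>i | 1 \<le> index_pos i. \<alpha> (index_pos i) * hs_metric i (p $ i) (u $ i) (v $ i))"

definition rows_map ::
    "real^'n::{finite,linorder}^'n::{finite,linorder} \<Rightarrow>
     real^'n::{finite,linorder}^'n::{finite,linorder}" where
  "rows_map L = (\<chi> i. row i L)"

definition phc_metric ::
    "(nat \<Rightarrow> real) \<Rightarrow> (real^'n::{finite,linorder}^'n::{finite,linorder}) metric_tensor" where
  "phc_metric \<alpha> = pullback (rows_map \<circ> Chol) (hs_product_metric \<alpha>)"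

definition cphc_metric :: "(real^'n::{finite,linorder}^'n::{finite,linorder}) metric_tensor" where
  "cphc_metric = phc_metric (\<lambda>_. 1)"

end

theory Submission
  imports Defs
begin

text \<open>
  Sending the rows of the Cholesky factor to their hyperboloids gives a diffeomorphism \<open>F\<close> of the manifold
  of correlation matrices onto a product of hyperboloids, and the metric is the restriction of a
  weighted sum of Minkowski forms \<open>Q\<close>. The unit normal of a hyperboloid is its position vector, so the Gauss formula
  reads \<open>DF (\<Gamma>(u, v)) = D\<^sup>2F(u, v) - Q(DF u, DF v) F\<close>; differentiating it once more gives the curvature tensor of a
  product of hyperbolic spaces. Geodesic symmetries are linear reflections of Minkowski space, and
  the lower bound for the length of paths is a calibration by signed distances to totally geodesic hypersurfaces.
\<close>

section \<open>Elementary functions and directional derivatives\<close>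

text \<open>Two features of the definitions shape the proof. Derivatives are controlled only along
  \<open>V\<close>, since the correlation matrices have empty interior among all matrices, and the
  Christoffel symbol is given by a description operator, hence without a formula to differentiate
  for the curvature. Both are met by an inverse chart \<open>H\<close> that is total: precomposed
  with the retraction \<open>hyp_lift\<close>, it is differentiable on the whole matrix space, it
  shows that \<open>DF\<close> is onto the tangent spaces, and it turns the Christoffel symbol into
  \<open>dir_deriv H (F x) (gauss x u v)\<close>. The geometry uses only the identities between
  \<open>F\<close> and \<open>H\<close>; Cholesky factors enter when the locale is instantiated.

  The constant of the curvature bound: in factor \<open>i\<close> the numerator of the sectional
  curvature is \<open>- w i\<close> times a Gram determinant, which enters the denominator with
  \<open>(w i)^2\<close>. Gram determinants are superadditive over the factors, so the quotient is
  at least \<open>- 1 / m\<close> for the smallest weight \<open>m\<close>; factors of dimension at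
  most 1 have vanishing Gram determinant, which is why the minimum starts at 2.\<close>

text \<open>
  This class contains all maps below (entries of Cholesky factors, geodesics, reflections). It is closed under
  differentiation by a single induction, which also gives the symmetry of second derivatives, so that
  smoothness never has to be proved order by order.
\<close>

inductive elementary_on :: "'a::euclidean_space set \<Rightarrow> ('a \<Rightarrow> real) \<Rightarrow> bool" for U where
  const: "elementary_on U (\<lambda>_. c)"
| coord: "elementary_on U (\<lambda>x. x \<bullet> b)"
| add: "elementary_on U f \<Longrightarrow> elementary_on U g \<Longrightarrow> elementary_on U (\<lambda>x. f x + g x)"
| mult: "elementary_on U f \<Longrightarrow> elementary_on U g \<Longrightarrow> elementary_on U (\<lambda>x. f x * g x)"
| inverse: "elementary_on U f \<Longrightarrow> \<forall>x\<in>U. f x \<noteq> 0 \<Longrightarrow> elementary_on U (\<lambda>x. inverse (f x))"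
| sqrt: "elementary_on U f \<Longrightarrow> \<forall>x\<in>U. 0 < f x \<Longrightarrow> elementary_on U (\<lambda>x. sqrt (f x))"
| exp: "elementary_on U f \<Longrightarrow> elementary_on U (\<lambda>x. exp (f x))"
| cong: "elementary_on U f \<Longrightarrow> \<forall>x\<in>U. g x = f x \<Longrightarrow> elementary_on U g"

lemma elementary_uminus: "elementary_on U f \<Longrightarrow> elementary_on U (\<lambda>x. - f x)"
  using elementary_on.mult[OF elementary_on.const[of U "-1"], of f] by simp

lemma elementary_diff:
  "elementary_on U f \<Longrightarrow> elementary_on U g \<Longrightarrow> elementary_on U (\<lambda>x. f x - g x)"
  using elementary_on.add[OF _ elementary_uminus, of U f g] by simp

lemma elementary_divide:
  "elementary_on U f \<Longrightarrow> elementary_on U g \<Longrightarrow> \<forall>x\<in>U. g x \<noteq> 0 \<Longrightarrow> elementary_on U (\<lambda>x. f x / g x)"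
  unfolding divide_inverse by (intro elementary_on.mult elementary_on.inverse)

lemma elementary_divide_const: "elementary_on U f \<Longrightarrow> elementary_on U (\<lambda>x. f x / c)"
  unfolding divide_inverse by (intro elementary_on.mult elementary_on.const)

lemma elementary_sum:
  "(\<And>i. i \<in> A \<Longrightarrow> elementary_on U (f i)) \<Longrightarrow> elementary_on U (\<lambda>x. \<Sum>i\<in>A. f i x)"
  by (induction A rule: infinite_finite_induct) (auto intro: elementary_on.const elementary_on.add)

lemma elementary_power: "elementary_on U f \<Longrightarrow> elementary_on U (\<lambda>x. f x ^ k)"
  by (induction k) (auto intro: elementary_on.const elementary_on.mult)

lemma elementary_if:
  "(b \<Longrightarrow> elementary_on U f) \<Longrightarrow> (\<not> b \<Longrightarrow> elementary_on U g) \<Longrightarrow>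
   elementary_on U (\<lambda>x. if b then f x else g x)"
  by (cases b) simp_all

lemmas elementary_intros = elementary_on.const elementary_on.coord elementary_on.add
  elementary_on.mult elementary_on.exp elementary_uminus elementary_diff elementary_sum
  elementary_power elementary_if elementary_divide_const

lemma elementary_cosh: "elementary_on U f \<Longrightarrow> elementary_on U (\<lambda>x. cosh (f x))"
  by (auto simp: cosh_def intro!: elementary_intros)

lemma elementary_sinh: "elementary_on U f \<Longrightarrow> elementary_on U (\<lambda>x. sinh (f x))"
  by (auto simp: sinh_def intro!: elementary_intros)

text \<open>Within a thin set \<open>U\<close> a derivative is not unique. The induction selects one
  by the differentiation rules, defined in every direction \<open>v\<close>, and its dependence on
  the base point is again elementary, so the statement can be iterated.\<close>

lemma elementary_derivative:
  assumes "elementary_on U f"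
  shows "\<exists>f'. (\<forall>v. elementary_on U (\<lambda>x. f' x v)) \<and>
    (\<forall>x\<in>U. (f has_derivative f' x) (at x within U))"
  using assms
proof induction
  case (const c)
  show ?case by (intro exI[of _ "\<lambda>x v. 0"]) (auto intro: elementary_intros)
next
  case (coord b)
  show ?case
    by (intro exI[of _ "\<lambda>x v. v \<bullet> b"]) (auto intro!: elementary_intros derivative_eq_intros)
next
  case (add f g)
  then obtain f' g' where "\<forall>v. elementary_on U (\<lambda>x. f' x v)" "\<forall>v. elementary_on U (\<lambda>x. g' x v)"
    "\<forall>x\<in>U. (f has_derivative f' x) (at x within U)" "\<forall>x\<in>U. (g has_derivative g' x) (at x within U)"
    by auto
  then show ?case
    by (intro exI[of _ "\<lambda>x v. f' x v + g' x v"]) (auto intro!: elementary_intros derivative_eq_intros)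
next
  case (mult f g)
  then obtain f' g' where "\<forall>v. elementary_on U (\<lambda>x. f' x v)" "\<forall>v. elementary_on U (\<lambda>x. g' x v)"
    "\<forall>x\<in>U. (f has_derivative f' x) (at x within U)" "\<forall>x\<in>U. (g has_derivative g' x) (at x within U)"
    by auto
  with mult(1,2) show ?case
    by (intro exI[of _ "\<lambda>x v. f x * g' x v + f' x v * g x"])
      (auto intro!: elementary_intros has_derivative_mult)
next
  case (inverse f)
  then obtain f' where "\<forall>v. elementary_on U (\<lambda>x. f' x v)"
    "\<forall>x\<in>U. (f has_derivative f' x) (at x within U)"
    by auto
  with inverse(1,2) show ?case
    by (intro exI[of _ "\<lambda>x v. - (inverse (f x) * f' x v * inverse (f x))"])
      (auto intro!: elementary_intros elementary_on.inverse derivative_eq_intros)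
next
  case (sqrt f)
  then obtain f' where "\<forall>v. elementary_on U (\<lambda>x. f' x v)"
    "\<forall>x\<in>U. (f has_derivative f' x) (at x within U)"
    by auto
  with sqrt(1,2) show ?case
    by (intro exI[of _ "\<lambda>x v. f' x v * (inverse (sqrt (f x)) / 2)"])
      (fastforce intro!: elementary_intros elementary_on.inverse elementary_on.sqrt
        elementary_divide derivative_eq_intros)
next
  case (exp f)
  then obtain f' where "\<forall>v. elementary_on U (\<lambda>x. f' x v)"
    "\<forall>x\<in>U. (f has_derivative f' x) (at x within U)"
    by auto
  with exp(1) show ?case
    by (intro exI[of _ "\<lambda>x v. exp (f x) * f' x v"])
      (auto intro!: elementary_intros derivative_eq_intros)
next
  case (cong f g)
  then obtain f' where "\<forall>v. elementary_on U (\<lambda>x. f' x v)"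
    "\<forall>x\<in>U. (f has_derivative f' x) (at x within U)"
    by auto
  with cong(2) show ?case
    by (intro exI[of _ f']) (auto intro: has_derivative_transform)
qed

text \<open>Symmetry is demanded of the chosen \<open>f''\<close> itself: within a set with empty
  interior the second derivative is not determined by \<open>f\<close>.\<close>

definition has_second_derivatives_on ::
    "('a::real_normed_vector \<Rightarrow> real) \<Rightarrow> ('a \<Rightarrow> 'a \<Rightarrow> real) \<Rightarrow> ('a \<Rightarrow> 'a \<Rightarrow> 'a \<Rightarrow> real) \<Rightarrow> 'a set \<Rightarrow> bool"
  where
  "has_second_derivatives_on f f' f'' U \<longleftrightarrow> (\<forall>x\<in>U. (f has_derivative f' x) (at x within U) \<and>
    (\<forall>v. ((\<lambda>y. f' y v) has_derivative f'' x v) (at x within U)) \<and> (\<forall>u v. f'' x u v = f'' x v u))"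

lemma has_second_derivatives_onD:
  assumes "has_second_derivatives_on f f' f'' U" "x \<in> U"
  shows "(f has_derivative f' x) (at x within U)"
    "((\<lambda>y. f' y v) has_derivative f'' x v) (at x within U)"
    "f'' x u v = f'' x v u"
  using assms by (simp_all add: has_second_derivatives_on_def)

text \<open>The differentiation rules build the second derivative from expressions that are
  symmetric in the two directions, so symmetry passes through the induction without any continuity
  argument.\<close>

lemma elementary_second_derivatives:
  assumes "elementary_on U f"
  shows "\<exists>f' f''. has_second_derivatives_on f f' f'' U"
  using assms
proof induction
  case (const c)
  show ?case
    unfolding has_second_derivatives_on_def by (intro exI[of _ "\<lambda>x v. 0"] exI[of _ "\<lambda>x u v. 0"]) auto
next
  case (coord b)
  show ?case
    unfolding has_second_derivatives_on_def
    by (intro exI[of _ "\<lambda>x v. v \<bullet> b"] exI[of _ "\<lambda>x u v. 0"]) (auto intro!: derivative_eq_intros)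
next
  case (add f g)
  then obtain f' g' f'' g'' where
    "has_second_derivatives_on f f' f'' U" "has_second_derivatives_on g g' g'' U"
    by (elim exE)
  note f = has_second_derivatives_onD[OF this(1)] and g = has_second_derivatives_onD[OF this(2)]
  show ?case
    unfolding has_second_derivatives_on_def
    by (intro exI[of _ "\<lambda>x v. f' x v + g' x v"] exI[of _ "\<lambda>x u v. f'' x u v + g'' x u v"]
        ballI conjI allI has_derivative_add f g) (simp_all add: f(3) g(3))
next
  case (mult f g)
  then obtain f' g' f'' g'' where
    "has_second_derivatives_on f f' f'' U" "has_second_derivatives_on g g' g'' U"
    by (elim exE)
  note f = has_second_derivatives_onD[OF this(1)] and g = has_second_derivatives_onD[OF this(2)]
  show ?case
    unfolding has_second_derivatives_on_def
    by (intro exI[of _ "\<lambda>x v. f x * g' x v + f' x v * g x"]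
        exI[of _ "\<lambda>x u v. (f x * g'' x u v + f' x v * g' x u) + (f' x u * g' x v + f'' x u v * g x)"]
        ballI conjI allI has_derivative_mult has_derivative_add f g)
      (simp_all add: f(3) g(3))
next
  case (inverse f)
  then obtain f' f'' where "has_second_derivatives_on f f' f'' U"
    by (elim exE)
  note f = has_second_derivatives_onD[OF this]
  note [derivative_intros] = f(1,2)
  show ?case
    unfolding has_second_derivatives_on_def
    by (intro exI[of _ "\<lambda>x v. - (inverse (f x) * f' x v * inverse (f x))"]
        exI[of _ "\<lambda>x u v. 2 * inverse (f x) ^ 3 * f' x u * f' x v - inverse (f x) ^ 2 * f'' x u v"]
        ballI conjI allI)
      (use inverse(2) in \<open>auto intro!: derivative_eq_intros simp: f(3) field_simps power2_eq_square power3_eq_cube\<close>)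
next
  case (sqrt f)
  then obtain f' f'' where "has_second_derivatives_on f f' f'' U"
    by (elim exE)
  note f = has_second_derivatives_onD[OF this]
  note [derivative_intros] = f(1,2)
  have nz: "sqrt (f x) \<noteq> 0" if "x \<in> U" for x
    using sqrt(2) that by fastforce
  show ?case
    unfolding has_second_derivatives_on_def
    by (intro exI[of _ "\<lambda>x v. f' x v * (inverse (sqrt (f x)) / 2)"]
        exI[of _ "\<lambda>x u v. f'' x u v * (inverse (sqrt (f x)) / 2) -
          f' x u * f' x v * inverse (sqrt (f x)) ^ 3 / 4"]
        ballI conjI allI)
      (use sqrt(2) nz in \<open>auto intro!: derivative_eq_intros simp: f(3) field_simps power2_eq_square power3_eq_cube\<close>)
next
  case (exp f)
  then obtain f' f'' where "has_second_derivatives_on f f' f'' U"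
    by (elim exE)
  note f = has_second_derivatives_onD[OF this]
  note [derivative_intros] = f(1,2)
  show ?case
    unfolding has_second_derivatives_on_def
    by (intro exI[of _ "\<lambda>x v. exp (f x) * f' x v"]
        exI[of _ "\<lambda>x u v. exp (f x) * f' x v * f' x u + exp (f x) * f'' x u v"] ballI conjI allI)
      (auto intro!: derivative_eq_intros simp: f(3))
next
  case (cong f g)
  then obtain f' f'' where "has_second_derivatives_on f f' f'' U"
    by (elim exE)
  note f = has_second_derivatives_onD[OF this]
  show ?case
    unfolding has_second_derivatives_on_def
    by (intro exI[of _ f'] exI[of _ f'']) (use cong(2) f in \<open>auto intro: has_derivative_transform\<close>)
qed

section \<open>Vector-valued elementary maps\<close>

definition elementary_map ::
    "'a::euclidean_space set \<Rightarrow> ('a \<Rightarrow> 'b::euclidean_space) \<Rightarrow> bool" where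
  "elementary_map U f \<longleftrightarrow> (\<forall>b\<in>Basis. elementary_on U (\<lambda>x. f x \<bullet> b))"

lemma elementary_map_real: "elementary_map U f \<longleftrightarrow> elementary_on U (f :: _ \<Rightarrow> real)"
  by (simp add: elementary_map_def)

lemma elementary_map_matrix:
  "elementary_map U f \<longleftrightarrow> (\<forall>i j. elementary_on U (\<lambda>x. (f x :: real^'n^'m) $ i $ j))"
  unfolding elementary_map_def
  by (auto simp: Basis_vec_def inner_axis)

lemma elementary_map_vec:
  "elementary_map U f \<longleftrightarrow> (\<forall>i. elementary_on U (\<lambda>x. (f x :: real^'n) $ i))"
  unfolding elementary_map_def
  by (auto simp: Basis_vec_def inner_axis)

lemma elementary_map_inner: "elementary_map U f \<Longrightarrow> elementary_on U (\<lambda>x. f x \<bullet> v)"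
proof -
  assume "elementary_map U f"
  then have "elementary_on U (\<lambda>x. \<Sum>b\<in>Basis. (f x \<bullet> b) * (v \<bullet> b))"
    by (auto simp: elementary_map_def intro!: elementary_intros)
  then show ?thesis
    by (subst euclidean_inner)
qed

lemma elementary_map_cong:
  "elementary_map U f \<Longrightarrow> (\<And>x. x \<in> U \<Longrightarrow> g x = f x) \<Longrightarrow> elementary_map U g"
  unfolding elementary_map_def by (intro ballI) (rule elementary_on.cong, auto)

lemma elementary_compose:
  assumes "elementary_on W h" "elementary_map U f" "f ` U \<subseteq> W"
  shows "elementary_on U (\<lambda>x. h (f x))"
  using assms(1)
proof induction
  case (coord b)
  show ?case using elementary_map_inner[OF assms(2)] .
next
  case (cong f g)
  then show ?case using assms(3) by (intro elementary_on.cong[OF cong.IH]) auto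
qed (use assms(3) in \<open>auto intro!: elementary_on.const elementary_on.add elementary_on.mult
  elementary_on.inverse elementary_on.sqrt elementary_on.exp\<close>)

lemma elementary_map_compose:
  "elementary_map W h \<Longrightarrow> elementary_map U f \<Longrightarrow> f ` U \<subseteq> W \<Longrightarrow> elementary_map U (\<lambda>x. h (f x))"
  using elementary_compose[of W _ U f] unfolding elementary_map_def by blast

lemma elementary_map_ident: "elementary_map U (\<lambda>x. x)"
  by (auto simp: elementary_map_def intro: elementary_intros)

lemma elementary_map_derivative:
  assumes "elementary_map U f"
  shows "\<exists>f'. (\<forall>v. elementary_map U (\<lambda>x. f' x v)) \<and>
    (\<forall>x\<in>U. (f has_derivative f' x) (at x within U))"
proof -
  have "\<forall>b\<in>Basis. \<exists>f'. (\<forall>v. elementary_on U (\<lambda>x. f' x v)) \<and>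
      (\<forall>x\<in>U. ((\<lambda>x. f x \<bullet> b) has_derivative f' x) (at x within U))"
    using assms elementary_derivative unfolding elementary_map_def by blast
  from bchoice[OF this] obtain d where d: "\<And>b v. b \<in> Basis \<Longrightarrow> elementary_on U (\<lambda>x. d b x v)"
      "\<And>b x. b \<in> Basis \<Longrightarrow> x \<in> U \<Longrightarrow> ((\<lambda>x. f x \<bullet> b) has_derivative d b x) (at x within U)"
    by blast
  show ?thesis
  proof (intro exI[of _ "\<lambda>x v. \<Sum>b\<in>Basis. d b x v *\<^sub>R b"] conjI allI ballI)
    show "elementary_map U (\<lambda>x. \<Sum>b\<in>Basis. d b x v *\<^sub>R b)" for v
      using d(1) by (simp add: elementary_map_def)
    show "(f has_derivative (\<lambda>v. \<Sum>b\<in>Basis. d b x v *\<^sub>R b)) (at x within U)" if "x \<in> U" for x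
      using d(2) that by (subst has_derivative_componentwise_within) simp
  qed
qed

lemma elementary_map_continuous: "elementary_map U f \<Longrightarrow> continuous_on U f"
  by (drule elementary_map_derivative) (auto intro: has_derivative_continuous_on)

section \<open>Directional calculus on an affine chart\<close>

locale affine_chart =
  fixes V U :: "'a::euclidean_space set"
  assumes affine_domain: "affine_domain V U"
begin

lemma subspace_V: "subspace V"
  using affine_domain by (simp add: affine_domain_def)

lemma diff_in_V: "x \<in> U \<Longrightarrow> y \<in> U \<Longrightarrow> y - x \<in> V"
  using affine_domain by (simp add: affine_domain_def)

lemma eventually_line_in:
  assumes "x \<in> U" "v \<in> V"
  shows "\<forall>\<^sub>F t in nhds 0. x + t *\<^sub>R v \<in> U"
proof -
  obtain e where e: "e > 0" "\<And>w. w \<in> V \<Longrightarrow> norm w < e \<Longrightarrow> x + w \<in> U"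
    using affine_domain assms(1) unfolding affine_domain_def by blast
  have "((\<lambda>t. norm (t *\<^sub>R v)) \<longlongrightarrow> norm (0 *\<^sub>R v)) (nhds (0::real))"
    by (intro tendsto_intros filterlim_ident)
  then have "\<forall>\<^sub>F t in nhds (0::real). norm (t *\<^sub>R v) < e"
    using e(1) by (intro order_tendstoD(2)[of _ "norm (0 *\<^sub>R v)"]) auto
  then show ?thesis
    by eventually_elim (use e(2) subspace_V assms(2) subspace_scale in blast)
qed

text \<open>For small \<open>t\<close> the line stays in \<open>U\<close>, so a derivative within
  \<open>U\<close> already gives a two-sided derivative along directions in \<open>V\<close>. Hence
  all derivatives within \<open>U\<close> agree with \<open>dir_deriv\<close> on
  \<open>V\<close>.\<close>

lemma line_vector_derivative:
  assumes "x \<in> U" "v \<in> V" "(f has_derivative f') (at x within U)"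
  shows "((\<lambda>t::real. f (x + t *\<^sub>R v)) has_vector_derivative f' v) (at 0)"
proof -
  obtain S where S: "open S" "0 \<in> S" "\<And>t. t \<in> S \<Longrightarrow> x + t *\<^sub>R v \<in> U"
    using eventually_line_in[OF assms(1,2)] unfolding eventually_nhds by blast
  have "((\<lambda>t. x + t *\<^sub>R v) has_derivative (\<lambda>t. t *\<^sub>R v)) (at 0 within S)"
    by (auto intro!: derivative_eq_intros)
  moreover have "(f has_derivative f') (at (x + 0 *\<^sub>R v) within (\<lambda>t. x + t *\<^sub>R v) ` S)"
    using assms(3) S(3) by (auto intro: has_derivative_subset)
  ultimately have "((\<lambda>t. f (x + t *\<^sub>R v)) has_derivative (\<lambda>t. f' (t *\<^sub>R v))) (at 0 within S)"
    by (rule has_derivative_in_compose)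
  moreover have "f' (t *\<^sub>R v) = t *\<^sub>R f' v" for t
    using has_derivative_linear[OF assms(3)] by (rule linear_cmul)
  ultimately show ?thesis
    unfolding has_vector_derivative_def using at_within_open[OF S(2,1)] by simp
qed

lemma dir_deriv_eq:
  assumes "x \<in> U" "v \<in> V" "(f has_derivative f') (at x within U)"
  shows "dir_deriv f x v = f' v"
  unfolding dir_deriv_def using line_vector_derivative[OF assms] by (rule vector_derivative_at)

lemma dir_deriv_cong:
  assumes "x \<in> U" "v \<in> V" "\<And>y. y \<in> U \<Longrightarrow> f y = g y"
  shows "dir_deriv f x v = dir_deriv g x v"
  unfolding dir_deriv_def
  by (intro vector_derivative_cong_eq refl eventually_mono[OF eventually_line_in[OF assms(1,2)]])
    (auto simp: assms)

lemma dir_derivative: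
  assumes "elementary_map U f" "x \<in> U"
  obtains f' where "(f has_derivative f') (at x within U)" "\<And>v. v \<in> V \<Longrightarrow> f' v = dir_deriv f x v"
proof -
  obtain f' where "\<forall>x\<in>U. (f has_derivative f' x) (at x within U)"
    using elementary_map_derivative[OF assms(1)] by (elim exE conjE)
  then have f': "(f has_derivative f' x) (at x within U)"
    using assms(2) by simp
  show thesis
    by (rule that[OF f']) (use dir_deriv_eq[OF assms(2) _ f'] in simp)
qed

lemma elementary_map_dir_deriv:
  assumes "elementary_map U f" "v \<in> V"
  shows "elementary_map U (\<lambda>x. dir_deriv f x v)"
proof -
  obtain f' where f': "\<forall>v. elementary_map U (\<lambda>x. f' x v)"
    "\<forall>x\<in>U. (f has_derivative f' x) (at x within U)"
    using elementary_map_derivative[OF assms(1)] by (elim exE conjE)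
  show ?thesis
    by (rule elementary_map_cong[OF f'(1)[THEN spec[of _ v]]])
      (rule dir_deriv_eq[OF _ assms(2) f'(2)[THEN bspec]])
qed

lemma elementary_map_smooth_on:
  assumes "elementary_map U f"
  shows "smooth_on V U f"
proof -
  have "Ck_on k V U f" for k
    using assms
  proof (induction k arbitrary: f)
    case 0
    then show ?case by (simp add: elementary_map_continuous)
  next
    case (Suc k)
    have "(\<lambda>t::real. f (x + t *\<^sub>R v)) differentiable (at 0)" if x: "x \<in> U" and v: "v \<in> V" for x v
    proof -
      obtain f' where "(f has_derivative f') (at x within U)"
        using dir_derivative[OF Suc.prems x] by blast
      from line_vector_derivative[OF x v this] show ?thesis
        unfolding differentiable_def has_vector_derivative_def by (intro exI)
    qed
    then show ?case
      using Suc by (simp add: elementary_map_continuous elementary_map_dir_deriv)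
  qed
  then show ?thesis by (simp add: smooth_on_def)
qed

lemma dir_deriv_linear:
  assumes "elementary_map U f" "x \<in> U" "u \<in> V" "v \<in> V"
  shows "dir_deriv f x (a *\<^sub>R u + b *\<^sub>R v) = a *\<^sub>R dir_deriv f x u + b *\<^sub>R dir_deriv f x v"
proof -
  obtain f' where f': "(f has_derivative f') (at x within U)" "\<And>v. v \<in> V \<Longrightarrow> f' v = dir_deriv f x v"
    using dir_derivative[OF assms(1,2)] by blast
  have "a *\<^sub>R u + b *\<^sub>R v \<in> V"
    using assms subspace_V by (simp add: subspace_add subspace_scale)
  then have "dir_deriv f x (a *\<^sub>R u + b *\<^sub>R v) = f' (a *\<^sub>R u + b *\<^sub>R v)"
    using f'(2) by simp
  also have "\<dots> = a *\<^sub>R f' u + b *\<^sub>R f' v"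
    by (simp add: linear_add[OF has_derivative_linear[OF f'(1)]] linear_cmul[OF has_derivative_linear[OF f'(1)]])
  finally show ?thesis
    using f'(2) assms(3,4) by simp
qed

lemma dir_deriv_const: "dir_deriv (\<lambda>_. c) x v = 0"
  by (simp add: dir_deriv_def)

lemma dir_deriv_zero: "dir_deriv f x 0 = 0"
  by (simp add: dir_deriv_def)

text \<open>Coordinate by coordinate, the iterated directional derivatives along \<open>V\<close>
  coincide with the symmetric \<open>f''\<close> produced for elementary functions.\<close>

lemma dir_deriv_commute:
  assumes "elementary_map U f" "x \<in> U" "u \<in> V" "v \<in> V"
  shows "dir_deriv (\<lambda>y. dir_deriv f y u) x v = dir_deriv (\<lambda>y. dir_deriv f y v) x u"
proof (rule euclidean_eqI)
  fix b :: 'b assume b: "b \<in> Basis"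
  have inner: "dir_deriv f y w \<bullet> b = dir_deriv (\<lambda>y. f y \<bullet> b) y w"
    if f: "elementary_map U f" and y: "y \<in> U" and w: "w \<in> V" for f :: "'a \<Rightarrow> 'b" and y w
  proof -
    obtain f' where f': "(f has_derivative f') (at y within U)" "\<And>v. v \<in> V \<Longrightarrow> f' v = dir_deriv f y v"
      using dir_derivative[OF f y] by blast
    then have "((\<lambda>y. f y \<bullet> b) has_derivative (\<lambda>v. f' v \<bullet> b)) (at y within U)"
      by (auto intro!: derivative_eq_intros)
    then have "dir_deriv (\<lambda>y. f y \<bullet> b) y w = f' w \<bullet> b"
      by (rule dir_deriv_eq[OF y w])
    then show ?thesis using f'(2)[OF w] by simp
  qed
  have el: "elementary_on U (\<lambda>y. f y \<bullet> b)"
    using assms(1) b by (simp add: elementary_map_def)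
  obtain f' f'' where "has_second_derivatives_on (\<lambda>y. f y \<bullet> b) f' f'' U"
    using elementary_second_derivatives[OF el] by (elim exE)
  note f = has_second_derivatives_onD[OF this]
  have "dir_deriv (\<lambda>y. dir_deriv f y u) x v \<bullet> b = f'' x u v" if "u \<in> V" "v \<in> V" for u v
  proof -
    have "dir_deriv (\<lambda>y. dir_deriv f y u) x v \<bullet> b = dir_deriv (\<lambda>y. dir_deriv f y u \<bullet> b) x v"
      by (rule inner) (auto intro: elementary_map_dir_deriv assms that)
    also have "\<dots> = dir_deriv (\<lambda>y. f' y u) x v"
      using assms(1,2) that by (intro dir_deriv_cong) (auto simp: inner intro: dir_deriv_eq f)
    also have "\<dots> = f'' x u v"
      using f(2) assms(2) that by (intro dir_deriv_eq)
    finally show ?thesis .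
  qed
  then show "dir_deriv (\<lambda>y. dir_deriv f y u) x v \<bullet> b = dir_deriv (\<lambda>y. dir_deriv f y v) x u \<bullet> b"
    using assms(3,4) f(3)[OF assms(2), of u v] by simp
qed

text \<open>Differences of points of \<open>U\<close> lie in \<open>V\<close>, so \<open>f\<close>
  has constant inner product with every vector orthogonal to \<open>V\<close>, and the orthogonal
  component of the derivative vanishes.\<close>

lemma derivative_in_V:
  assumes f: "(f has_derivative f') (at x)" and S: "open S" "x \<in> S" "f ` S \<subseteq> U"
  shows "f' v \<in> V"
proof -
  obtain y z where yz: "y \<in> span V" "\<And>w. w \<in> span V \<Longrightarrow> orthogonal z w" "f' v = y + z"
    using orthogonal_subspace_decomp_exists by metis
  have "((\<lambda>t. f t \<bullet> z) has_derivative (\<lambda>t. f' t \<bullet> z)) (at x)"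
    using f by (auto intro!: derivative_eq_intros)
  moreover have "((\<lambda>t. f t \<bullet> z) has_derivative (\<lambda>t. 0)) (at x)"
  proof (rule has_derivative_transform_within_open[of "\<lambda>t. f x \<bullet> z", OF _ S(1,2)])
    fix t assume "t \<in> S"
    then have "f t - f x \<in> V" using S diff_in_V by blast
    then have "(f t - f x) \<bullet> z = 0"
      using yz(2) by (metis orthogonal_def inner_commute span_base)
    then show "f x \<bullet> z = f t \<bullet> z" by (simp add: inner_diff_left)
  qed simp
  ultimately have "f' v \<bullet> z = 0"
    using has_derivative_unique by metis
  then have "z \<bullet> z = 0"
    using yz unfolding orthogonal_def by (metis add_0 inner_add_left inner_commute)
  then show ?thesis using yz(1,3) subspace_V by (metis add.right_neutral inner_eq_zero_iff span_eq_iff)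
qed

lemma elementary_map_curve_derivative:
  assumes "elementary_map U f" and c: "(c has_vector_derivative c') (at t)"
    and S: "open S" "t \<in> S" "c ` S \<subseteq> U"
  shows "((\<lambda>t. f (c t)) has_vector_derivative dir_deriv f (c t) c') (at t)" "c' \<in> V"
proof -
  have "(\<lambda>r. r *\<^sub>R c') 1 \<in> V"
    using c S derivative_in_V unfolding has_vector_derivative_def by blast
  then show V: "c' \<in> V" by simp
  obtain f' where f': "(f has_derivative f') (at (c t) within U)"
      "\<And>v. v \<in> V \<Longrightarrow> f' v = dir_deriv f (c t) v"
    using dir_derivative[OF assms(1), of "c t"] S by blast
  have "(f has_derivative f') (at (c t) within c ` S)"
    using f'(1) S(3) by (rule has_derivative_subset)
  moreover have "(c has_derivative (\<lambda>r. r *\<^sub>R c')) (at t within S)"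
    using c unfolding has_vector_derivative_def by (rule has_derivative_at_withinI)
  ultimately have "((\<lambda>t. f (c t)) has_derivative (\<lambda>r. f' (r *\<^sub>R c'))) (at t within S)"
    using has_derivative_in_compose by blast
  moreover have "f' (r *\<^sub>R c') = r *\<^sub>R dir_deriv f (c t) c'" for r
    using f'(2)[OF V] linear_cmul[OF has_derivative_linear[OF f'(1)]] by metis
  ultimately show "((\<lambda>t. f (c t)) has_vector_derivative dir_deriv f (c t) c') (at t)"
    unfolding has_vector_derivative_def using at_within_open[OF S(2,1)] by simp
qed

end

lemma affine_domain_open: "open S \<Longrightarrow> S \<noteq> {} \<Longrightarrow> affine_domain UNIV S"
  unfolding affine_domain_def
proof (intro conjI ballI)
  fix x assume "open S" "x \<in> S"
  then obtain e where "e > 0" "ball x e \<subseteq> S" by (meson openE)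
  then show "\<exists>e>0. \<forall>v\<in>UNIV. norm v < e \<longrightarrow> x + v \<in> S"
    by (auto simp: subset_iff dist_norm intro!: exI[of _ e])
qed auto

text \<open>The chain rule: \<open>f\<close> need not be differentiable transversally to \<open>V\<close>, nor \<open>h\<close> transversally to \<open>V'\<close>.\<close>

lemma dir_deriv_compose:
  assumes "affine_domain V U" "affine_domain V' U'" "elementary_map U f" "elementary_map U' h"
    and "f ` U \<subseteq> U'" "x \<in> U" "v \<in> V"
  shows "dir_deriv (\<lambda>x. h (f x)) x v = dir_deriv h (f x) (dir_deriv f x v)"
    and "dir_deriv f x v \<in> V'"
proof -
  interpret A: affine_chart V U using assms by (simp add: affine_chart_def)
  interpret B: affine_chart V' U' using assms by (simp add: affine_chart_def)
  obtain S where S: "open S" "0 \<in> S" "\<And>t. t \<in> S \<Longrightarrow> x + t *\<^sub>R v \<in> U"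
    using A.eventually_line_in[OF assms(6,7)] unfolding eventually_nhds by blast
  obtain f' where f': "(f has_derivative f') (at x within U)" "\<And>v. v \<in> V \<Longrightarrow> f' v = dir_deriv f x v"
    using A.dir_derivative[OF assms(3,6)] by blast
  have "((\<lambda>t. f (x + t *\<^sub>R v)) has_vector_derivative dir_deriv f x v) (at 0)"
    using A.line_vector_derivative[OF assms(6,7) f'(1)] f'(2)[OF assms(7)] by simp
  note B.elementary_map_curve_derivative[OF assms(4) this S(1,2)]
  then have *: "((\<lambda>t. h (f (x + t *\<^sub>R v))) has_vector_derivative dir_deriv h (f x) (dir_deriv f x v)) (at 0)"
    "dir_deriv f x v \<in> V'"
    using S assms(5) by auto
  show "dir_deriv f x v \<in> V'" by fact
  show "dir_deriv (\<lambda>x. h (f x)) x v = dir_deriv h (f x) (dir_deriv f x v)"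
    unfolding dir_deriv_def[of "\<lambda>x. h (f x)"] using *(1) by (rule vector_derivative_at)
qed

section \<open>The hyperboloid model\<close>

lemma hyp_form_add_left: "hyp_form i (x + y) z = hyp_form i x z + hyp_form i y z"
  and hyp_form_add_right: "hyp_form i z (x + y) = hyp_form i z x + hyp_form i z y"
  and hyp_form_diff_left: "hyp_form i (x - y) z = hyp_form i x z - hyp_form i y z"
  and hyp_form_diff_right: "hyp_form i z (x - y) = hyp_form i z x - hyp_form i z y"
  by (simp_all add: hyp_form_def algebra_simps sum.distrib sum_subtractf)

lemma hyp_form_scale_left: "hyp_form i (c *\<^sub>R x) z = c * hyp_form i x z"
  and hyp_form_scale_right: "hyp_form i z (c *\<^sub>R x) = c * hyp_form i z x"
  by (simp_all add: hyp_form_def algebra_simps sum_distrib_left)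

lemma hyp_form_minus_left: "hyp_form i (- x) z = - hyp_form i x z"
  and hyp_form_minus_right: "hyp_form i z (- x) = - hyp_form i z x"
  by (simp_all add: hyp_form_def sum_negf)

lemma hyp_form_zero: "hyp_form i 0 z = 0" "hyp_form i z 0 = 0"
  by (simp_all add: hyp_form_def)

lemmas hyp_form_simps = hyp_form_add_left hyp_form_add_right hyp_form_diff_left hyp_form_diff_right
  hyp_form_scale_left hyp_form_scale_right hyp_form_minus_left hyp_form_minus_right hyp_form_zero

lemma hyp_form_commute: "hyp_form i x y = hyp_form i y x"
  by (simp add: hyp_form_def mult.commute)

lemma elementary_hyp_form:
  "elementary_map U f \<Longrightarrow> elementary_map U g \<Longrightarrow> elementary_on U (\<lambda>x. hyp_form i (f x) (g x))"
  unfolding hyp_form_def elementary_map_vec by (auto intro!: elementary_intros)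

lemma bounded_bilinear_hyp_form: "bounded_bilinear (hyp_form i)"
  unfolding bilinear_conv_bounded_bilinear[symmetric]
  by (auto simp: bilinear_def linear_iff hyp_form_simps)

definition hyperboloid :: "'n::{finite,linorder} \<Rightarrow> (real^'n::{finite,linorder}) set" where
  "hyperboloid i = {x. (\<forall>j>i. x $ j = 0) \<and> 0 < x $ i \<and> hyp_form i x x = - 1}"

lemma hyperboloidD:
  assumes "x \<in> hyperboloid i"
  shows "0 < x $ i" "hyp_form i x x = - 1" "i < j \<Longrightarrow> x $ j = 0"
  using assms by (auto simp: hyperboloid_def)

definition hyperboloid_tangent ::
    "'n::{finite,linorder} \<Rightarrow> real^'n::{finite,linorder} \<Rightarrow> (real^'n::{finite,linorder}) set" where
  "hyperboloid_tangent i x = {v. (\<forall>j>i. v $ j = 0) \<and> hyp_form i x v = 0}"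

text \<open>Cauchy-Schwarz for the coordinates below \<open>i\<close>: there \<open>x\<close> has
  squared length \<open>(x $ i)^2 - 1\<close>, and tangency says that the product with
  \<open>v\<close> is \<open>x $ i * v $ i\<close>. The explicit bound yields both nonnegativity and
  definiteness of the form on tangent vectors.\<close>

lemma tangent_form_bound:
  assumes x: "0 < x $ i" "hyp_form i x x = - 1" and v: "hyp_form i x v = 0"
  shows "(\<Sum>j<i. (v $ j)\<^sup>2) \<le> hyp_form i v v * (x $ i)\<^sup>2"
proof -
  have X: "(\<Sum>j<i. (x $ j)\<^sup>2) = (x $ i)\<^sup>2 - 1"
    using x(2) by (simp add: hyp_form_def power2_eq_square)
  have "(\<Sum>j<i. x $ j * v $ j) = x $ i * v $ i"
    using v by (simp add: hyp_form_def)
  then have "(x $ i * v $ i)\<^sup>2 \<le> (\<Sum>j<i. (x $ j)\<^sup>2) * (\<Sum>j<i. (v $ j)\<^sup>2)"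
    using Cauchy_Schwarz_ineq_sum[of "\<lambda>j. x $ j" "\<lambda>j. v $ j" "{..<i}"] by simp
  then show ?thesis
    unfolding X hyp_form_def by (simp add: power2_eq_square algebra_simps)
qed

lemma tangent_form_nonneg:
  assumes "0 < x $ i" "hyp_form i x x = - 1" "hyp_form i x v = 0"
  shows "0 \<le> hyp_form i v v"
proof -
  have "0 \<le> (\<Sum>j<i. (v $ j)\<^sup>2)"
    by (simp add: sum_nonneg)
  then have "0 \<le> hyp_form i v v * (x $ i)\<^sup>2"
    using tangent_form_bound[OF assms] by linarith
  moreover have "0 < (x $ i)\<^sup>2"
    using assms(1) by simp
  ultimately show ?thesis
    by (simp add: zero_le_mult_iff)
qed

lemma tangent_form_definite:
  assumes "x \<in> hyperboloid i" "v \<in> hyperboloid_tangent i x" "hyp_form i v v = 0"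
  shows "v = 0"
proof -
  have x: "0 < x $ i" "hyp_form i x x = - 1" and v: "hyp_form i x v = 0" "\<And>j. i < j \<Longrightarrow> v $ j = 0"
    using assms by (auto simp: hyperboloid_def hyperboloid_tangent_def)
  have "(\<Sum>j<i. (v $ j)\<^sup>2) = 0"
    using tangent_form_bound[OF x v(1)] assms(3) sum_nonneg[of "{..<i}" "\<lambda>j. (v $ j)\<^sup>2"] by simp
  then have lt: "v $ j = 0" if "j < i" for j
    using that by (simp add: sum_nonneg_eq_0_iff)
  then have "x $ i * v $ i = 0"
    using v(1) by (simp add: hyp_form_def)
  then show ?thesis
    using x(1) v(2) lt by (auto simp: vec_eq_iff) (metis less_irrefl linorder_cases)
qed

text \<open>The form is only semidefinite here, as coordinates above \<open>i\<close> are not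
  constrained, so \<open>b = 0\<close> is treated separately. Otherwise the form is evaluated at
  \<open>b *\<^sub>R u - c *\<^sub>R v\<close>.\<close>

lemma tangent_Cauchy_Schwarz:
  assumes x: "0 < x $ i" "hyp_form i x x = - 1" and u: "hyp_form i x u = 0" and v: "hyp_form i x v = 0"
  shows "(hyp_form i u v)\<^sup>2 \<le> hyp_form i u u * hyp_form i v v"
proof -
  define a b c where abc: "a = hyp_form i u u" "b = hyp_form i v v" "c = hyp_form i u v"
  have "0 \<le> hyp_form i (s *\<^sub>R u + t *\<^sub>R v) (s *\<^sub>R u + t *\<^sub>R v)" for s t
    by (rule tangent_form_nonneg[OF x]) (simp add: hyp_form_simps u v)
  then have *: "0 \<le> s * s * a + 2 * s * t * c + t * t * b" for s t
    by (simp add: hyp_form_simps hyp_form_commute[of i v u] abc algebra_simps)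
  have a0: "0 \<le> a" and "0 \<le> b"
    using *[of 1 0] *[of 0 1] by auto
  have "c = 0" if "b = 0"
  proof (rule ccontr)
    assume "c \<noteq> 0"
    \<comment> \<open>With \<open>b = 0\<close> and \<open>s = 1\<close> the quadratic is affine in
      \<open>t\<close>; this \<open>t\<close> gives it the value \<open>- a - 2\<close>.\<close>
    then have "2 \<le> - a"
      using *[of 1 "- (a + 1) / c"] that by simp
    then show False using a0 by linarith
  qed
  moreover have "b * b * a + 2 * b * (- c) * c + (- c) * (- c) * b = b * (a * b - c\<^sup>2)"
    by (simp add: power2_eq_square algebra_simps)
  then have "0 \<le> b * (a * b - c\<^sup>2)"
    using *[of b "- c"] by simp
  ultimately have "0 \<le> a * b - c\<^sup>2"
    using \<open>0 \<le> b\<close> by (cases "b = 0") (simp_all add: zero_le_mult_iff)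
  then show ?thesis
    by (simp add: abc)
qed

text \<open>Otherwise Cauchy-Schwarz would force \<open>(A + 1) * (B + 1) \<le> A * B\<close> for
  the squared lengths \<open>A\<close>, \<open>B\<close> of the coordinates below \<open>i\<close>.
  A negative pairing is thus a test for lying in the same sheet, used for reflections and
  geodesics.\<close>

lemma hyperboloid_sheet:
  assumes y: "hyp_form i y y = - 1" and p: "p \<in> hyperboloid i" and neg: "hyp_form i y p < 0"
  shows "0 < y $ i"
proof (rule ccontr)
  assume n: "\<not> 0 < y $ i"
  define A B where "A = (\<Sum>j<i. (y $ j)\<^sup>2)" and "B = (\<Sum>j<i. (p $ j)\<^sup>2)"
  have A: "(y $ i)\<^sup>2 = A + 1" and B: "(p $ i)\<^sup>2 = B + 1" and p0: "0 < p $ i"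
    using y p by (auto simp: A_def B_def hyperboloid_def hyp_form_def power2_eq_square)
  have nn: "0 \<le> A" "0 \<le> B"
    by (auto simp: A_def B_def sum_nonneg)
  have "(\<Sum>j<i. y $ j * p $ j) < y $ i * p $ i" "y $ i * p $ i \<le> 0"
    using neg n p0 by (auto simp: hyp_form_def mult_le_0_iff)
  then have "(y $ i * p $ i)\<^sup>2 \<le> (\<Sum>j<i. y $ j * p $ j)\<^sup>2"
    by (simp add: abs_le_square_iff[symmetric])
  also have "\<dots> \<le> A * B"
    unfolding A_def B_def by (rule Cauchy_Schwarz_ineq_sum)
  finally show False
    using nn by (simp add: power_mult_distrib A B algebra_simps)
qed

text \<open>The reverse Cauchy-Schwarz inequality: from \<open>s\<^sup>2 \<le> A * B\<close> and
  \<open>2 * s \<le> A + B\<close> follows \<open>(s + 1)\<^sup>2 \<le> (A + 1) * (B + 1)\<close>.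
  It makes \<open>arcosh (- hyp_form i x p)\<close> meaningful.\<close>

lemma hyperboloid_form_le:
  assumes "x \<in> hyperboloid i" "p \<in> hyperboloid i"
  shows "hyp_form i x p \<le> - 1"
proof -
  define A B where "A = (\<Sum>j<i. (x $ j)\<^sup>2)" and "B = (\<Sum>j<i. (p $ j)\<^sup>2)"
  define s where "s = (\<Sum>j<i. x $ j * p $ j)"
  have A: "(x $ i)\<^sup>2 = A + 1" and B: "(p $ i)\<^sup>2 = B + 1" and pos: "0 < x $ i" "0 < p $ i"
    using assms by (auto simp: A_def B_def hyperboloid_def hyp_form_def power2_eq_square)
  have nn: "0 \<le> A" "0 \<le> B"
    by (auto simp: A_def B_def sum_nonneg)
  have s: "s\<^sup>2 \<le> A * B"
    unfolding A_def B_def s_def by (rule Cauchy_Schwarz_ineq_sum)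
  have "0 \<le> (A - B)\<^sup>2" by simp
  then have "4 * (A * B) \<le> (A + B)\<^sup>2" by (simp add: power2_eq_square algebra_simps)
  then have "(2 * s)\<^sup>2 \<le> (A + B)\<^sup>2" using s by (simp add: power_mult_distrib)
  then have "2 * s \<le> A + B"
    using nn by (meson abs_le_square_iff abs_of_nonneg add_nonneg_nonneg abs_le_D1 power2_le_imp_le)
  moreover have "(x $ i * p $ i)\<^sup>2 = (A + 1) * (B + 1)"
    by (simp only: power_mult_distrib A B)
  ultimately have "(s + 1)\<^sup>2 \<le> (x $ i * p $ i)\<^sup>2"
    using s by (simp add: power2_eq_square algebra_simps)
  then have "s + 1 \<le> x $ i * p $ i"
    by (rule power2_le_imp_le) (use pos in simp)
  then show ?thesis
    by (simp add: hyp_form_def s_def)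
qed

text \<open>The point reflection of the hyperboloid at \<open>p\<close> is the restriction of a linear map.\<close>

definition hyp_reflect ::
    "'n::{finite,linorder} \<Rightarrow> real^'n::{finite,linorder} \<Rightarrow> real^'n::{finite,linorder} \<Rightarrow> real^'n::{finite,linorder}" where
  "hyp_reflect i p x = - x - (2 * hyp_form i x p) *\<^sub>R p"

lemma hyp_reflect_form:
  assumes "hyp_form i p p = - 1"
  shows "hyp_form i (hyp_reflect i p x) (hyp_reflect i p y) = hyp_form i x y"
  by (simp add: hyp_reflect_def hyp_form_simps assms hyp_form_commute[of i p x] hyp_form_commute[of i p y]
      algebra_simps)

lemma hyp_reflect_involution:
  assumes "hyp_form i p p = - 1"
  shows "hyp_reflect i p (hyp_reflect i p x) = x"
  by (simp add: hyp_reflect_def hyp_form_simps assms algebra_simps)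

lemma hyp_reflect_hyperboloid:
  assumes "p \<in> hyperboloid i" "x \<in> hyperboloid i"
  shows "hyp_reflect i p x \<in> hyperboloid i"
proof -
  note p = hyperboloidD[OF assms(1)] and x = hyperboloidD[OF assms(2)]
  have "hyp_form i (hyp_reflect i p x) p = hyp_form i x p"
    by (simp add: hyp_reflect_def hyp_form_simps p)
  then have "0 < hyp_reflect i p x $ i"
    using hyperboloid_form_le[OF assms(2,1)] x p
    by (intro hyperboloid_sheet[OF _ assms(1)]) (auto simp: hyp_reflect_form)
  then show ?thesis
    using x p by (auto simp: hyperboloid_def hyp_reflect_form) (simp add: hyp_reflect_def)
qed

text \<open>The initial direction \<open>w\<close> of the geodesic from \<open>p\<close> to
  \<open>q\<close> is the normalised tangential part \<open>q - cosh d *\<^sub>R p\<close>, whose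
  squared length is \<open>(sinh d)\<^sup>2\<close>. For \<open>d = 0\<close> there is no direction,
  and \<open>w = 0\<close> keeps the formula for \<open>q\<close> valid.\<close>

lemma hyperboloid_geodesic:
  assumes p: "p \<in> hyperboloid i" and q: "q \<in> hyperboloid i"
  defines "d \<equiv> arcosh (- hyp_form i p q)"
  obtains w where "w \<in> hyperboloid_tangent i p" "hyp_form i w w = (if d = 0 then 0 else 1)"
    "d = 0 \<Longrightarrow> w = 0" "q = cosh d *\<^sub>R p + sinh d *\<^sub>R w"
proof -
  note P = hyperboloidD[OF p] and Q = hyperboloidD[OF q]
  have pq: "1 \<le> - hyp_form i p q"
    using hyperboloid_form_le[OF p q] by simp
  then have cosh: "cosh d = - hyp_form i p q"
    by (simp add: d_def)
  define r where "r = q - cosh d *\<^sub>R p"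
  have r: "r \<in> hyperboloid_tangent i p"
    using P Q by (simp add: r_def hyperboloid_tangent_def hyp_form_simps cosh)
  have "hyp_form i r r = (cosh d)\<^sup>2 - 1"
    using P Q by (simp add: r_def hyp_form_simps hyp_form_commute[of i q p] cosh power2_eq_square)
  then have rr: "hyp_form i r r = (sinh d)\<^sup>2"
    by (simp add: cosh_square_eq)
  show thesis
  proof (cases "d = 0")
    case True
    then have "r = 0"
      using rr tangent_form_definite[OF p r] by simp
    then show thesis
      using True by (intro that[of 0]) (auto simp: r_def hyperboloid_tangent_def hyp_form_simps)
  next
    case False
    then have "sinh d \<noteq> 0" by simp
    then show thesis
      using False rr r by (intro that[of "(1 / sinh d) *\<^sub>R r"])
        (auto simp: hyperboloid_tangent_def hyp_form_simps power2_eq_square r_def[symmetric] field_simps,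
         simp add: r_def)
  qed
qed

lemma geodesic_in_hyperboloid:
  assumes p: "p \<in> hyperboloid i" and w: "w \<in> hyperboloid_tangent i p" "hyp_form i w w = 1"
  shows "cosh t *\<^sub>R p + sinh t *\<^sub>R w \<in> hyperboloid i"
proof -
  note P = hyperboloidD[OF p]
  have W: "hyp_form i p w = 0" "hyp_form i w p = 0" "\<And>j. i < j \<Longrightarrow> w $ j = 0"
    using w by (auto simp: hyperboloid_tangent_def hyp_form_commute)
  let ?y = "cosh t *\<^sub>R p + sinh t *\<^sub>R w"
  have y: "hyp_form i ?y ?y = - 1"
    using hyperbolic_pythagoras[of t] by (simp add: hyp_form_simps P W w(2) power2_eq_square)
  moreover have "hyp_form i ?y p < 0"
    by (simp add: hyp_form_simps P W)
  ultimately have "0 < ?y $ i"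
    using hyperboloid_sheet[OF _ p] by blast
  then show ?thesis
    using y P W by (simp add: hyperboloid_def)
qed

text \<open>For a unit tangent vector \<open>w\<close> at some point, \<open>arsinh (hyp_form i x w)\<close> is the signed distance of
  \<open>x\<close> to the totally geodesic hypersurface orthogonal to \<open>w\<close>; it is 1-Lipschitz, and its growth along the
  geodesic in direction \<open>w\<close> is the arc length.\<close>

lemma hyp_form_tangent_le:
  assumes x: "0 < x $ i" "hyp_form i x x = - 1" and v: "hyp_form i x v = 0" and w: "hyp_form i w w = 1"
  shows "\<bar>hyp_form i v w\<bar> / sqrt ((hyp_form i x w)\<^sup>2 + 1) \<le> sqrt (hyp_form i v v)"
proof -
  \<comment> \<open>The tangential projection of \<open>w\<close> at \<open>x\<close>, with a plus
    sign because \<open>hyp_form i x x = - 1\<close>. Its length is the denominator in the claim,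
    which is also the one in the derivative of \<open>arsinh\<close>.\<close>
  define w' where "w' = w + hyp_form i x w *\<^sub>R x"
  have t: "hyp_form i x w' = 0"
    by (simp add: w'_def hyp_form_simps x)
  have w': "hyp_form i w' w' = (hyp_form i x w)\<^sup>2 + 1"
    by (simp add: w'_def hyp_form_simps x w hyp_form_commute[of i w x] power2_eq_square)
  have vw: "hyp_form i v w' = hyp_form i v w"
    by (simp add: w'_def hyp_form_simps hyp_form_commute[of i v x] v)
  have "(hyp_form i v w)\<^sup>2 \<le> hyp_form i v v * ((hyp_form i x w)\<^sup>2 + 1)"
    using tangent_Cauchy_Schwarz[OF x v t] by (simp add: vw w')
  then have "\<bar>hyp_form i v w\<bar> \<le> sqrt (hyp_form i v v) * sqrt ((hyp_form i x w)\<^sup>2 + 1)"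
    by (metis real_sqrt_abs real_sqrt_le_mono real_sqrt_mult)
  moreover have "0 < sqrt ((hyp_form i x w)\<^sup>2 + 1)"
    by (simp add: add_nonneg_pos)
  ultimately show ?thesis
    by (simp add: pos_divide_le_eq)
qed

text \<open>The tangent spaces of \<open>hyperboloid i\<close> have dimension at most 1 when \<open>index_pos i \<le> 1\<close>.\<close>

lemma tangent_form_degenerate:
  assumes x: "0 < x $ i" and u: "hyp_form i x u = 0" and v: "hyp_form i x v = 0" and "index_pos i \<le> 1"
  shows "hyp_form i u u * hyp_form i v v = (hyp_form i u v)\<^sup>2"
proof -
  consider "{..<i} = {}" | k where "{..<i} = {k}"
    using assms(4) unfolding index_pos_def
    by (metis card_0_eq card_1_singletonE finite le_neq_implies_less less_one)
  then show ?thesis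
  proof cases
    case 1
    then show ?thesis using x u v by (simp add: hyp_form_def)
  next
    case 2
    have "u $ i = x $ k * u $ k / x $ i" "v $ i = x $ k * v $ k / x $ i"
      using x u v by (simp_all add: 2 hyp_form_def field_simps)
    then show ?thesis
      unfolding hyp_form_def by (simp add: 2 power2_eq_square algebra_simps)
  qed
qed

section \<open>The Gauss formula for products of hyperboloids\<close>

lemma elementary_map_component: "elementary_map U f \<Longrightarrow> elementary_map U (\<lambda>x. (f x :: real^'n^'m) $ i)"
  by (simp add: elementary_map_matrix elementary_map_vec)

lemma elementary_map_scaleR:
  "elementary_on U s \<Longrightarrow> elementary_map U f \<Longrightarrow> elementary_map U (\<lambda>x. s x *\<^sub>R f x)"
  by (auto simp: elementary_map_def intro!: elementary_intros)

lemma elementary_map_sum: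
  "(\<And>i. i \<in> A \<Longrightarrow> elementary_map U (f i)) \<Longrightarrow> elementary_map U (\<lambda>x. \<Sum>i\<in>A. f i x)"
  by (auto simp: elementary_map_def inner_sum_left intro!: elementary_intros)

context affine_chart
begin

lemma dir_deriv_bounded_linear:
  assumes "bounded_linear L" "elementary_map U f" "x \<in> U" "v \<in> V"
  shows "dir_deriv (\<lambda>y. L (f y)) x v = L (dir_deriv f x v)"
proof -
  obtain f' where f': "(f has_derivative f') (at x within U)" "\<And>v. v \<in> V \<Longrightarrow> f' v = dir_deriv f x v"
    using dir_derivative[OF assms(2,3)] by blast
  have "dir_deriv (\<lambda>y. L (f y)) x v = L (f' v)"
    by (rule dir_deriv_eq[OF assms(3,4) bounded_linear.has_derivative[OF assms(1) f'(1)]])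
  then show ?thesis using f'(2)[OF assms(4)] by simp
qed

lemma dir_deriv_bilinear:
  assumes "bounded_bilinear B" "elementary_map U f" "elementary_map U g" "x \<in> U" "v \<in> V"
  shows "dir_deriv (\<lambda>y. B (f y) (g y)) x v = B (f x) (dir_deriv g x v) + B (dir_deriv f x v) (g x)"
proof -
  obtain f' where f': "(f has_derivative f') (at x within U)" "\<And>v. v \<in> V \<Longrightarrow> f' v = dir_deriv f x v"
    using dir_derivative[OF assms(2,4)] by blast
  obtain g' where g': "(g has_derivative g') (at x within U)" "\<And>v. v \<in> V \<Longrightarrow> g' v = dir_deriv g x v"
    using dir_derivative[OF assms(3,4)] by blast
  have "dir_deriv (\<lambda>y. B (f y) (g y)) x v = B (f x) (g' v) + B (f' v) (g x)"
    by (rule dir_deriv_eq[OF assms(4,5) bounded_bilinear.FDERIV[OF assms(1) f'(1) g'(1)]])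
  then show ?thesis using f'(2)[OF assms(5)] g'(2)[OF assms(5)] by simp
qed

lemma dir_deriv_diff:
  assumes "elementary_map U f" "elementary_map U g" "x \<in> U" "v \<in> V"
  shows "dir_deriv (\<lambda>y. f y - g y) x v = dir_deriv f x v - dir_deriv g x v"
proof -
  obtain f' where f': "(f has_derivative f') (at x within U)" "\<And>v. v \<in> V \<Longrightarrow> f' v = dir_deriv f x v"
    using dir_derivative[OF assms(1,3)] by blast
  obtain g' where g': "(g has_derivative g') (at x within U)" "\<And>v. v \<in> V \<Longrightarrow> g' v = dir_deriv g x v"
    using dir_derivative[OF assms(2,3)] by blast
  have "dir_deriv (\<lambda>y. f y - g y) x v = f' v - g' v"
    by (rule dir_deriv_eq[OF assms(3,4) has_derivative_diff[OF f'(1) g'(1)]])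
  then show ?thesis using f'(2)[OF assms(4)] g'(2)[OF assms(4)] by simp
qed

lemma dir_deriv_sum:
  assumes "\<And>i. i \<in> A \<Longrightarrow> elementary_map U (f i)" "x \<in> U" "v \<in> V"
  shows "dir_deriv (\<lambda>y. \<Sum>i\<in>A. f i y) x v = (\<Sum>i\<in>A. dir_deriv (f i) x v)"
proof -
  have "\<forall>i\<in>A. \<exists>f'. (f i has_derivative f') (at x within U) \<and> f' v = dir_deriv (f i) x v"
  proof
    fix i assume "i \<in> A"
    obtain f' where "(f i has_derivative f') (at x within U)" "\<And>v. v \<in> V \<Longrightarrow> f' v = dir_deriv (f i) x v"
      using dir_derivative[OF assms(1)[OF \<open>i \<in> A\<close>] assms(2)] by blast
    then show "\<exists>f'. (f i has_derivative f') (at x within U) \<and> f' v = dir_deriv (f i) x v"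
      using assms(3) by blast
  qed
  from bchoice[OF this] obtain f' where
    f': "\<And>i. i \<in> A \<Longrightarrow> (f i has_derivative f' i) (at x within U)"
      "\<And>i. i \<in> A \<Longrightarrow> f' i v = dir_deriv (f i) x v"
    by blast
  have "dir_deriv (\<lambda>y. \<Sum>i\<in>A. f i y) x v = (\<Sum>i\<in>A. f' i v)"
    by (rule dir_deriv_eq[OF assms(2,3) has_derivative_sum[OF f'(1)]])
  then show ?thesis using f'(2) by simp
qed

lemma dir_deriv_ident: "dir_deriv (\<lambda>y. y) x v = v"
proof -
  have "((\<lambda>t. x + t *\<^sub>R v) has_vector_derivative v) (at 0)"
    by (auto intro!: derivative_eq_intros)
  then show ?thesis unfolding dir_deriv_def by (rule vector_derivative_at)
qed

lemma affine_domain_V: "affine_domain V V"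
  unfolding affine_domain_def using subspace_V
  by (auto intro: subspace_diff subspace_add subspace_0 exI[of _ 1])

lemma dir_deriv_in_V:
  assumes "elementary_map U f" "\<And>y. y \<in> U \<Longrightarrow> f y \<in> V" "x \<in> U" "v \<in> V"
  shows "dir_deriv f x v \<in> V"
  by (rule dir_deriv_compose(2)[OF affine_domain affine_domain_V assms(1) elementary_map_ident])
    (use assms in auto)

text \<open>The product rule for a derivative in a moving direction. With \<open>N\<close> a
  Christoffel symbol, the Gauss formula gives \<open>dir_deriv f y (N y)\<close>, and the rule is
  solved for the image of the derivative of \<open>N\<close>.\<close>

lemma dir_deriv_apply:
  assumes f: "elementary_map U f" and N: "elementary_map U N" "\<And>y. y \<in> U \<Longrightarrow> N y \<in> V"
    and x: "x \<in> U" and u: "u \<in> V"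
  shows "dir_deriv (\<lambda>y. dir_deriv f y (N y)) x u =
      dir_deriv (\<lambda>y. dir_deriv f y (N x)) x u + dir_deriv f x (dir_deriv N x u)"
proof -
  obtain f' where f': "\<forall>v. elementary_map U (\<lambda>x. f' x v)"
    "\<forall>x\<in>U. (f has_derivative f' x) (at x within U)"
    using elementary_map_derivative[OF f] by (elim exE conjE)
  have D: "dir_deriv f y v = f' y v" if "y \<in> U" "v \<in> V" for y v
    using dir_deriv_eq[OF that] f'(2) that by blast
  \<comment> \<open>Basis vectors need not lie in \<open>V\<close>, so the expansion uses the
    derivative \<open>f'\<close>, which is linear in all directions, instead of
    \<open>dir_deriv\<close>.\<close>
  have expand: "f' y v = (\<Sum>b\<in>Basis. (v \<bullet> b) *\<^sub>R f' y b)" if "y \<in> U" for y v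
  proof -
    have lin: "linear (f' y)"
      using f'(2) that has_derivative_linear by blast
    have "f' y v = f' y (\<Sum>b\<in>Basis. (v \<bullet> b) *\<^sub>R b)"
      by (simp add: euclidean_representation)
    also have "\<dots> = (\<Sum>b\<in>Basis. (v \<bullet> b) *\<^sub>R f' y b)"
      by (simp add: linear_sum[OF lin] linear_cmul[OF lin])
    finally show ?thesis .
  qed
  have el: "elementary_map U (\<lambda>y. (w y \<bullet> b) *\<^sub>R f' y b)" if "elementary_map U w" for w b
    using f'(1) elementary_map_inner[OF that] by (intro elementary_map_scaleR) auto
  have sum: "dir_deriv (\<lambda>y. dir_deriv f y (w y)) x u =
      (\<Sum>b\<in>Basis. (w x \<bullet> b) *\<^sub>R dir_deriv (\<lambda>y. f' y b) x u + (dir_deriv w x u \<bullet> b) *\<^sub>R f' x b)"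
    if w: "elementary_map U w" "\<And>y. y \<in> U \<Longrightarrow> w y \<in> V" for w
  proof -
    have "dir_deriv (\<lambda>y. dir_deriv f y (w y)) x u = dir_deriv (\<lambda>y. \<Sum>b\<in>Basis. (w y \<bullet> b) *\<^sub>R f' y b) x u"
      by (rule dir_deriv_cong[OF x u]) (simp add: D w(2) expand[symmetric])
    also have "\<dots> = (\<Sum>b\<in>Basis. dir_deriv (\<lambda>y. (w y \<bullet> b) *\<^sub>R f' y b) x u)"
      by (rule dir_deriv_sum[OF el[OF w(1)] x u])
    also have "\<dots> = (\<Sum>b\<in>Basis. (w x \<bullet> b) *\<^sub>R dir_deriv (\<lambda>y. f' y b) x u + (dir_deriv w x u \<bullet> b) *\<^sub>R f' x b)"
    proof (rule sum.cong[OF refl])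
      fix b
      have "dir_deriv (\<lambda>y. w y \<bullet> b) x u = dir_deriv w x u \<bullet> b"
        by (rule dir_deriv_bounded_linear[OF bounded_linear_inner_left w(1) x u])
      moreover have "elementary_map U (\<lambda>y. w y \<bullet> b)"
        using elementary_map_inner[OF w(1)] by (simp add: elementary_map_real)
      ultimately show "dir_deriv (\<lambda>y. (w y \<bullet> b) *\<^sub>R f' y b) x u =
          (w x \<bullet> b) *\<^sub>R dir_deriv (\<lambda>y. f' y b) x u + (dir_deriv w x u \<bullet> b) *\<^sub>R f' x b"
        using dir_deriv_bilinear[OF bounded_bilinear_scaleR _ f'(1)[THEN spec[of _ b]] x u] by simp
    qed
    finally show ?thesis .
  qed
  have c: "elementary_map U (\<lambda>_. N x)"
    by (simp add: elementary_map_def elementary_intros)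
  have 3: "dir_deriv f x (dir_deriv N x u) = (\<Sum>b\<in>Basis. (dir_deriv N x u \<bullet> b) *\<^sub>R f' x b)"
    by (rule trans[OF D[OF x dir_deriv_in_V[OF N x u]] expand[OF x]])
  have 1: "dir_deriv (\<lambda>y. dir_deriv f y (N y)) x u =
      (\<Sum>b\<in>Basis. (N x \<bullet> b) *\<^sub>R dir_deriv (\<lambda>y. f' y b) x u + (dir_deriv N x u \<bullet> b) *\<^sub>R f' x b)"
    by (rule sum[OF N])
  have 2: "dir_deriv (\<lambda>y. dir_deriv f y (N x)) x u =
      (\<Sum>b\<in>Basis. (N x \<bullet> b) *\<^sub>R dir_deriv (\<lambda>y. f' y b) x u)"
    using sum[OF c N(2)[OF x]] by (simp add: dir_deriv_const)
  show ?thesis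
    using 1 2 3 by (simp add: sum.distrib)
qed

end

lemma affine_chart_UNIV: "affine_chart UNIV UNIV"
  by (simp add: affine_chart_def affine_domain_open)

text \<open>Linearity reduces a moving direction to finitely many fixed basis directions; this is
  how the formula for the Christoffel symbol is seen to be elementary.\<close>

lemma elementary_map_differential:
  assumes h: "elementary_map UNIV h" and "elementary_map U f" "elementary_map U a"
  shows "elementary_map U (\<lambda>x. dir_deriv h (f x) (a x))"
proof -
  interpret affine_chart UNIV UNIV by (rule affine_chart_UNIV)
  have lin: "linear (dir_deriv h y)" for y
    using dir_deriv_linear[OF h, of y _ _ 1 1] dir_deriv_linear[OF h, of y _ 0 _ 0]
    by (intro linearI) simp_all
  have "dir_deriv h y v = (\<Sum>b\<in>Basis. (v \<bullet> b) *\<^sub>R dir_deriv h y b)" for y v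
  proof -
    have "dir_deriv h y v = dir_deriv h y (\<Sum>b\<in>Basis. (v \<bullet> b) *\<^sub>R b)"
      by (simp add: euclidean_representation)
    then show ?thesis
      by (simp add: linear_sum[OF lin] linear_cmul[OF lin])
  qed
  then have "(\<lambda>x. dir_deriv h (f x) (a x)) = (\<lambda>x. \<Sum>b\<in>Basis. (a x \<bullet> b) *\<^sub>R dir_deriv h (f x) b)"
    by metis
  moreover have "elementary_map U (\<lambda>x. \<Sum>b\<in>Basis. (a x \<bullet> b) *\<^sub>R dir_deriv h (f x) b)"
    by (intro elementary_map_sum elementary_map_scaleR elementary_map_inner assms
        elementary_map_compose[OF elementary_map_dir_deriv[OF h]]) auto
  ultimately show ?thesis by simp
qed

text \<open>The entries below the diagonal are global coordinates on the product of the hyperboloids;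
  \<open>hyp_lift\<close> is the corresponding retraction of the space of all matrices.\<close>

definition hyp_lift ::
    "real^'n::{finite,linorder}^'n::{finite,linorder} \<Rightarrow> real^'n::{finite,linorder}^'n::{finite,linorder}" where
  "hyp_lift Y = (\<chi> i j. if j < i then Y $ i $ j else
     if j = i then sqrt (1 + (\<Sum>k<i. (Y $ i $ k)\<^sup>2)) else 0)"

lemma one_plus_sum_squares_pos: "0 < 1 + (\<Sum>k\<in>A. (f k)\<^sup>2 :: real)"
  by (simp add: add_pos_nonneg sum_nonneg)

lemma hyp_lift_hyperboloid: "hyp_lift Y $ i \<in> hyperboloid i"
  using one_plus_sum_squares_pos[of "\<lambda>k. Y $ i $ k" "{..<i}"]
  by (auto simp: hyp_lift_def hyperboloid_def hyp_form_def power2_eq_square)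

lemma hyp_lift_ident:
  assumes "\<And>i. P $ i \<in> hyperboloid i"
  shows "hyp_lift P = P"
proof -
  have "sqrt (1 + (\<Sum>k<i. (P $ i $ k)\<^sup>2)) = P $ i $ i" for i
    using hyperboloidD[OF assms[of i]]
    by (intro real_sqrt_unique) (auto simp: hyp_form_def power2_eq_square)
  then show ?thesis
    using hyperboloidD(3)[OF assms] by (auto simp: hyp_lift_def vec_eq_iff not_less)
qed

lemma elementary_entry: "elementary_on U (\<lambda>Y. (Y :: real^'n^'m) $ i $ j)"
  using elementary_map_ident[of U] by (simp add: elementary_map_matrix)

lemma elementary_hyp_lift: "elementary_map U hyp_lift"
  unfolding elementary_map_matrix hyp_lift_def
  by (auto intro!: elementary_intros elementary_on.sqrt elementary_entry simp: one_plus_sum_squares_pos)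

lemma hyperboloid_tangent_eqI:
  assumes "x \<in> hyperboloid i" "u \<in> hyperboloid_tangent i x" "v \<in> hyperboloid_tangent i x"
    and "\<And>j. j < i \<Longrightarrow> u $ j = v $ j"
  shows "u = v"
proof -
  have x: "0 < x $ i" using assms(1) by (simp add: hyperboloid_def)
  have "x $ i * u $ i = x $ i * v $ i"
    using assms(2-4) by (simp add: hyperboloid_tangent_def hyp_form_def)
  with x have "u $ i = v $ i" by simp
  then show ?thesis
    using assms(2-4) by (auto simp: vec_eq_iff hyperboloid_tangent_def) (metis linorder_cases)
qed

text \<open>So that \<open>H\<close> can be total, \<open>F \<circ> H\<close> is the retraction and
  not the identity. Together with \<open>HF\<close> this forces the rows of \<open>F\<close> into
  the hyperboloids. All weights are positive, including that of the one-point factor at the least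
  index.\<close>

locale hyperbolic_product_chart = affine_chart V U for V U :: "'a::euclidean_space set" +
  fixes F :: "'a \<Rightarrow> real^'n::{finite,linorder}^'n::{finite,linorder}"
    and H :: "real^'n::{finite,linorder}^'n::{finite,linorder} \<Rightarrow> 'a"
    and w :: "'n \<Rightarrow> real" and g :: "'a metric_tensor"
  assumes F: "elementary_map U F" and H: "elementary_map UNIV H"
    and H_in: "H Y \<in> U" and HF: "x \<in> U \<Longrightarrow> H (F x) = x" and FH: "F (H Y) = hyp_lift Y"
    and w_pos: "0 < w i"
    and g_eq: "x \<in> U \<Longrightarrow> u \<in> V \<Longrightarrow> v \<in> V \<Longrightarrow>
      g x u v = (\<Sum>i\<in>UNIV. w i * hyp_form i (dir_deriv F x u $ i) (dir_deriv F x v $ i))"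
begin

abbreviation D where "D \<equiv> dir_deriv F"

lemma F_hyperboloid: "x \<in> U \<Longrightarrow> F x $ i \<in> hyperboloid i"
  using hyp_lift_hyperboloid HF FH by metis

lemmas F_row = hyperboloidD[OF F_hyperboloid]

lemma F_component: "elementary_map U (\<lambda>x. F x $ i)"
  by (rule elementary_map_component[OF F])

lemma D_component: "v \<in> V \<Longrightarrow> elementary_map U (\<lambda>x. D x v $ i)"
  by (rule elementary_map_component[OF elementary_map_dir_deriv[OF F]])

lemma dir_deriv_row:
  "elementary_map U f \<Longrightarrow> x \<in> U \<Longrightarrow> v \<in> V \<Longrightarrow>
    dir_deriv (\<lambda>y. (f y :: real^'m^'k) $ i) x v = dir_deriv f x v $ i"
  by (rule dir_deriv_bounded_linear[OF bounded_linear_vec_nth])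

lemma D_tangent:
  assumes "x \<in> U" "u \<in> V"
  shows "D x u $ i \<in> hyperboloid_tangent i (F x $ i)"
proof -
  have "0 = dir_deriv (\<lambda>y. hyp_form i (F y $ i) (F y $ i)) x u"
    using dir_deriv_cong[OF assms, of "\<lambda>y. hyp_form i (F y $ i) (F y $ i)" "\<lambda>_. -1"]
    by (simp add: F_row dir_deriv_const)
  also have "\<dots> = 2 * hyp_form i (F x $ i) (D x u $ i)"
    using dir_deriv_bilinear[OF bounded_bilinear_hyp_form[of i] F_component[of i] F_component[of i] assms]
    by (simp add: dir_deriv_row[OF F assms] hyp_form_commute)
  finally have "hyp_form i (F x $ i) (D x u $ i) = 0" by simp
  moreover have "D x u $ i $ j = 0" if "i < j" for j
  proof -
    have "D x u $ i $ j = dir_deriv (\<lambda>y. F y $ i $ j) x u"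
      using dir_deriv_bounded_linear[OF bounded_linear_vec_nth F_component assms, of i j]
      by (simp add: dir_deriv_row[OF F assms])
    also have "\<dots> = dir_deriv (\<lambda>y. 0) x u"
      using that by (intro dir_deriv_cong[OF assms]) (simp add: F_row)
    finally show ?thesis by (simp add: dir_deriv_const)
  qed
  ultimately show ?thesis by (simp add: hyperboloid_tangent_def)
qed

lemma F_D_orthogonal:
  assumes "x \<in> U" "u \<in> V"
  shows "hyp_form i (F x $ i) (D x u $ i) = 0" "hyp_form i (D x u $ i) (F x $ i) = 0"
  using D_tangent[OF assms] by (auto simp: hyperboloid_tangent_def hyp_form_commute)

text \<open>Differentiating \<open>F (H Y) = hyp_lift Y\<close> at \<open>F x\<close>: the
  retraction keeps the entries below the diagonal, and these determine a tangent vector.\<close>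

lemma D_surj:
  assumes x: "x \<in> U" and A: "\<And>i. A $ i \<in> hyperboloid_tangent i (F x $ i)"
  shows "dir_deriv H (F x) A \<in> V" "D x (dir_deriv H (F x) A) = A"
proof -
  interpret M: affine_chart UNIV UNIV by (rule affine_chart_UNIV)
  let ?z = "dir_deriv H (F x) A"
  note chain = dir_deriv_compose[OF M.affine_domain affine_domain H F _ UNIV_I UNIV_I, of "F x" A]
  show z: "?z \<in> V"
    by (rule chain(2)) (use H_in in auto)
  have B: "dir_deriv hyp_lift (F x) A = D x ?z"
    using chain(1) H_in by (simp add: image_subset_iff FH HF[OF x])
  have "D x ?z $ i = A $ i" for i
  proof (rule hyperboloid_tangent_eqI[OF F_hyperboloid[OF x] D_tangent[OF x z] A])
    fix j assume "j < i"
    have "D x ?z $ i $ j = dir_deriv (\<lambda>Y. hyp_lift Y $ i $ j) (F x) A"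
      unfolding B[symmetric]
      using M.dir_deriv_bounded_linear[OF bounded_linear_vec_nth
          elementary_map_component[OF elementary_hyp_lift], of "F x" A i j]
        M.dir_deriv_bounded_linear[OF bounded_linear_vec_nth elementary_hyp_lift, of "F x" A i] by simp
    also have "\<dots> = dir_deriv (\<lambda>Y. Y $ i $ j) (F x) A"
      using \<open>j < i\<close> by (simp add: hyp_lift_def)
    also have "\<dots> = A $ i $ j"
      using M.dir_deriv_bounded_linear[OF bounded_linear_vec_nth
          elementary_map_component[OF elementary_map_ident], of "F x" A i j]
        M.dir_deriv_bounded_linear[OF bounded_linear_vec_nth elementary_map_ident, of "F x" A i]
      by (simp add: M.dir_deriv_ident)
    finally show "D x ?z $ i $ j = A $ i $ j" .
  qed
  then show "D x ?z = A" by (simp add: vec_eq_iff)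
qed

lemma dir_deriv_H_D:
  assumes "x \<in> U" "u \<in> V"
  shows "dir_deriv H (F x) (D x u) = u"
proof -
  have "dir_deriv H (F x) (D x u) = dir_deriv (\<lambda>x. H (F x)) x u"
    using dir_deriv_compose(1)[OF affine_domain affine_chart.affine_domain[OF affine_chart_UNIV] F H _ assms]
    by simp
  also have "\<dots> = dir_deriv (\<lambda>x. x) x u"
    by (rule dir_deriv_cong[OF assms HF])
  finally show ?thesis by (simp add: dir_deriv_ident)
qed

lemma D_inj: "x \<in> U \<Longrightarrow> u \<in> V \<Longrightarrow> v \<in> V \<Longrightarrow> D x u = D x v \<Longrightarrow> u = v"
  using dir_deriv_H_D by metis

lemma D_add: "x \<in> U \<Longrightarrow> u \<in> V \<Longrightarrow> v \<in> V \<Longrightarrow> D x (u + v) = D x u + D x v"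
  using dir_deriv_linear[OF F, of x u v 1 1] by simp

lemma D_scale: "x \<in> U \<Longrightarrow> u \<in> V \<Longrightarrow> D x (c *\<^sub>R u) = c *\<^sub>R D x u"
  using dir_deriv_linear[OF F, of x u u c 0] by simp

lemma g_nonneg: "x \<in> U \<Longrightarrow> u \<in> V \<Longrightarrow> 0 \<le> w i * hyp_form i (D x u $ i) (D x u $ i)"
  using tangent_form_nonneg[OF F_row(1,2) F_D_orthogonal(1)] w_pos[of i] by simp

lemma g_definite:
  assumes "x \<in> U" "u \<in> V" "g x u u = 0"
  shows "u = 0"
proof -
  have "(\<Sum>i\<in>UNIV. w i * hyp_form i (D x u $ i) (D x u $ i)) = 0"
    using assms by (simp add: g_eq)
  then have "w i * hyp_form i (D x u $ i) (D x u $ i) = 0" for i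
    using g_nonneg[OF assms(1,2)] by (simp add: sum_nonneg_eq_0_iff)
  then have "hyp_form i (D x u $ i) (D x u $ i) = 0" for i
    using w_pos[of i] by (metis less_irrefl mult_eq_0_iff)
  then have "D x u $ i = 0" for i
    using tangent_form_definite[OF F_hyperboloid D_tangent] assms by blast
  then have "D x u = D x 0"
    by (simp add: vec_eq_iff dir_deriv_zero)
  then show ?thesis
    using D_inj assms subspace_V subspace_0 by blast
qed

lemma g_pos: "x \<in> U \<Longrightarrow> u \<in> V \<Longrightarrow> u \<noteq> 0 \<Longrightarrow> 0 < g x u u"
  using g_definite[of x u] g_nonneg[of x u] sum_nonneg[of UNIV "\<lambda>i. w i * hyp_form i (D x u $ i) (D x u $ i)"]
  by (fastforce simp: g_eq)

lemma g_commute: "x \<in> U \<Longrightarrow> u \<in> V \<Longrightarrow> v \<in> V \<Longrightarrow> g x u v = g x v u"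
  by (simp add: g_eq hyp_form_commute)

lemma g_linear:
  assumes "x \<in> U" "u \<in> V" "v \<in> V" "z \<in> V"
  shows "g x (a *\<^sub>R u + b *\<^sub>R v) z = a * g x u z + b * g x v z"
proof -
  have "a *\<^sub>R u + b *\<^sub>R v \<in> V"
    using assms subspace_V by (simp add: subspace_add subspace_scale)
  then show ?thesis
    using assms by (simp add: g_eq dir_deriv_linear[OF F] hyp_form_simps sum_distrib_left
        sum.distrib algebra_simps)
qed

lemma g_diff: "x \<in> U \<Longrightarrow> u \<in> V \<Longrightarrow> v \<in> V \<Longrightarrow> z \<in> V \<Longrightarrow> g x (u - v) z = g x u z - g x v z"
  using g_linear[of x u v z 1 "-1"] by simp

lemma g_elementary: "u \<in> V \<Longrightarrow> v \<in> V \<Longrightarrow> elementary_map U (\<lambda>x. g x u v)"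
  by (rule elementary_map_cong[where f = "\<lambda>x. \<Sum>i\<in>UNIV. w i * hyp_form i (D x u $ i) (D x v $ i)"])
    (auto simp: elementary_map_real g_eq intro!: elementary_intros elementary_hyp_form D_component)

lemma riemannian_manifold: "riemannian_manifold V U g"
  unfolding riemannian_manifold_def
  using affine_domain g_commute g_linear g_pos elementary_map_smooth_on[OF g_elementary] by blast

section \<open>The Gauss formula, the Christoffel symbol and the curvature tensor\<close>

abbreviation D2 where "D2 x u v \<equiv> dir_deriv (\<lambda>y. D y v) x u"

lemma D2_commute: "x \<in> U \<Longrightarrow> u \<in> V \<Longrightarrow> v \<in> V \<Longrightarrow> D2 x u v = D2 x v u"
  by (rule dir_deriv_commute[OF F])

lemma D2_elementary: "u \<in> V \<Longrightarrow> v \<in> V \<Longrightarrow> elementary_map U (\<lambda>x. D2 x u v)"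
  by (intro elementary_map_dir_deriv F)

text \<open>The tangential part of the second derivative, as in the Gauss formula for the isometric immersion
  \<open>F\<close>; the unit normals of the hyperboloids are the position vectors.\<close>

definition gauss :: "'a \<Rightarrow> 'a \<Rightarrow> 'a \<Rightarrow> real^'n::{finite,linorder}^'n::{finite,linorder}" where
  "gauss x u v = (\<chi> i. D2 x u v $ i - hyp_form i (D x u $ i) (D x v $ i) *\<^sub>R F x $ i)"

lemma dir_deriv_form:
  assumes "x \<in> U" "u \<in> V" "v \<in> V" "z \<in> V"
  shows "dir_deriv (\<lambda>y. hyp_form i (D y v $ i) (D y z $ i)) x u =
    hyp_form i (D x v $ i) (D2 x u z $ i) + hyp_form i (D2 x u v $ i) (D x z $ i)"
  using dir_deriv_bilinear[OF bounded_bilinear_hyp_form D_component D_component] assms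
  by (simp add: dir_deriv_row[OF elementary_map_dir_deriv[OF F]])

lemma dir_deriv_g:
  assumes "x \<in> U" "u \<in> V" "v \<in> V" "z \<in> V"
  shows "dir_deriv (\<lambda>y. g y v z) x u = (\<Sum>i\<in>UNIV. w i *
    (hyp_form i (D x v $ i) (D2 x u z $ i) + hyp_form i (D2 x u v $ i) (D x z $ i)))"
proof -
  have el: "elementary_map U (\<lambda>y. hyp_form i (D y v $ i) (D y z $ i))" for i
    using assms by (auto simp: elementary_map_real intro!: elementary_hyp_form D_component)
  then have el': "elementary_map U (\<lambda>y. w i * hyp_form i (D y v $ i) (D y z $ i))" for i
    by (auto simp: elementary_map_real intro!: elementary_intros)
  have "dir_deriv (\<lambda>y. g y v z) x u =
      dir_deriv (\<lambda>y. \<Sum>i\<in>UNIV. w i * hyp_form i (D y v $ i) (D y z $ i)) x u"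
    using assms by (intro dir_deriv_cong) (auto simp: g_eq)
  also have "\<dots> = (\<Sum>i\<in>UNIV. w i * dir_deriv (\<lambda>y. hyp_form i (D y v $ i) (D y z $ i)) x u)"
    using dir_deriv_sum[OF el'] dir_deriv_bounded_linear[OF bounded_linear_mult_right el] assms by simp
  finally show ?thesis
    by (simp add: dir_deriv_form assms)
qed

text \<open>Differentiating the orthogonality of \<open>F y $ i\<close> and \<open>D y v $ i\<close>
  gives the normal part of the second derivative; the correction removes it, because
  \<open>F x $ i\<close> has square \<open>- 1\<close>.\<close>

lemma gauss_tangent:
  assumes "x \<in> U" "u \<in> V" "v \<in> V"
  shows "gauss x u v $ i \<in> hyperboloid_tangent i (F x $ i)"
proof -
  have "0 = dir_deriv (\<lambda>y. hyp_form i (F y $ i) (D y v $ i)) x u"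
    using dir_deriv_cong[OF assms(1,2), of "\<lambda>y. hyp_form i (F y $ i) (D y v $ i)" "\<lambda>_. 0"]
    by (simp add: F_D_orthogonal assms(3) dir_deriv_const)
  also have "\<dots> = hyp_form i (F x $ i) (D2 x u v $ i) + hyp_form i (D x u $ i) (D x v $ i)"
    using dir_deriv_bilinear[OF bounded_bilinear_hyp_form[of i] F_component[of i] D_component[of v i] assms(1,2)]
      assms(3)
    by (simp add: dir_deriv_row[OF elementary_map_dir_deriv[OF F]] dir_deriv_row[OF F] assms(1,2))
  finally have "hyp_form i (F x $ i) (gauss x u v $ i) = 0"
    using assms by (simp add: gauss_def hyp_form_simps F_row)
  moreover have "gauss x u v $ i $ j = 0" if "i < j" for j
  proof -
    have "D2 x u v $ i $ j = dir_deriv (\<lambda>y. D y v $ i $ j) x u"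
      using dir_deriv_bounded_linear[OF bounded_linear_vec_nth D_component[OF assms(3)] assms(1,2), of i j]
      by (simp add: dir_deriv_row[OF elementary_map_dir_deriv[OF F assms(3)] assms(1,2)])
    also have "\<dots> = dir_deriv (\<lambda>y. 0) x u"
      using that D_tangent[OF _ assms(3)]
      by (intro dir_deriv_cong[OF assms(1,2)]) (auto simp: hyperboloid_tangent_def)
    finally show ?thesis
      using F_row(3)[OF assms(1) that] by (simp add: dir_deriv_const gauss_def)
  qed
  ultimately show ?thesis by (simp add: hyperboloid_tangent_def)
qed

lemma gauss_form:
  assumes "x \<in> U" "u \<in> V" "v \<in> V" "z \<in> V"
  shows "hyp_form i (gauss x u v $ i) (D x z $ i) = hyp_form i (D2 x u v $ i) (D x z $ i)"
  using assms by (simp add: gauss_def hyp_form_simps F_D_orthogonal)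

text \<open>In Koszul's formula the symmetry of \<open>D2\<close> cancels everything except twice
  the weighted pairing of \<open>D2 x u v\<close> with \<open>D x y\<close>. Pairing with a tangent
  vector sees only the tangential part, and \<open>D_surj\<close> lifts that to \<open>V\<close>;
  definiteness of \<open>g\<close> gives uniqueness.\<close>

lemma christoffel_eq:
  assumes x: "x \<in> U" and u: "u \<in> V" and v: "v \<in> V"
  shows "christoffel V g x u v = dir_deriv H (F x) (gauss x u v)"
    "christoffel V g x u v \<in> V" "D x (christoffel V g x u v) = gauss x u v"
proof -
  let ?z = "dir_deriv H (F x) (gauss x u v)"
  let ?K = "\<lambda>w. dir_deriv (\<lambda>y. g y v w) x u + dir_deriv (\<lambda>y. g y u w) x v - dir_deriv (\<lambda>y. g y u v) x w"
  note z = D_surj[OF x gauss_tangent[OF x u v]]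
  have K: "?K y = 2 * g x ?z y" if "y \<in> V" for y
    unfolding dir_deriv_g[OF x u v that] dir_deriv_g[OF x v u that] dir_deriv_g[OF x that u v]
      g_eq[OF x z(1) that] z(2) gauss_form[OF x u v that]
      D2_commute[OF x that v] D2_commute[OF x that u] D2_commute[OF x v u]
      sum.distrib[symmetric] sum_subtractf[symmetric] sum_distrib_left
  proof (rule sum.cong[OF refl])
    fix i
    show "w i * (hyp_form i (D x v $ i) (D2 x u y $ i) + hyp_form i (D2 x u v $ i) (D x y $ i)) +
        w i * (hyp_form i (D x u $ i) (D2 x v y $ i) + hyp_form i (D2 x u v $ i) (D x y $ i)) -
        w i * (hyp_form i (D x u $ i) (D2 x v y $ i) + hyp_form i (D2 x u y $ i) (D x v $ i)) =
        2 * (w i * hyp_form i (D2 x u v $ i) (D x y $ i))"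
      by (simp add: algebra_simps hyp_form_commute[of i "D2 x u y $ i" "D x v $ i"])
  qed
  show eq: "christoffel V g x u v = ?z"
    unfolding christoffel_def
  proof (rule the_equality)
    show "?z \<in> V \<and> (\<forall>w\<in>V. 2 * g x ?z w = ?K w)"
      using z(1) K by simp
    fix z' assume "z' \<in> V \<and> (\<forall>w\<in>V. 2 * g x z' w = ?K w)"
    then have z': "z' \<in> V" and "\<And>w. w \<in> V \<Longrightarrow> g x z' w = g x ?z w"
      using K by auto
    moreover have d: "z' - ?z \<in> V"
      using subspace_V z' z(1) by (rule subspace_diff)
    ultimately have "g x (z' - ?z) (z' - ?z) = 0"
      using g_diff[OF x z' z(1) d] by simp
    then show "z' = ?z"
      using g_definite[OF x d] by simp
  qed
  show "christoffel V g x u v \<in> V" "D x (christoffel V g x u v) = gauss x u v"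
    using z by (simp_all add: eq)
qed

lemma elementary_gauss:
  assumes "u \<in> V" "v \<in> V"
  shows "elementary_map U (\<lambda>x. gauss x u v)"
  using D2_elementary[OF assms] F
    elementary_hyp_form[OF D_component[OF assms(1)] D_component[OF assms(2)]]
  unfolding gauss_def elementary_map_matrix by (auto intro!: elementary_intros)

lemma elementary_christoffel:
  assumes "u \<in> V" "v \<in> V"
  shows "elementary_map U (\<lambda>x. christoffel V g x u v)"
proof (rule elementary_map_cong)
  show "elementary_map U (\<lambda>x. dir_deriv H (F x) (gauss x u v))"
    by (rule elementary_map_differential[OF H F elementary_gauss[OF assms]])
qed (use assms in \<open>simp add: christoffel_eq\<close>)

text \<open>After applying \<open>D x\<close>, all multiples of \<open>F x $ i\<close> disappear in
  the pairing with a tangent vector. The product of forms comes from differentiating the position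
  vector in \<open>gauss\<close>.\<close>

lemma second_covariant_derivative:
  assumes x: "x \<in> U" and u: "u \<in> V" and v: "v \<in> V" and z: "z \<in> V" and y: "y \<in> V"
  shows "levi_civita V g (\<lambda>_. u) (levi_civita V g (\<lambda>_. v) (\<lambda>_. z)) x \<in> V" (is "?E \<in> V")
    "g x (levi_civita V g (\<lambda>_. u) (levi_civita V g (\<lambda>_. v) (\<lambda>_. z)) x) y = (\<Sum>i\<in>UNIV. w i *
      (hyp_form i (dir_deriv (\<lambda>p. D2 p v z) x u $ i) (D x y $ i)
       - hyp_form i (D x v $ i) (D x z $ i) * hyp_form i (D x u $ i) (D x y $ i)))"
proof -
  define N where "N p = christoffel V g p v z" for p
  have N: "elementary_map U N" "\<And>p. p \<in> U \<Longrightarrow> N p \<in> V" "\<And>p. p \<in> U \<Longrightarrow> D p (N p) = gauss p v z"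
    using elementary_christoffel[OF v z] christoffel_eq[OF _ v z] by (simp_all add: N_def[abs_def])
  have dN: "dir_deriv N x u \<in> V"
    by (rule dir_deriv_in_V[OF N(1,2) x u])
  note chr = christoffel_eq[OF x u N(2)[OF x]]
  have "levi_civita V g (\<lambda>_. v) (\<lambda>_. z) = N"
    by (simp add: levi_civita_def N_def fun_eq_iff dir_deriv_const)
  then have E: "?E = dir_deriv N x u + christoffel V g x u (N x)"
    by (simp add: levi_civita_def)
  show EV: "?E \<in> V"
    unfolding E using subspace_V dN chr(2) by (rule subspace_add)
  have "hyp_form i (D x ?E $ i) (D x y $ i) = hyp_form i (dir_deriv (\<lambda>p. D2 p v z) x u $ i) (D x y $ i)
       - hyp_form i (D x v $ i) (D x z $ i) * hyp_form i (D x u $ i) (D x y $ i)" for i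
  proof -
    let ?s = "\<lambda>p. hyp_form i (D p v $ i) (D p z $ i)"
    have s: "elementary_map U ?s"
      using elementary_hyp_form[OF D_component[OF v] D_component[OF z]] by (simp add: elementary_map_real)
    have sF: "elementary_map U (\<lambda>p. ?s p *\<^sub>R F p $ i)"
      using s F_component by (intro elementary_map_scaleR) (simp_all add: elementary_map_real)
    have D2i: "elementary_map U (\<lambda>p. D2 p v z $ i)"
      by (rule elementary_map_component[OF D2_elementary[OF v z]])
    have el: "elementary_map U (\<lambda>p. D p (N p))"
      by (rule elementary_map_cong[OF elementary_gauss[OF v z]]) (rule N(3))
    have "D x ?E $ i = dir_deriv (\<lambda>p. D p (N p)) x u $ i - hyp_form i (D x u $ i) (D x (N x) $ i) *\<^sub>R F x $ i"
      using dir_deriv_apply[OF F N(1,2) x u]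
      unfolding E D_add[OF x dN chr(2)] chr(3) by (simp add: gauss_def)
    also have "dir_deriv (\<lambda>p. D p (N p)) x u $ i = dir_deriv (\<lambda>p. D2 p v z $ i - ?s p *\<^sub>R F p $ i) x u"
      unfolding dir_deriv_row[OF el x u, symmetric]
      by (rule dir_deriv_cong[OF x u]) (simp add: N(3) gauss_def)
    also have "\<dots> = dir_deriv (\<lambda>p. D2 p v z) x u $ i - (?s x *\<^sub>R D x u $ i + dir_deriv ?s x u *\<^sub>R F x $ i)"
      unfolding dir_deriv_diff[OF D2i sF x u] dir_deriv_row[OF D2_elementary[OF v z] x u]
        dir_deriv_bilinear[OF bounded_bilinear_scaleR s F_component x u] dir_deriv_row[OF F x u] ..
    finally show ?thesis
      using F_D_orthogonal[OF x y] by (simp add: hyp_form_simps)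
  qed
  then show "g x ?E y = (\<Sum>i\<in>UNIV. w i *
      (hyp_form i (dir_deriv (\<lambda>p. D2 p v z) x u $ i) (D x y $ i)
       - hyp_form i (D x v $ i) (D x z $ i) * hyp_form i (D x u $ i) (D x y $ i)))"
    by (simp add: g_eq[OF x EV y])
qed

text \<open>The third derivatives of \<open>F\<close> cancel by symmetry, and constant fields
  commute. What remains in factor \<open>i\<close> is \<open>w i\<close> times the curvature tensor
  of hyperbolic space.\<close>

lemma g_curvature_tensor:
  assumes x: "x \<in> U" and u: "u \<in> V" and v: "v \<in> V" and z: "z \<in> V" and y: "y \<in> V"
  shows "g x (curvature_tensor V g (\<lambda>_. u) (\<lambda>_. v) (\<lambda>_. z) x) y = (\<Sum>i\<in>UNIV. w i *
      (hyp_form i (D x u $ i) (D x z $ i) * hyp_form i (D x v $ i) (D x y $ i)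
       - hyp_form i (D x v $ i) (D x z $ i) * hyp_form i (D x u $ i) (D x y $ i)))"
proof -
  note E1 = second_covariant_derivative[OF x u v z y] and E2 = second_covariant_derivative[OF x v u z y]
  have V0: "0 \<in> V" using subspace_V by (rule subspace_0)
  have bracket: "lie_bracket (\<lambda>_. u) (\<lambda>_. v) = (\<lambda>_. 0)"
    by (simp add: lie_bracket_def fun_eq_iff dir_deriv_const)
  have "D x (christoffel V g x 0 z) = D x 0"
    using christoffel_eq(3)[OF x V0 z] by (simp add: gauss_def dir_deriv_zero hyp_form_simps vec_eq_iff)
  then have "christoffel V g x 0 z = 0"
    using D_inj[OF x christoffel_eq(2)[OF x V0 z] V0] by simp
  then have third: "levi_civita V g (\<lambda>_. 0) (\<lambda>_. z) x = 0"
    by (simp add: levi_civita_def dir_deriv_zero)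
  have D3: "dir_deriv (\<lambda>p. D2 p v z) x u = dir_deriv (\<lambda>p. D2 p u z) x v"
    by (rule dir_deriv_commute[OF elementary_map_dir_deriv[OF F z] x v u])
  show ?thesis
    unfolding curvature_tensor_def bracket third diff_zero g_diff[OF x E1(1) E2(1) y] E1(2) E2(2) D3
    by (simp add: sum_subtractf[symmetric] algebra_simps)
qed

lemma sectional_curvature_eq:
  assumes "x \<in> U" "u \<in> V" "v \<in> V"
  defines "q \<equiv> \<lambda>i a b. hyp_form i (D x a $ i) (D x b $ i)"
  shows "sectional_curvature V g x u v =
    - (\<Sum>i\<in>UNIV. w i * (q i u u * q i v v - (q i u v)\<^sup>2)) /
      ((\<Sum>i\<in>UNIV. w i * q i u u) * (\<Sum>i\<in>UNIV. w i * q i v v) - (\<Sum>i\<in>UNIV. w i * q i u v)\<^sup>2)"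
  unfolding sectional_curvature_def g_curvature_tensor[OF assms(1,2,3,3,2)] q_def
  using assms(1-3)
  by (simp add: g_eq sum_negf[symmetric] power2_eq_square algebra_simps hyp_form_commute[of _ "D x v $ _" "D x u $ _"])

end

section \<open>Curvature bounds and point reflections\<close>

lemma gram_mixed_term:
  fixes a b c a' b' c' :: real
  assumes "0 \<le> a" "0 \<le> b" "0 \<le> a'" "0 \<le> b'" "c\<^sup>2 \<le> a * b" "c'\<^sup>2 \<le> a' * b'"
  shows "2 * (c * c') \<le> a * b' + b * a'"
proof (rule power2_le_imp_le)
  have "c\<^sup>2 * c'\<^sup>2 \<le> (a * b) * (a' * b')"
    using assms by (intro mult_mono) auto
  moreover have "0 \<le> (a * b' - b * a')\<^sup>2" by simp
  ultimately show "(2 * (c * c'))\<^sup>2 \<le> (a * b' + b * a')\<^sup>2"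
    by (simp add: power2_eq_square algebra_simps)
  show "0 \<le> a * b' + b * a'"
    using assms by simp
qed

text \<open>Gram determinants of semidefinite forms are superadditive: expanding the products of
  sums leaves, besides the diagonal terms, only mixed terms, and \<open>gram_mixed_term\<close>
  makes these nonnegative.\<close>

lemma sum_gram_le:
  fixes a b c :: "'i \<Rightarrow> real"
  assumes "finite I" "\<And>i. i \<in> I \<Longrightarrow> 0 \<le> a i" "\<And>i. i \<in> I \<Longrightarrow> 0 \<le> b i"
    "\<And>i. i \<in> I \<Longrightarrow> (c i)\<^sup>2 \<le> a i * b i"
  shows "(\<Sum>i\<in>I. a i * b i - (c i)\<^sup>2) \<le> (\<Sum>i\<in>I. a i) * (\<Sum>i\<in>I. b i) - (\<Sum>i\<in>I. c i)\<^sup>2"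
  using assms
proof (induction I rule: finite_induct)
  case (insert k I)
  have "(\<Sum>i\<in>I. 2 * (c k * c i)) \<le> (\<Sum>i\<in>I. a k * b i + b k * a i)"
    using insert.prems by (intro sum_mono gram_mixed_term) auto
  then have "2 * c k * (\<Sum>i\<in>I. c i) \<le> a k * (\<Sum>i\<in>I. b i) + b k * (\<Sum>i\<in>I. a i)"
    by (simp add: sum.distrib sum_distrib_left mult.assoc)
  moreover have "(\<Sum>i\<in>I. a i * b i - (c i)\<^sup>2) \<le> (\<Sum>i\<in>I. a i) * (\<Sum>i\<in>I. b i) - (\<Sum>i\<in>I. c i)\<^sup>2"
    using insert by auto
  ultimately show ?case
    using insert.hyps by (simp add: power2_eq_square algebra_simps)
qed simp

section \<open>Sectional curvature and point reflections of the product\<close>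

context hyperbolic_product_chart
begin

lemma row_Cauchy_Schwarz:
  assumes "x \<in> U" "u \<in> V" "v \<in> V"
  shows "(hyp_form i (D x u $ i) (D x v $ i))\<^sup>2 \<le>
    hyp_form i (D x u $ i) (D x u $ i) * hyp_form i (D x v $ i) (D x v $ i)"
  using assms by (intro tangent_Cauchy_Schwarz[OF F_row(1,2) F_D_orthogonal(1) F_D_orthogonal(1)])

text \<open>Divided by \<open>g x v v\<close>, the determinant is the squared length of the
  component \<open>z\<close> of \<open>u\<close> orthogonal to \<open>v\<close>, and independence
  makes \<open>z\<close> nonzero.\<close>

lemma gram_pos:
  assumes x: "x \<in> U" and u: "u \<in> V" and v: "v \<in> V" and "u \<noteq> v" "independent {u, v}"
  shows "0 < g x u u * g x v v - (g x u v)\<^sup>2"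
proof -
  have v0: "v \<noteq> 0" and nspan: "u \<notin> span {v}"
    using assms(4,5) dependent_zero[of "{u, v}"] by (auto simp: independent_insert)
  have vv: "0 < g x v v"
    by (rule g_pos[OF x v v0])
  define z where "z = u - (g x u v / g x v v) *\<^sub>R v"
  have cv: "(g x u v / g x v v) *\<^sub>R v \<in> V"
    using subspace_V v by (rule subspace_scale)
  have z: "z \<in> V"
    unfolding z_def using subspace_V u cv by (rule subspace_diff)
  have "z \<noteq> 0"
    using nspan span_scale[OF span_base[of v "{v}"], of "g x u v / g x v v"] by (auto simp: z_def)
  then have "0 < g x z z" by (rule g_pos[OF x z])
  also have "g x z z = g x u z - g x u v / g x v v * g x v z"
    using g_linear[OF x u v z, of 1 "- (g x u v / g x v v)"] by (simp add: z_def)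
  also have "g x u z = g x u u - g x u v / g x v v * g x v u"
    using g_linear[OF x u v u, of 1 "- (g x u v / g x v v)"] g_commute[OF x u z] by (simp add: z_def)
  also have "g x v z = 0"
    using g_linear[OF x u v v, of 1 "- (g x u v / g x v v)"] g_commute[OF x v z] vv by (simp add: z_def)
  finally have "0 < g x u u - (g x u v)\<^sup>2 / g x v v"
    by (simp add: g_commute[OF x v u] power2_eq_square)
  then show ?thesis
    using vv by (simp add: field_simps)
qed

text \<open>The curvature is \<open>- N / G\<close>, and \<open>m * N \<le> G\<close> follows by
  superadditivity from \<open>m * w i \<le> (w i)\<^sup>2\<close>. That inequality is available for
  the factors of dimension at least 2, and the Gram determinants of the others vanish.\<close>

lemma sectional_curvature_bounds:
  assumes x: "x \<in> U" and u: "u \<in> V" and v: "v \<in> V" and indep: "u \<noteq> v" "independent {u, v}"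
    and m: "0 < m" "\<And>i. 2 \<le> index_pos i \<Longrightarrow> m \<le> w i"
  shows "sectional_curvature V g x u v \<in> {- (1 / m)..0}"
proof -
  define a where "a i = hyp_form i (D x u $ i) (D x u $ i)" for i
  define b where "b i = hyp_form i (D x v $ i) (D x v $ i)" for i
  define c where "c i = hyp_form i (D x u $ i) (D x v $ i)" for i
  define N where "N = (\<Sum>i\<in>UNIV. w i * (a i * b i - (c i)\<^sup>2))"
  define G where "G = (\<Sum>i\<in>UNIV. w i * a i) * (\<Sum>i\<in>UNIV. w i * b i) - (\<Sum>i\<in>UNIV. w i * c i)\<^sup>2"
  have K: "sectional_curvature V g x u v = - N / G"
    unfolding sectional_curvature_eq[OF x u v] a_def b_def c_def N_def G_def ..
  have G: "0 < G"
    using gram_pos[OF x u v indep] by (simp add: G_def g_eq x u v a_def b_def c_def)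
  have CS: "(c i)\<^sup>2 \<le> a i * b i" for i
    unfolding a_def b_def c_def by (rule row_Cauchy_Schwarz[OF x u v])
  have N: "0 \<le> N"
    unfolding N_def using CS w_pos by (intro sum_nonneg mult_nonneg_nonneg) (auto simp: less_imp_le)
  have "m * (w i * (a i * b i - (c i)\<^sup>2)) \<le> (w i * a i) * (w i * b i) - (w i * c i)\<^sup>2" for i
  proof (cases "2 \<le> index_pos i")
    case True
    have "m * (w i * (a i * b i - (c i)\<^sup>2)) \<le> w i * (w i * (a i * b i - (c i)\<^sup>2))"
      using m(2)[OF True] CS[of i] w_pos[of i] by (intro mult_right_mono mult_nonneg_nonneg) auto
    then show ?thesis by (simp add: power2_eq_square algebra_simps)
  next
    case False
    then have "a i * b i = (c i)\<^sup>2"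
      unfolding a_def b_def c_def
      using tangent_form_degenerate[OF F_row(1)[OF x] F_D_orthogonal(1)[OF x u] F_D_orthogonal(1)[OF x v], of i]
      by simp
    moreover have "(w i * a i) * (w i * b i) = (w i)\<^sup>2 * (a i * b i)"
      by (simp add: power2_eq_square)
    ultimately show ?thesis by (simp add: power_mult_distrib)
  qed
  then have "m * N \<le> (\<Sum>i\<in>UNIV. (w i * a i) * (w i * b i) - (w i * c i)\<^sup>2)"
    unfolding N_def sum_distrib_left by (rule sum_mono)
  also have "\<dots> \<le> G"
    unfolding G_def
  proof (rule sum_gram_le)
    show "0 \<le> w i * a i" "0 \<le> w i * b i" for i
      unfolding a_def b_def using g_nonneg[OF x] u v by auto
    show "(w i * c i)\<^sup>2 \<le> w i * a i * (w i * b i)" for i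
      using mult_left_mono[OF CS[of i], of "(w i)\<^sup>2"] by (simp add: power2_eq_square algebra_simps)
  qed simp
  finally have "N / G \<le> 1 / m"
    using G m(1) by (simp add: field_simps)
  then show ?thesis
    using K N G by simp
qed

lemma orthogonal_tangents:
  assumes x: "x \<in> U" and A: "\<And>i. A $ i \<in> hyperboloid_tangent i (F x $ i)"
    and B: "\<And>i. B $ i \<in> hyperboloid_tangent i (F x $ i)"
    and orth: "(\<Sum>i\<in>UNIV. w i * hyp_form i (A $ i) (B $ i)) = 0" and nz: "A \<noteq> 0" "B \<noteq> 0"
  obtains u v where "u \<in> V" "v \<in> V" "u \<noteq> v" "independent {u, v}" "D x u = A" "D x v = B"
proof -
  define u where "u = dir_deriv H (F x) A"
  define v where "v = dir_deriv H (F x) B"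
  have u: "u \<in> V" "D x u = A" and v: "v \<in> V" "D x v = B"
    using D_surj[OF x A] D_surj[OF x B] by (simp_all add: u_def v_def)
  have u0: "u \<noteq> 0" and v0: "v \<noteq> 0"
    using nz u v by (auto simp: dir_deriv_zero)
  have guv: "g x u v = 0"
    using orth by (simp add: g_eq x u v)
  have nspan: "u \<notin> span {v}"
  proof
    assume "u \<in> span {v}"
    then obtain k where k: "u = k *\<^sub>R v" by (auto simp: span_singleton)
    then have "g x u u = k * g x v u"
      using g_linear[OF x v(1) v(1) u(1), of k 0] by simp
    then show False
      using guv g_pos[OF x u(1) u0] by (simp add: g_commute[OF x v(1) u(1)])
  qed
  moreover have "independent {v}"
    using v0 by (simp add: independent_insert)
  ultimately have "independent {u, v}" "u \<noteq> v"
    using span_base[of v "{v}"] by (auto simp: independent_insert)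
  then show thesis
    using that u v by blast
qed

text \<open>A plane spanned by directions in two different factors is flat, one tangent to a single factor
  \<open>i\<close> has curvature \<open>- 1 / w i\<close>.\<close>

lemma not_constant_curvature:
  fixes i j j' k l :: 'n
  assumes x: "x \<in> U" and i: "j < i" "j' < i" "j \<noteq> j'" and k: "l < k" "k \<noteq> i"
  shows "\<not> constant_curvature V U g"
proof
  assume "constant_curvature V U g"
  then obtain c where c: "sectional_curvatures V U g \<subseteq> {c}"
    by (auto simp: constant_curvature_def)
  define T :: "'n \<Rightarrow> real^'n::{finite,linorder} \<Rightarrow> real^'n::{finite,linorder}^'n::{finite,linorder}"
    where "T i v = (\<chi> r. if r = i then v else 0)" for i v
  have T: "T i v $ r \<in> hyperboloid_tangent r (F x $ r)"
    if "v \<in> hyperboloid_tangent i (F x $ i)" for i v r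
    using that by (auto simp: T_def hyperboloid_tangent_def hyp_form_simps)
  have sum_T: "(\<Sum>r\<in>UNIV. w r * hyp_form r (T i v $ r) (B $ r)) = w i * hyp_form i v (B $ i)" for i v B
  proof -
    have "(\<Sum>r\<in>UNIV. w r * hyp_form r (T i v $ r) (B $ r)) =
        (\<Sum>r\<in>UNIV. if r = i then w i * hyp_form i v (B $ i) else 0)"
      by (intro sum.cong) (auto simp: T_def hyp_form_simps)
    then show ?thesis by simp
  qed
  have Tsame: "T i v $ i = v" for i v by (simp add: T_def)
  have Tnz: "T i v \<noteq> 0" if "v \<noteq> 0" for i v
    using that Tsame[of i v] by auto
  \<comment> \<open>The \<open>j\<close>-th unit vector, corrected in the last coordinate
    \<open>i\<close> so as to be tangent at \<open>F x $ i\<close>.\<close>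
  define t :: "'n \<Rightarrow> 'n \<Rightarrow> real^'n::{finite,linorder}"
    where "t i j = (\<chi> s. if s = j then 1 else if s = i then F x $ i $ j / F x $ i $ i else 0)" for i j
  have t: "t i j \<in> hyperboloid_tangent i (F x $ i)" if "j < i" for i j
  proof -
    have "(\<Sum>s<i. F x $ i $ s * t i j $ s) = (\<Sum>s<i. if s = j then F x $ i $ j else 0)"
      by (intro sum.cong) (auto simp: t_def)
    then have "(\<Sum>s<i. F x $ i $ s * t i j $ s) = F x $ i $ j"
      using that by simp
    then show ?thesis
      using that F_row(1)[OF x, of i] by (auto simp: t_def hyperboloid_tangent_def hyp_form_def)
  qed
  have tnz: "t i j \<noteq> 0" for i j
    by (auto simp: t_def vec_eq_iff)
  have curv: "sectional_curvature V g x u v = c" if "u \<in> V" "v \<in> V" "u \<noteq> v" "independent {u, v}" for u v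
    using c that x unfolding sectional_curvatures_def by blast
  have "(\<Sum>r\<in>UNIV. w r * hyp_form r (T i (t i j) $ r) (T k (t k l) $ r)) = 0"
    unfolding sum_T using k(2) by (simp add: T_def hyp_form_simps)
  then obtain u v where uv: "u \<in> V" "v \<in> V" "u \<noteq> v" "independent {u, v}"
      "D x u = T i (t i j)" "D x v = T k (t k l)"
    using orthogonal_tangents[OF x T[OF t[OF i(1)]] T[OF t[OF k(1)]] _ Tnz[OF tnz] Tnz[OF tnz]] by blast
  have zero: "hyp_form r (T i (t i j) $ r) (T i (t i j) $ r) * hyp_form r (T k (t k l) $ r) (T k (t k l) $ r) = 0"
    "hyp_form r (T i (t i j) $ r) (T k (t k l) $ r) = 0" for r
    using k(2) by (auto simp: T_def hyp_form_simps)
  then have "sectional_curvature V g x u v = 0"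
    unfolding sectional_curvature_eq[OF x uv(1,2)] uv(5,6) by (simp only: zero) simp
  then have c0: "c = 0"
    using curv uv by simp
  define e where "e = t i j"
  define f where "f = t i j' - (hyp_form i (t i j') e / hyp_form i e e) *\<^sub>R e"
  have e: "e \<in> hyperboloid_tangent i (F x $ i)" and j': "t i j' \<in> hyperboloid_tangent i (F x $ i)"
    unfolding e_def using t i by auto
  then have f: "f \<in> hyperboloid_tangent i (F x $ i)"
    by (simp add: f_def hyperboloid_tangent_def hyp_form_simps)
  have ee: "hyp_form i e e \<noteq> 0"
    using tangent_form_definite[OF F_hyperboloid[OF x] e] tnz by (auto simp: e_def)
  then have ef: "hyp_form i e f = 0"
    by (simp add: f_def hyp_form_simps hyp_form_commute[of i e "t i j'"])
  \<comment> \<open>The vector \<open>e\<close> vanishes at \<open>j'\<close>, so the Gram-Schmidt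
    correction keeps this entry.\<close>
  have "f $ j' = 1"
    using i by (simp add: f_def e_def t_def)
  then have f0: "f \<noteq> 0" by auto
  then have ff: "hyp_form i f f \<noteq> 0"
    using tangent_form_definite[OF F_hyperboloid[OF x] f] by auto
  have "(\<Sum>r\<in>UNIV. w r * hyp_form r (T i e $ r) (T i f $ r)) = 0"
    unfolding sum_T using ef by (simp add: Tsame)
  then obtain u v where uv: "u \<in> V" "v \<in> V" "u \<noteq> v" "independent {u, v}" "D x u = T i e" "D x v = T i f"
    using orthogonal_tangents[OF x T[OF e] T[OF f] _ Tnz Tnz] f0 tnz unfolding e_def by blast
  have "(\<Sum>r\<in>UNIV. w r * (hyp_form r (T i e $ r) (T i e $ r) * hyp_form r (T i f $ r) (T i f $ r) -
      (hyp_form r (T i e $ r) (T i f $ r))\<^sup>2)) = (\<Sum>r\<in>UNIV. if r = i then w i * (hyp_form i e e * hyp_form i f f) else 0)"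
    by (intro sum.cong) (auto simp: T_def hyp_form_simps ef)
  also have "\<dots> = w i * (hyp_form i e e * hyp_form i f f)" by simp
  also have "\<dots> \<noteq> 0"
    using ee ff w_pos[of i] by simp
  finally have "sectional_curvature V g x u v \<noteq> 0"
    using ee ff w_pos[of i] unfolding sectional_curvature_eq[OF x uv(1,2)] uv(5,6) sum_T by (simp add: Tsame ef)
  then show False
    using curv uv(1-4) c0 by simp
qed

text \<open>In the coordinates \<open>F\<close> the symmetry is the factorwise linear map
  \<open>S\<close>. It preserves the hyperboloids, where \<open>hyp_lift\<close> is the identity;
  hence \<open>F (s x) = S (F x)\<close>. As \<open>s\<close> is an involution, its inverse is
  smooth as well, and on vectors orthogonal to \<open>F p\<close> in each factor \<open>S\<close> is
  multiplication by \<open>- 1\<close>.\<close>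

lemma point_reflection:
  assumes p: "p \<in> U"
  obtains s where "riemannian_isometry V U g s" "s p = p" "\<And>v. v \<in> V \<Longrightarrow> dir_deriv s p v = - v"
proof -
  define S where "S Y = (\<chi> i. hyp_reflect i (F p $ i) (Y $ i))" for Y :: "real^'n::{finite,linorder}^'n::{finite,linorder}"
  define s where "s x = H (S (F x))" for x
  have S_comp: "S Y $ i = hyp_reflect i (F p $ i) (Y $ i)" for Y i
    by (simp add: S_def)
  have lin: "bounded_linear S"
  proof -
    have "linear S"
      by (rule linearI) (auto simp: S_def hyp_reflect_def vec_eq_iff hyp_form_simps algebra_simps)
    then show ?thesis by (rule linear_conv_bounded_linear[THEN iffD1])
  qed
  have FpFp: "hyp_form i (F p $ i) (F p $ i) = - 1" for i
    by (rule F_row(2)[OF p])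
  have S_hyp: "S (F x) $ i \<in> hyperboloid i" if "x \<in> U" for x i
    using hyp_reflect_hyperboloid[OF F_hyperboloid[OF p] F_hyperboloid[OF that]] by (simp add: S_comp)
  have SS: "S (S Y) = Y" for Y
    by (simp add: vec_eq_iff S_comp hyp_reflect_involution FpFp)
  have sU: "s x \<in> U" for x by (simp add: s_def H_in)
  have Fs: "F (s x) = S (F x)" if "x \<in> U" for x
    using hyp_lift_ident[OF S_hyp[OF that]] by (simp add: s_def FH)
  have ss: "s (s x) = x" if "x \<in> U" for x
    unfolding s_def[of "s x"] Fs[OF that] SS by (rule HF[OF that])
  have SF: "elementary_map U (\<lambda>x. S (F x))"
    using F elementary_hyp_form[OF F_component, of "\<lambda>x. F p $ i" for i]
    unfolding S_def hyp_reflect_def elementary_map_matrix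
    by (auto intro!: elementary_intros elementary_hyp_form F_component simp: elementary_map_vec)
  have els: "elementary_map U s"
    unfolding s_def[abs_def] by (rule elementary_map_compose[OF H SF]) simp
  have bij: "bij_betw s U U"
    by (rule bij_betw_byWitness[of _ s]) (auto simp: ss sU)
  have inv: "the_inv_into U s x = s x" if "x \<in> U" for x
    using that bij ss sU by (intro the_inv_into_f_eq) (auto simp: bij_betw_def)
  have Ds: "D (s x) (dir_deriv s x u) = S (D x u)" and sV: "dir_deriv s x u \<in> V" if "x \<in> U" "u \<in> V" for x u
  proof -
    note chain = dir_deriv_compose[OF affine_domain affine_domain els F _ that]
    show "dir_deriv s x u \<in> V" using chain(2) sU by blast
    have "D (s x) (dir_deriv s x u) = dir_deriv (\<lambda>x. F (s x)) x u"
      using chain(1) sU by (simp add: image_subset_iff)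
    also have "\<dots> = dir_deriv (\<lambda>x. S (F x)) x u"
      by (rule dir_deriv_cong[OF that Fs])
    also have "\<dots> = S (D x u)"
      by (rule dir_deriv_bounded_linear[OF lin F that])
    finally show "D (s x) (dir_deriv s x u) = S (D x u)" .
  qed
  have "riemannian_isometry V U g s"
    unfolding riemannian_isometry_def
  proof (intro conjI ballI bij elementary_map_smooth_on els)
    show "elementary_map U (the_inv_into U s)"
      by (rule elementary_map_cong[OF els inv])
    fix x u v assume *: "x \<in> U" "u \<in> V" "v \<in> V"
    then show "pullback s g x u v = g x u v"
      by (simp add: pullback_def g_eq sU sV Ds S_comp hyp_reflect_form FpFp)
  qed
  moreover have sp: "s p = p"
  proof -
    have "S (F p) = F p"
      by (simp add: vec_eq_iff S_comp hyp_reflect_def FpFp)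
    then show ?thesis by (simp add: s_def HF p)
  qed
  moreover have "dir_deriv s p v = - v" if v: "v \<in> V" for v
  proof -
    have "D p (dir_deriv s p v) = S (D p v)"
      using Ds[OF p v] sp by simp
    also have "\<dots> = - D p v"
      by (simp add: vec_eq_iff S_comp hyp_reflect_def F_D_orthogonal[OF p v])
    also have "\<dots> = D p (- v)"
      using D_scale[OF p v, of "-1"] by simp
    finally show ?thesis
      using D_inj[OF p sV[OF p v]] subspace_neg[OF subspace_V v] by simp
  qed
  ultimately show thesis using that by blast
qed

lemma riemannian_symmetric_space: "riemannian_symmetric_space V U g"
  unfolding riemannian_symmetric_space_def
proof (intro conjI ballI)
  have "U = range H"
    using HF H_in by (auto simp: image_iff) metis
  then show "connected U"
    using connected_continuous_image[OF elementary_map_continuous[OF H] convex_connected[OF convex_UNIV]]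
    by simp
  fix p assume "p \<in> U"
  then show "\<exists>s. riemannian_isometry V U g s \<and> s p = p \<and> (\<forall>v\<in>V. dir_deriv s p v = - v)"
    using point_reflection by metis
qed (rule riemannian_manifold)

end

section \<open>Distance\<close>

lemma elementary_real_ident: "elementary_on U (\<lambda>t::real. t)"
  using elementary_on.coord[of U "1::real"] by simp

context hyperbolic_product_chart
begin

definition hyp_dist :: "'a \<Rightarrow> 'a \<Rightarrow> 'n \<Rightarrow> real" where
  "hyp_dist x y i = arcosh (- hyp_form i (F x $ i) (F y $ i))"

lemma hyp_dist_nonneg: "x \<in> U \<Longrightarrow> y \<in> U \<Longrightarrow> 0 \<le> hyp_dist x y i"
  using hyperboloid_form_le[OF F_hyperboloid F_hyperboloid, of x y i] by (simp add: hyp_dist_def)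

lemma geodesic_directions:
  assumes "x \<in> U" "y \<in> U"
  obtains W where "\<And>i. W i \<in> hyperboloid_tangent i (F x $ i)"
    "\<And>i. hyp_form i (W i) (W i) = (if hyp_dist x y i = 0 then 0 else 1)"
    "\<And>i. hyp_dist x y i = 0 \<Longrightarrow> W i = 0"
    "\<And>i. F y $ i = cosh (hyp_dist x y i) *\<^sub>R F x $ i + sinh (hyp_dist x y i) *\<^sub>R W i"
proof -
  have "\<exists>v. v \<in> hyperboloid_tangent i (F x $ i) \<and> hyp_form i v v = (if hyp_dist x y i = 0 then 0 else 1) \<and>
      (hyp_dist x y i = 0 \<longrightarrow> v = 0) \<and>
      F y $ i = cosh (hyp_dist x y i) *\<^sub>R F x $ i + sinh (hyp_dist x y i) *\<^sub>R v" for i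
    by (rule hyperboloid_geodesic[OF F_hyperboloid[OF assms(1)] F_hyperboloid[OF assms(2)], of i])
      (auto simp: hyp_dist_def)
  then obtain W where "\<And>i. W i \<in> hyperboloid_tangent i (F x $ i) \<and>
      hyp_form i (W i) (W i) = (if hyp_dist x y i = 0 then 0 else 1) \<and>
      (hyp_dist x y i = 0 \<longrightarrow> W i = 0) \<and>
      F y $ i = cosh (hyp_dist x y i) *\<^sub>R F x $ i + sinh (hyp_dist x y i) *\<^sub>R W i"
    by metis
  then show thesis by (intro that[of W]) blast+
qed

lemma curve_D:
  assumes "(c has_vector_derivative c') (at t)" "open S" "t \<in> S" "c ` S \<subseteq> U"
  shows "((\<lambda>t. F (c t) $ i) has_vector_derivative D (c t) c' $ i) (at t)" "c' \<in> V"
  using elementary_map_curve_derivative[OF F assms]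
  by (auto intro: bounded_linear.has_vector_derivative[OF bounded_linear_vec_nth])

text \<open>Every component runs along its hyperbolic geodesic with constant speed
  \<open>hyp_dist x y i\<close>, so the product path has constant speed equal to the claimed length.
  A component at distance 0 rests, in line with \<open>W i = 0\<close>.\<close>

lemma minimizing_path:
  assumes x: "x \<in> U" and y: "y \<in> U"
  obtains c where "valid_path c" "path_image c \<subseteq> U" "pathstart c = x" "pathfinish c = y"
    "((\<lambda>t. sqrt (g (c t) (vector_derivative c (at t)) (vector_derivative c (at t)))) has_integral
      sqrt (\<Sum>i\<in>UNIV. w i * (hyp_dist x y i)\<^sup>2)) {0..1}"
proof -
  interpret R: affine_chart "UNIV :: real set" UNIV
    by (rule affine_chart_UNIV)
  obtain W where W: "\<And>i. W i \<in> hyperboloid_tangent i (F x $ i)"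
    "\<And>i. hyp_form i (W i) (W i) = (if hyp_dist x y i = 0 then 0 else 1)"
    "\<And>i. hyp_dist x y i = 0 \<Longrightarrow> W i = 0"
    "\<And>i. F y $ i = cosh (hyp_dist x y i) *\<^sub>R F x $ i + sinh (hyp_dist x y i) *\<^sub>R W i"
    using geodesic_directions[OF x y] by blast
  define d where "d = hyp_dist x y"
  \<comment> \<open>Defined for all real \<open>t\<close>, which gives two-sided derivatives at the
    end points as well.\<close>
  define P where "P t = (\<chi> i. cosh (t * d i) *\<^sub>R F x $ i + sinh (t * d i) *\<^sub>R W i)" for t
  define c where "c t = H (P t)" for t
  have P: "elementary_map UNIV P"
    unfolding elementary_map_matrix P_def
    by (auto intro!: elementary_intros elementary_cosh elementary_sinh elementary_real_ident)
  have "P t $ i \<in> hyperboloid i" for t i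
    using geodesic_in_hyperboloid[OF F_hyperboloid[OF x] W(1), of i "t * d i"] W(2,3)[of i] F_hyperboloid[OF x]
    by (cases "d i = 0") (simp_all add: P_def d_def)
  then have Fc: "F (c t) = P t" for t
    by (simp add: c_def FH hyp_lift_ident)
  have cU: "c t \<in> U" for t
    by (simp add: c_def H_in)
  have c: "elementary_map UNIV c"
    unfolding c_def[abs_def] by (rule elementary_map_compose[OF H P]) simp
  have c': "(c has_vector_derivative dir_deriv c t 1) (at t)" for t
    using R.elementary_map_curve_derivative[OF c _ open_UNIV, of "\<lambda>t. t" 1 t] by simp
  have "c C1_differentiable_on {0..1}"
    unfolding C1_differentiable_on_def
    using c' elementary_map_continuous[OF R.elementary_map_dir_deriv[OF c, of 1]]
    by (intro exI[of _ "\<lambda>t. dir_deriv c t 1"]) (auto intro: continuous_on_subset)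
  then have valid: "valid_path c"
    by (simp add: valid_path_def C1_differentiable_imp_piecewise)
  have c0: "c 0 = x" and c1: "c 1 = y"
  proof -
    have "P 0 = F x" "P 1 = F y"
      by (simp_all add: P_def vec_eq_iff W(4) d_def)
    then show "c 0 = x" "c 1 = y" by (simp_all add: c_def HF x y)
  qed
  have speed: "g (c t) (dir_deriv c t 1) (dir_deriv c t 1) = (\<Sum>i\<in>UNIV. w i * (hyp_dist x y i)\<^sup>2)" for t
  proof -
    have imc: "c ` UNIV \<subseteq> U" using cU by blast
    note D = curve_D[OF c' open_UNIV UNIV_I imc]
    have "hyp_form i (D (c t) (dir_deriv c t 1) $ i) (D (c t) (dir_deriv c t 1) $ i) = (d i)\<^sup>2" for i
    proof -
      have 1: "((\<lambda>t. cosh (t * d i) *\<^sub>R F x $ i + sinh (t * d i) *\<^sub>R W i) has_vector_derivative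
          (d i * sinh (t * d i)) *\<^sub>R F x $ i + (d i * cosh (t * d i)) *\<^sub>R W i) (at t)"
        by (auto intro!: derivative_eq_intros simp: mult.commute)
      have 2: "((\<lambda>t. cosh (t * d i) *\<^sub>R F x $ i + sinh (t * d i) *\<^sub>R W i) has_vector_derivative
          D (c t) (dir_deriv c t 1) $ i) (at t)"
        using D(1)[of i t] by (simp add: Fc P_def)
      have eq: "D (c t) (dir_deriv c t 1) $ i =
          (d i * sinh (t * d i)) *\<^sub>R F x $ i + (d i * cosh (t * d i)) *\<^sub>R W i"
        by (rule vector_derivative_unique_at[OF 2 1])
      have "hyp_form i (F x $ i) (W i) = 0" "hyp_form i (W i) (F x $ i) = 0"
        using W(1)[of i] by (auto simp: hyperboloid_tangent_def hyp_form_commute)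
      then have "hyp_form i (D (c t) (dir_deriv c t 1) $ i) (D (c t) (dir_deriv c t 1) $ i) =
          (d i)\<^sup>2 * ((cosh (t * d i))\<^sup>2 * hyp_form i (W i) (W i) - (sinh (t * d i))\<^sup>2)"
        unfolding eq by (simp add: hyp_form_simps F_row(2)[OF x] power2_eq_square algebra_simps)
      also have "\<dots> = (d i)\<^sup>2"
        using hyperbolic_pythagoras[of "t * d i"] W(2)[of i] by (cases "d i = 0") (simp_all add: d_def)
      finally show ?thesis .
    qed
    then show ?thesis
      using D(2) by (simp add: g_eq cU d_def)
  qed
  have "((\<lambda>t. sqrt (g (c t) (vector_derivative c (at t)) (vector_derivative c (at t)))) has_integral
      sqrt (\<Sum>i\<in>UNIV. w i * (hyp_dist x y i)\<^sup>2)) {0..1}"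
    using has_integral_const_real[of "sqrt (\<Sum>i\<in>UNIV. w i * (hyp_dist x y i)\<^sup>2)" 0 1]
    by (simp add: vector_derivative_at[OF c'] speed)
  then show thesis
    using valid c0 c1 cU by (intro that[of c]) (auto simp: path_image_def pathstart_def pathfinish_def)
qed

text \<open>Calibration: the sum of the signed distances to the hypersurfaces orthogonal to the component
  geodesics, with coefficients \<open>w i\<close> times the \<open>i\<close>-th distance over the total distance, is 1-Lipschitz and grows by the total distance.\<close>

lemma path_length_ge:
  assumes c: "valid_path c" "path_image c \<subseteq> U"
    and l: "((\<lambda>t. sqrt (g (c t) (vector_derivative c (at t)) (vector_derivative c (at t)))) has_integral l) {0..1}"
  shows "sqrt (\<Sum>i\<in>UNIV. w i * (hyp_dist (pathstart c) (pathfinish c) i)\<^sup>2) \<le> l"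
proof -
  define x where "x = c 0"
  define y where "y = c 1"
  have cU: "c t \<in> U" if "t \<in> {0..1}" for t
    using c(2) that by (auto simp: path_image_def)
  have x: "x \<in> U" and y: "y \<in> U"
    using cU by (simp_all add: x_def y_def)
  obtain W where W: "\<And>i. W i \<in> hyperboloid_tangent i (F x $ i)"
    "\<And>i. hyp_form i (W i) (W i) = (if hyp_dist x y i = 0 then 0 else 1)"
    "\<And>i. hyp_dist x y i = 0 \<Longrightarrow> W i = 0"
    "\<And>i. F y $ i = cosh (hyp_dist x y i) *\<^sub>R F x $ i + sinh (hyp_dist x y i) *\<^sub>R W i"
    using geodesic_directions[OF x y] by blast
  define d where "d = hyp_dist x y"
  define L where "L = sqrt (\<Sum>i\<in>UNIV. w i * (d i)\<^sup>2)"
  have d0: "0 \<le> d i" for i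
    unfolding d_def by (rule hyp_dist_nonneg[OF x y])
  have sum0: "0 \<le> (\<Sum>i\<in>UNIV. w i * (d i)\<^sup>2)"
    using w_pos by (intro sum_nonneg) (simp add: less_imp_le)
  then have L0: "0 \<le> L" and LL: "(\<Sum>i\<in>UNIV. w i * (d i)\<^sup>2) = L * L"
    by (simp_all add: L_def)
  define q where "q i t = hyp_form i (F (c t) $ i) (W i)" for i t
  \<comment> \<open>For \<open>L = 0\<close> division by zero turns all coefficients, and hence
    \<open>f\<close>, into 0, in agreement with the end value \<open>L\<close>.\<close>
  define f where "f t = (\<Sum>i\<in>UNIV. (w i * d i / L) * arsinh (q i t))" for t
  define speed where "speed t = sqrt (g (c t) (vector_derivative c (at t)) (vector_derivative c (at t)))" for t
  obtain S where S: "finite S" "c C1_differentiable_on ({0..1} - S)" and cont: "continuous_on {0..1} c"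
    using c(1) unfolding valid_path_def piecewise_C1_differentiable_on_def by blast
  \<comment> \<open>At the break points and the end points the value is \<open>speed t\<close>: the
    comparison with the speed then holds on the whole interval, and finitely many values do not
    affect the integral.\<close>
  define f' where "f' t = (if t \<in> {0<..<1} - S then (\<Sum>i\<in>UNIV. (w i * d i / L) *
      (hyp_form i (D (c t) (vector_derivative c (at t)) $ i) (W i) / sqrt ((q i t)\<^sup>2 + 1))) else speed t)" for t
  have good: "(c has_vector_derivative vector_derivative c (at t)) (at t)" if "t \<in> {0<..<1} - S" for t
    using S(2) that unfolding C1_differentiable_on_eq
    by (auto simp: vector_derivative_works[symmetric])
  have im: "c ` {0<..<1} \<subseteq> U"
    using cU by auto
  have deriv: "(f has_vector_derivative f' t) (at t)" if t: "t \<in> {0<..<1} - S" for t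
  proof -
    have t01: "t \<in> {0<..<1}" using t by blast
    note D = curve_D[OF good[OF t] open_greaterThanLessThan t01 im]
    have "(q i has_vector_derivative hyp_form i (D (c t) (vector_derivative c (at t)) $ i) (W i)) (at t)" for i
      unfolding q_def
      by (rule bounded_linear.has_vector_derivative[OF bounded_bilinear.bounded_linear_left[OF bounded_bilinear_hyp_form] D(1)])
    then have dq: "(q i has_real_derivative hyp_form i (D (c t) (vector_derivative c (at t)) $ i) (W i)) (at t)" for i
      by (simp add: has_real_derivative_iff_has_vector_derivative)
    have ars: "((\<lambda>t. arsinh (q i t)) has_real_derivative
        hyp_form i (D (c t) (vector_derivative c (at t)) $ i) (W i) / sqrt ((q i t)\<^sup>2 + 1)) (at t)" for i
      using DERIV_chain2[OF arsinh_real_has_field_derivative dq[of i]] by simp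
    have "(f has_real_derivative f' t) (at t)"
      unfolding f_def f'_def if_P[OF t] by (intro DERIV_sum DERIV_cmult ars)
    then show ?thesis
      by (simp add: has_real_derivative_iff_has_vector_derivative)
  qed
  have "continuous_on {0..1} (\<lambda>t. F (c t))"
    using continuous_on_compose2[OF elementary_map_continuous[OF F] cont] cU by blast
  then have contq: "continuous_on {0..1} (q i)" for i
    unfolding q_def by (intro bounded_bilinear.continuous_on[OF bounded_bilinear_hyp_form] continuous_intros)
  then have contf: "continuous_on {0..1} f"
    unfolding f_def by (intro continuous_intros)
  have "(f' has_integral (f 1 - f 0)) {0..1}"
    by (rule fundamental_theorem_of_calculus_interior_strong[OF S(1) _ deriv contf]) auto
  moreover have "f 0 = 0"
    using W(1) unfolding f_def q_def x_def[symmetric] by (simp add: hyperboloid_tangent_def)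
  moreover have "f 1 = L"
  proof -
    have "q i 1 = sinh (d i)" for i
      using W(1,2)[of i] unfolding q_def y_def[symmetric] W(4)
      by (simp add: hyp_form_simps hyperboloid_tangent_def d_def)
    then have "f 1 = (\<Sum>i\<in>UNIV. w i * (d i)\<^sup>2) / L"
      by (simp add: f_def arsinh_sinh_real sum_divide_distrib power2_eq_square mult.assoc)
    then show ?thesis by (simp add: LL)
  qed
  ultimately have f': "(f' has_integral L) {0..1}" by simp
  have "f' t \<le> speed t" if "t \<in> {0..1}" for t
  proof (cases "t \<in> {0<..<1} - S")
    case True
    then have t01: "t \<in> {0<..<1}" by blast
    let ?v = "vector_derivative c (at t)"
    have v: "?v \<in> V" by (rule curve_D(2)[OF good[OF True] open_greaterThanLessThan t01 im])
    define s where "s i = hyp_form i (D (c t) ?v $ i) (D (c t) ?v $ i)" for i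
    have s0: "0 \<le> w i * s i" for i
      unfolding s_def by (rule g_nonneg[OF cU[OF that] v])
    have le: "d i * (hyp_form i (D (c t) ?v $ i) (W i) / sqrt ((q i t)\<^sup>2 + 1)) \<le> d i * sqrt (s i)" for i
    proof (cases "d i = 0")
      case False
      then have WW: "hyp_form i (W i) (W i) = 1" using W(2)[of i] by (simp add: d_def)
      have "hyp_form i (D (c t) ?v $ i) (W i) / sqrt ((q i t)\<^sup>2 + 1) \<le>
          \<bar>hyp_form i (D (c t) ?v $ i) (W i)\<bar> / sqrt ((q i t)\<^sup>2 + 1)"
        by (intro divide_right_mono) auto
      also have "\<dots> \<le> sqrt (s i)"
        unfolding s_def q_def
        by (rule hyp_form_tangent_le[OF F_row(1,2)[OF cU[OF that]] F_D_orthogonal(1)[OF cU[OF that] v] WW])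
      finally show ?thesis
        using d0[of i] by (rule mult_left_mono)
    qed simp
    have "f' t = (\<Sum>i\<in>UNIV. w i * (d i * (hyp_form i (D (c t) ?v $ i) (W i) / sqrt ((q i t)\<^sup>2 + 1)))) / L"
      using True by (simp add: f'_def sum_divide_distrib algebra_simps)
    also have "\<dots> \<le> (\<Sum>i\<in>UNIV. w i * (d i * sqrt (s i))) / L"
      by (intro divide_right_mono sum_mono mult_left_mono le L0 less_imp_le[OF w_pos])
    also have "\<dots> \<le> L * sqrt (\<Sum>i\<in>UNIV. w i * s i) / L"
    proof (intro divide_right_mono L0 power2_le_imp_le[of "\<Sum>i\<in>UNIV. w i * (d i * sqrt (s i))"])
      \<comment> \<open>The weight is split evenly between the two factors of Cauchy-Schwarz, so
        that one sum becomes \<open>L * L\<close> and the other the squared speed.\<close>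
      have "(\<Sum>i\<in>UNIV. w i * (d i * sqrt (s i))) = (\<Sum>i\<in>UNIV. (sqrt (w i) * d i) * sqrt (w i * s i))"
        using w_pos by (intro sum.cong) (simp_all add: real_sqrt_mult less_imp_le)
      then have "(\<Sum>i\<in>UNIV. w i * (d i * sqrt (s i)))\<^sup>2 \<le>
          (\<Sum>i\<in>UNIV. (sqrt (w i) * d i)\<^sup>2) * (\<Sum>i\<in>UNIV. (sqrt (w i * s i))\<^sup>2)"
        using Cauchy_Schwarz_ineq_sum[of "\<lambda>i. sqrt (w i) * d i" "\<lambda>i. sqrt (w i * s i)" UNIV] by simp
      also have "\<dots> = (\<Sum>i\<in>UNIV. w i * (d i)\<^sup>2) * (\<Sum>i\<in>UNIV. w i * s i)"
        using w_pos s0 by (simp add: power_mult_distrib less_imp_le)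
      also have "\<dots> = (L * sqrt (\<Sum>i\<in>UNIV. w i * s i))\<^sup>2"
        using s0 by (simp add: power_mult_distrib LL sum_nonneg power2_eq_square[of L])
      finally show "(\<Sum>i\<in>UNIV. w i * (d i * sqrt (s i)))\<^sup>2 \<le> (L * sqrt (\<Sum>i\<in>UNIV. w i * s i))\<^sup>2" .
      show "0 \<le> L * sqrt (\<Sum>i\<in>UNIV. w i * s i)"
        using L0 s0 by (simp add: sum_nonneg)
    qed
    also have "\<dots> \<le> sqrt (\<Sum>i\<in>UNIV. w i * s i)"
      using s0 by (cases "L = 0") (simp_all add: sum_nonneg)
    also have "\<dots> = speed t"
      by (simp add: speed_def g_eq[OF cU[OF that] v v] s_def)
    finally show ?thesis .
  next
    case False
    then show ?thesis by (simp only: f'_def if_False order_refl)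
  qed
  then have "L \<le> l"
    using l unfolding speed_def[symmetric] by (rule has_integral_le[OF f', rotated])
  then show ?thesis
    by (simp add: L_def d_def x_def y_def pathstart_def pathfinish_def)
qed

lemma riemannian_dist_eq:
  assumes "x \<in> U" "y \<in> U"
  shows "riemannian_dist U g x y = sqrt (\<Sum>i\<in>UNIV. w i * (hyp_dist x y i)\<^sup>2)"
  unfolding riemannian_dist_def
proof (rule cInf_eq_minimum)
  show "sqrt (\<Sum>i\<in>UNIV. w i * (hyp_dist x y i)\<^sup>2) \<in> {l. \<exists>c. valid_path c \<and> path_image c \<subseteq> U \<and>
     pathstart c = x \<and> pathfinish c = y \<and>
     ((\<lambda>t. sqrt (g (c t) (vector_derivative c (at t)) (vector_derivative c (at t)))) has_integral l) {0..1}}"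
    by (rule minimizing_path[OF assms]) blast
qed (use path_length_ge in blast)

end

section \<open>Cholesky factors\<close>

lemma matrix_inv_inverse:
  fixes A :: "real^'n^'n"
  assumes "invertible A"
  shows "A ** matrix_inv A = mat 1" "matrix_inv A ** A = mat 1"
  using someI_ex[OF assms[unfolded invertible_def]] by (simp_all add: matrix_inv_def)

lemma matrix_inv_unique:
  fixes A B :: "real^'n^'n"
  assumes "A ** B = mat 1"
  shows "matrix_inv A = B"
proof -
  have "invertible A"
    using assms by (auto simp: invertible_right_inverse)
  then have "matrix_inv A ** (A ** B) = B"
    by (simp add: matrix_mul_assoc matrix_inv_inverse)
  then show ?thesis by (simp add: assms)
qed

lemma matrix_mult_transpose_nth: "((A::real^'n^'m) ** transpose B) $ i $ j = A $ i \<bullet> B $ j"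
  by (simp add: matrix_matrix_mult_def transpose_def inner_vec_def)

lemma norm_matrix_vector_le: "norm ((A::real^'n^'m) *v x) \<le> norm A * norm x"
proof -
  have "L2_set (\<lambda>i. norm ((A *v x) $ i)) UNIV \<le> L2_set (\<lambda>i. norm (A $ i) * norm x) UNIV"
    by (rule L2_set_mono) (simp_all add: matrix_vector_mul_component Cauchy_Schwarz_ineq2)
  also have "\<dots> = norm A * norm x"
    by (simp add: L2_set_left_distrib norm_vec_def)
  finally show ?thesis by (simp add: norm_vec_def)
qed

lemma index_pos_less: "j < i \<Longrightarrow> index_pos j < index_pos i"
  unfolding index_pos_def by (intro psubset_card_mono) (auto dest: less_trans)

text \<open>Induction along a finite linear order through the number of smaller indices.\<close>

lemmas index_induct = measure_induct_rule[of index_pos, case_names less]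

lemma index_pos_eq_0_iff: "index_pos i = 0 \<longleftrightarrow> {..<i} = {}"
  by (simp add: index_pos_def)

lemma index_pos_less_card: "index_pos (i::'n::{finite,linorder}) < CARD('n)"
  unfolding index_pos_def by (rule psubset_card_mono) auto

lemma lower_triangular_mult_nth:
  assumes "lower_triangular L"
  shows "(\<Sum>k\<in>UNIV. f k * L $ j $ k) = (\<Sum>k<j. f k * L $ j $ k) + f j * L $ j $ j"
proof -
  have "(\<Sum>k\<in>UNIV. f k * L $ j $ k) = (\<Sum>k\<in>insert j {..<j}. f k * L $ j $ k)"
    using assms by (intro sum.mono_neutral_right) (auto simp: lower_triangular_def not_less less_le)
  then show ?thesis by simp
qed

lemma lower_triangular_inner:
  assumes "lower_triangular L"
  shows "x \<bullet> L $ j = (\<Sum>k<j. x $ k * L $ j $ k) + x $ j * L $ j $ j"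
  using lower_triangular_mult_nth[OF assms, of "\<lambda>k. x $ k"] by (simp add: inner_vec_def)

lemma lower_triangular_invertible:
  assumes "lower_triangular L" "\<And>i. 0 < L $ i $ i"
  shows "invertible L"
  unfolding invertible_left_inverse matrix_left_invertible_ker
proof (intro allI impI)
  fix x assume "L *v x = 0"
  then have z: "L $ j \<bullet> x = 0" for j
    by (metis matrix_vector_mul_component zero_index)
  have "x $ j = 0" for j
  proof (induction j rule: index_induct)
    case (less j)
    have "x $ k = 0" if "k < j" for k
      using less index_pos_less[OF that] by blast
    then have "x \<bullet> L $ j = x $ j * L $ j $ j"
      unfolding lower_triangular_inner[OF assms(1)] by (simp add: sum.neutral)
    then show ?case
      using z[of j] assms(2)[of j] by (simp add: inner_commute)
  qed
  then show "x = 0" by (simp add: vec_eq_iff)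
qed

text \<open>Column \<open>j\<close> is determined by the earlier columns and the products with row
  \<open>j\<close>: the case \<open>i = j\<close> gives the square of the diagonal entry, positivity
  fixes its sign, and division by it gives the other entries.\<close>

lemma Cholesky_unique:
  assumes L: "lower_triangular L" "\<And>i. 0 < L $ i $ i" and L': "lower_triangular L'" "\<And>i. 0 < L' $ i $ i"
    and eq: "L ** transpose L = L' ** transpose L'"
  shows "L = L'"
proof -
  have inner: "L $ i \<bullet> L $ j = L' $ i \<bullet> L' $ j" for i j
    using eq matrix_mult_transpose_nth by metis
  have "\<forall>i. L $ i $ j = L' $ i $ j" for j
  proof (induction j rule: index_induct)
    case (less j)
    have sum: "(\<Sum>k<j. L $ i $ k * L $ j $ k) = (\<Sum>k<j. L' $ i $ k * L' $ j $ k)" for i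
      by (intro sum.cong refl) (use less index_pos_less in \<open>metis lessThan_iff\<close>)
    then have *: "L $ i $ j * L $ j $ j = L' $ i $ j * L' $ j $ j" for i
      using inner[of i j] unfolding lower_triangular_inner[OF L(1)] lower_triangular_inner[OF L'(1)] by simp
    have "(L $ j $ j)\<^sup>2 = (L' $ j $ j)\<^sup>2"
      using *[of j] by (simp add: power2_eq_square)
    then have d: "L $ j $ j = L' $ j $ j"
      using L(2)[of j] L'(2)[of j] by (simp add: power2_eq_iff_nonneg less_imp_le)
    show ?case
      using * d L'(2)[of j] by (auto simp: less_imp_neq)
  qed
  then show ?thesis by (simp add: vec_eq_iff)
qed

text \<open>Bordering: indices are added in increasing order. The new row is the solution
  \<open>y\<close> of \<open>L *v y = c\<close> together with a diagonal entry whose square is the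
  Schur complement \<open>C $ b $ b - y \<bullet> y\<close>.\<close>

lemma Cholesky_exists:
  fixes C :: "real^'n::{finite,linorder}^'n::{finite,linorder}"
  assumes sym: "transpose C = C" and pos: "\<And>x. x \<noteq> 0 \<Longrightarrow> 0 < x \<bullet> (C *v x)"
  shows "\<exists>L. lower_triangular L \<and> (\<forall>i. 0 < L $ i $ i) \<and> C = L ** transpose L"
proof -
  have C_sym: "C $ i $ j = C $ j $ i" for i j
    using sym by (metis transpose_def vec_lambda_beta)
  \<comment> \<open>Outside \<open>A\<close> the factor is the identity, so that all intermediate
    factors are invertible matrices of full size.\<close>
  define Q where "Q A L \<longleftrightarrow> lower_triangular L \<and> (\<forall>i. 0 < L $ i $ i) \<and>
      (\<forall>i\<in>A. \<forall>j\<in>A. L $ i \<bullet> L $ j = C $ i $ j) \<and> (\<forall>i\<in>A. \<forall>j. j \<notin> A \<longrightarrow> L $ i $ j = 0) \<and>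
      (\<forall>i. i \<notin> A \<longrightarrow> L $ i = axis i 1)" for A L
  have "\<exists>L. Q A L" for A
    using finite[of A]
  proof (induction A rule: finite_linorder_max_induct)
    case empty
    show ?case
      by (rule exI[of _ "mat 1"]) (auto simp: Q_def lower_triangular_def mat_def axis_def vec_eq_iff)
  next
    case (insert b A)
    then have b: "b \<notin> A" by auto
    from insert obtain L where L: "lower_triangular L" "\<And>i. 0 < L $ i $ i"
      "\<And>i j. i \<in> A \<Longrightarrow> j \<in> A \<Longrightarrow> L $ i \<bullet> L $ j = C $ i $ j"
      "\<And>i j. i \<in> A \<Longrightarrow> j \<notin> A \<Longrightarrow> L $ i $ j = 0" "\<And>i. i \<notin> A \<Longrightarrow> L $ i = axis i 1"
      unfolding Q_def by blast
    define c where "c = (\<chi> j. if j \<in> A then C $ j $ b else 0)"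
    have inv: "invertible L" using lower_triangular_invertible[OF L(1,2)] .
    define y where "y = matrix_inv L *v c"
    \<comment> \<open>Supported on \<open>A\<close>, this solves \<open>C *v z = c\<close> in the
      rows of \<open>A\<close>. The quadratic form of \<open>C\<close> at
      \<open>axis b 1 - z\<close> is therefore the Schur complement, which is positive because
      \<open>C\<close> is.\<close>
    define z where "z = transpose (matrix_inv L) *v y"
    have Ly: "L *v y = c"
      by (simp add: y_def matrix_vector_mul_assoc matrix_inv_inverse[OF inv])
    have zL: "z v* L = y"
    proof -
      have "transpose L *v z = transpose (matrix_inv L ** L) *v y"
        unfolding z_def by (simp only: matrix_vector_mul_assoc matrix_transpose_mul)
      then show ?thesis
        by (simp add: matrix_inv_inverse[OF inv])
    qed
    have y0: "y $ j = 0" if "j \<notin> A" for j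
    proof -
      have "y $ j = L $ j \<bullet> y"
        using L(5)[OF that] by (simp add: inner_axis')
      also have "\<dots> = c $ j"
        using Ly matrix_vector_mul_component by metis
      finally show ?thesis using that by (simp add: c_def)
    qed
    have z0: "z $ j = 0" if "j \<notin> A" for j
    proof -
      have "y $ j = (\<Sum>k\<in>UNIV. L $ k $ j * z $ k)"
        using zL by (simp add: vector_matrix_mult_def vec_eq_iff mult.commute)
      also have "\<dots> = (\<Sum>k\<in>UNIV. if k = j then z $ j else 0)"
      proof (rule sum.cong[OF refl])
        fix k
        have "L $ k $ j = (if k = j then 1 else 0)"
          using L(4)[OF _ that, of k] L(5)[of k] that by (cases "k \<in> A") (auto simp: axis_def)
        then show "L $ k $ j * z $ k = (if k = j then z $ j else 0)" by simp
      qed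
      finally show ?thesis using y0[OF that] by simp
    qed
    have zz: "z \<bullet> (L *v x) = y \<bullet> x" for x
      unfolding zL[symmetric] by (simp add: dot_lmul_matrix)
    have zC: "z \<bullet> (C *v axis b 1) = y \<bullet> y"
    proof -
      have "z \<bullet> (C *v axis b 1) = z \<bullet> c"
        unfolding inner_vec_def using z0
        by (intro sum.cong) (auto simp: c_def matrix_vector_mult_basis column_def)
      then show ?thesis using zz[of y] Ly by simp
    qed
    have zCz: "z \<bullet> (C *v z) = y \<bullet> y"
    proof -
      have "(C *v z) $ i = ((L ** transpose L) *v z) $ i" if "i \<in> A" for i
        unfolding matrix_vector_mult_def vec_lambda_beta matrix_mult_transpose_nth
      proof (rule sum.cong[OF refl])
        show "C $ i $ j * z $ j = (L $ i \<bullet> L $ j) * z $ j" for j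
          using z0[of j] L(3)[OF that, of j] by (cases "j \<in> A") auto
      qed
      then have "z \<bullet> (C *v z) = z \<bullet> ((L ** transpose L) *v z)"
        unfolding inner_vec_def using z0 by (intro sum.cong refl) (metis inner_real_def mult_zero_left)
      also have "\<dots> = z \<bullet> (L *v (z v* L))"
        by (simp add: matrix_vector_mul_assoc[symmetric])
      also have "\<dots> = y \<bullet> y" unfolding zL by (rule zz)
      finally show ?thesis .
    qed
    have "axis b 1 - z \<noteq> 0"
      using z0[OF b] by (auto simp: vec_eq_iff axis_def intro!: exI[of _ b])
    then have "0 < (axis b 1 - z) \<bullet> (C *v (axis b 1 - z))" by (rule pos)
    also have "\<dots> = axis b 1 \<bullet> (C *v axis b 1) - axis b 1 \<bullet> (C *v z) - z \<bullet> (C *v axis b 1) + z \<bullet> (C *v z)"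
      by (simp add: matrix_vector_mult_diff_distrib inner_diff_left inner_diff_right)
    also have "axis b 1 \<bullet> (C *v z) = z \<bullet> (C *v axis b 1)"
      using sym by (metis dot_lmul_matrix inner_commute transpose_matrix_vector)
    also have "axis b 1 \<bullet> (C *v axis b 1) = C $ b $ b"
      by (simp add: inner_axis' matrix_vector_mult_basis column_def)
    finally have s: "0 < C $ b $ b - y \<bullet> y"
      by (simp add: zC zCz)
    define r where "r = sqrt (C $ b $ b - y \<bullet> y)"
    have r: "0 < r" "r * r = C $ b $ b - y \<bullet> y"
      using s by (simp_all add: r_def)
    define L' where "L' = (\<chi> i. if i = b then y + r *\<^sub>R axis b 1 else L $ i)"
    have L'b: "L' $ b = y + r *\<^sub>R axis b 1" and L': "i \<noteq> b \<Longrightarrow> L' $ i = L $ i" for i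
      by (simp_all add: L'_def)
    have "Q (insert b A) L'"
      unfolding Q_def
    proof (intro conjI ballI allI impI)
      show "lower_triangular L'"
      proof -
        have "y $ j = 0" if "b < j" for j
          using y0[of j] insert(2) that by fastforce
        then show ?thesis
          using L(1) by (auto simp: lower_triangular_def L'_def axis_def)
      qed
      show "0 < L' $ i $ i" for i
        using L(2) y0[OF b] r(1) by (simp add: L'_def)
      show "L' $ i = axis i 1" if "i \<notin> insert b A" for i
        using that L(5) by (simp add: L'_def)
      show "L' $ i $ j = 0" if "i \<in> insert b A" "j \<notin> insert b A" for i j
        using that L(4) y0 by (auto simp: L'_def axis_def)
      have cross: "L' $ b \<bullet> L' $ j = C $ b $ j" if "j \<in> A" for j
      proof -
        have "y \<bullet> L $ j = c $ j"
          using Ly matrix_vector_mul_component inner_commute by metis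
        moreover have "L' $ j = L $ j"
          using that b by (intro L') blast
        ultimately show ?thesis
          using that L(4)[OF that b] C_sym by (auto simp: L'b inner_add_left inner_axis' c_def)
      qed
      have "L' $ b \<bullet> L' $ b = C $ b $ b"
        using y0[OF b] r(2) by (simp add: L'b inner_add_left inner_add_right inner_axis inner_axis')
      then show "L' $ i \<bullet> L' $ j = C $ i $ j" if "i \<in> insert b A" "j \<in> insert b A" for i j
        using that cross L(3)[of i j] L' b C_sym inner_commute by (metis insert_iff)
    qed
    then show ?case by blast
  qed
  then obtain L where "Q UNIV L" by blast
  then show ?thesis
    by (intro exI[of _ L]) (simp add: Q_def vec_eq_iff matrix_mult_transpose_nth)
qed

lemma Cor_posD:
  assumes "C \<in> Cor_pos"
  shows "transpose C = C" "x \<noteq> 0 \<Longrightarrow> 0 < x \<bullet> (C *v x)" "C $ i $ i = 1"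
  using assms by (auto simp: Cor_pos_def)

lemma Chol_eqI:
  assumes "lower_triangular L" "\<And>i. 0 < L $ i $ i"
  shows "Chol (L ** transpose L) = L"
  unfolding Chol_def using assms Cholesky_unique by (intro the_equality) blast+

lemma Chol:
  assumes "C \<in> Cor_pos"
  shows "lower_triangular (Chol C)" "0 < Chol C $ i $ i" "Chol C ** transpose (Chol C) = C"
    "Chol C $ i \<bullet> Chol C $ j = C $ i $ j"
proof -
  obtain L where L: "lower_triangular L" "\<forall>i. 0 < L $ i $ i" "C = L ** transpose L"
    using Cholesky_exists Cor_posD[OF assms] by metis
  then have "Chol C = L" using Chol_eqI by blast
  then show "lower_triangular (Chol C)" "0 < Chol C $ i $ i" and C: "Chol C ** transpose (Chol C) = C"
    using L by auto
  show "Chol C $ i \<bullet> Chol C $ j = C $ i $ j"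
    using C matrix_mult_transpose_nth by metis
qed

lemma row_eq_nth: "row i A = A $ i"
  by (simp add: row_def)

lemma Chol_row_norm: "C \<in> Cor_pos \<Longrightarrow> norm (Chol C $ i) = 1"
  using Chol(4)[of C i i] Cor_posD(3) by (simp add: norm_eq_1)

lemma Chol_unit_row_factors: "C \<in> Cor_pos \<Longrightarrow> Chol C \<in> unit_row_factors"
  unfolding unit_row_factors_def mem_Collect_eq row_eq_nth
  by (intro conjI allI Chol(1,2) Chol_row_norm)

text \<open>The Cholesky algorithm, column by column: each entry is a quotient with denominator
  \<open>sqrt (s j C)\<close>. Since \<open>s j C\<close> is the square of a positive diagonal
  entry, the closure rules for roots and quotients apply.\<close>

lemma elementary_Chol:
  "elementary_map (Cor_pos :: (real^'n::{finite,linorder}^'n::{finite,linorder}) set) Chol"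
proof -
  have "\<forall>i. elementary_on Cor_pos (\<lambda>C. Chol C $ i $ j)" for j :: 'n
  proof (induction j rule: index_induct)
    case (less j)
    then have IH: "elementary_on Cor_pos (\<lambda>C. Chol C $ i $ k)" if "k < j" for i k
      using that index_pos_less by blast
    define s where "s i C = C $ i $ j - (\<Sum>k<j. Chol C $ i $ k * Chol C $ j $ k)" for i C
    have s: "elementary_on Cor_pos (s i)" for i
      unfolding s_def[abs_def] by (intro elementary_intros elementary_entry IH) auto
    have eq: "Chol C $ i $ j * Chol C $ j $ j = s i C" if "C \<in> Cor_pos" for i C
      using Chol(4)[OF that, of i j] unfolding lower_triangular_inner[OF Chol(1)[OF that]] s_def by simp
    have pos: "0 < s j C" if "C \<in> Cor_pos" for C
      using eq[OF that, of j] Chol(2)[OF that, of j] by (metis mult_pos_pos)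
    have "Chol C $ i $ j = s i C / sqrt (s j C)" if "C \<in> Cor_pos" for i C
    proof -
      have "sqrt (s j C) = Chol C $ j $ j"
        using eq[OF that, of j] Chol(2)[OF that, of j] by (metis abs_of_pos real_sqrt_abs2)
      then show ?thesis
        using eq[OF that, of i] Chol(2)[OF that, of j] by (simp add: field_simps)
    qed
    moreover have "elementary_on Cor_pos (\<lambda>C. s i C / sqrt (s j C))" for i
      using s pos by (intro elementary_divide elementary_on.sqrt) (auto dest: pos)
    ultimately show ?case
      by (auto intro: elementary_on.cong)
  qed
  then show ?thesis by (simp add: elementary_map_matrix)
qed

section \<open>The chart of correlation matrices by products of hyperboloids\<close>

definition chol_to_hyp ::
    "real^'n::{finite,linorder}^'n::{finite,linorder} \<Rightarrow> real^'n::{finite,linorder}^'n::{finite,linorder}" where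
  "chol_to_hyp C = (\<chi> i. hs_to_hyp i (Chol C $ i))"

text \<open>Row by row the same formula as \<open>hs_to_hyp\<close>: dividing the earlier
  coordinates by the last one and inverting the last one is an involution, which exchanges
  hemisphere and hyperboloid.\<close>

definition hyp_to_hs ::
    "real^'n::{finite,linorder}^'n::{finite,linorder} \<Rightarrow> real^'n::{finite,linorder}^'n::{finite,linorder}" where
  "hyp_to_hs P = (\<chi> i j. if j < i then P $ i $ j / P $ i $ i else if j = i then 1 / P $ i $ i else 0)"

definition hyp_to_cor ::
    "real^'n::{finite,linorder}^'n::{finite,linorder} \<Rightarrow> real^'n::{finite,linorder}^'n::{finite,linorder}" where
  "hyp_to_cor Y = hyp_to_hs (hyp_lift Y) ** transpose (hyp_to_hs (hyp_lift Y))"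

lemma Chol_diag_nz: "C \<in> Cor_pos \<Longrightarrow> Chol C $ i $ i \<noteq> 0"
  using Chol(2)[of C i] by simp

lemma hs_to_hyp_nth:
  "hs_to_hyp i x $ j = (if j < i then x $ j / x $ i else if j = i then 1 / x $ i else 0)"
  by (simp add: hs_to_hyp_def)

lemma hs_to_hyp_hyperboloid:
  assumes "0 < x $ i" "\<And>j. i < j \<Longrightarrow> x $ j = 0" "norm x = 1"
  shows "hs_to_hyp i x \<in> hyperboloid i"
proof -
  \<comment> \<open>A matrix whose only nonzero row is \<open>x\<close> makes the inner product
    formula for triangular matrices available for a single vector.\<close>
  have "lower_triangular (\<chi> k. if k = i then x else 0)"
    using assms(2) by (auto simp: lower_triangular_def)
  from lower_triangular_inner[OF this, of x i] have "x \<bullet> x = (\<Sum>k<i. (x $ k)\<^sup>2) + (x $ i)\<^sup>2"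
    by (simp add: power2_eq_square)
  then have "(\<Sum>k<i. (x $ k)\<^sup>2) = 1 - (x $ i)\<^sup>2"
    using assms(3) by (simp add: norm_eq_1)
  then have "(\<Sum>k<i. (x $ k / x $ i)\<^sup>2) = (1 - (x $ i)\<^sup>2) / (x $ i)\<^sup>2"
    by (simp add: power_divide sum_divide_distrib[symmetric])
  then have "(\<Sum>k<i. (x $ k / x $ i) * (x $ k / x $ i)) - 1 / x $ i * (1 / x $ i) = - 1"
    using assms(1) by (simp add: power2_eq_square field_simps)
  then show ?thesis
    using assms(1) by (auto simp: hyperboloid_def hyp_form_def hs_to_hyp_nth)
qed

lemma chol_to_hyp_hyperboloid: "C \<in> Cor_pos \<Longrightarrow> chol_to_hyp C $ i \<in> hyperboloid i"
  using Chol(1,2) Chol_row_norm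
  by (auto simp: chol_to_hyp_def lower_triangular_def intro!: hs_to_hyp_hyperboloid)

lemma hyp_to_hs_lower_triangular: "lower_triangular (hyp_to_hs P)"
  by (auto simp: lower_triangular_def hyp_to_hs_def)

lemma hyp_to_hs_diag:
  assumes "P $ i \<in> hyperboloid i"
  shows "0 < hyp_to_hs P $ i $ i" "hyp_to_hs P $ i \<bullet> hyp_to_hs P $ i = 1"
proof -
  note P = hyperboloidD[OF assms]
  show "0 < hyp_to_hs P $ i $ i" using P by (simp add: hyp_to_hs_def)
  have "(\<Sum>k<i. (P $ i $ k)\<^sup>2) = (P $ i $ i)\<^sup>2 - 1"
    using P(2) by (simp add: hyp_form_def power2_eq_square)
  then have "(\<Sum>k<i. (P $ i $ k / P $ i $ i)\<^sup>2) = ((P $ i $ i)\<^sup>2 - 1) / (P $ i $ i)\<^sup>2"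
    by (simp add: power_divide sum_divide_distrib[symmetric])
  then show "hyp_to_hs P $ i \<bullet> hyp_to_hs P $ i = 1"
    unfolding lower_triangular_inner[OF hyp_to_hs_lower_triangular]
    using P(1) by (simp add: hyp_to_hs_def power2_eq_square field_simps)
qed

lemma hyp_to_cor_Cor_pos: "hyp_to_cor Y \<in> Cor_pos"
proof -
  define L where "L = hyp_to_hs (hyp_lift Y)"
  have L: "lower_triangular L" "\<And>i. 0 < L $ i $ i" "\<And>i. L $ i \<bullet> L $ i = 1"
    unfolding L_def using hyp_to_hs_lower_triangular hyp_to_hs_diag[OF hyp_lift_hyperboloid] by blast+
  have "invertible (transpose L)"
    using lower_triangular_invertible[OF L(1,2)] by (rule transpose_invertible)
  then have ker: "x v* L = 0 \<Longrightarrow> x = 0" for x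
    using matrix_left_invertible_ker[of "transpose L"] by (auto simp: invertible_left_inverse)
  have "0 < x \<bullet> ((L ** transpose L) *v x)" if "x \<noteq> 0" for x
  proof -
    have "x \<bullet> ((L ** transpose L) *v x) = (x v* L) \<bullet> (x v* L)"
      by (simp add: dot_lmul_matrix matrix_vector_mul_assoc[symmetric])
    then show ?thesis using ker that by auto
  qed
  then show ?thesis
    using L(3) by (simp add: hyp_to_cor_def L_def[symmetric] Cor_pos_def matrix_transpose_mul
        matrix_mult_transpose_nth)
qed

lemma chol_to_hyp_hyp_to_cor: "chol_to_hyp (hyp_to_cor Y) = hyp_lift Y"
proof -
  have "Chol (hyp_to_cor Y) = hyp_to_hs (hyp_lift Y)"
    unfolding hyp_to_cor_def
    by (rule Chol_eqI[OF hyp_to_hs_lower_triangular hyp_to_hs_diag(1)[OF hyp_lift_hyperboloid]])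
  then have C: "chol_to_hyp (hyp_to_cor Y) $ i = hs_to_hyp i (hyp_to_hs (hyp_lift Y) $ i)" for i
    by (simp add: chol_to_hyp_def)
  have "chol_to_hyp (hyp_to_cor Y) $ i $ j = hyp_lift Y $ i $ j" for i j
    using hyperboloidD(1,3)[OF hyp_lift_hyperboloid[of Y i]]
    by (cases i j rule: linorder_cases) (auto simp: C hs_to_hyp_nth hyp_to_hs_def)
  then show ?thesis by (simp add: vec_eq_iff)
qed

lemma hyp_to_cor_chol_to_hyp:
  assumes "C \<in> Cor_pos"
  shows "hyp_to_cor (chol_to_hyp C) = C"
proof -
  have "hyp_to_hs (chol_to_hyp C) $ i $ j = Chol C $ i $ j" for i j
    using Chol(1)[OF assms] Chol_diag_nz[OF assms, of i]
    by (cases i j rule: linorder_cases)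
      (auto simp: hyp_to_hs_def chol_to_hyp_def hs_to_hyp_nth lower_triangular_def)
  then have "hyp_to_hs (chol_to_hyp C) = Chol C"
    by (simp add: vec_eq_iff)
  then show ?thesis
    using hyp_lift_ident[OF chol_to_hyp_hyperboloid[OF assms]] Chol(3)[OF assms]
    by (simp add: hyp_to_cor_def)
qed

lemma elementary_chol_to_hyp:
  "elementary_map (Cor_pos :: (real^'n::{finite,linorder}^'n::{finite,linorder}) set) chol_to_hyp"
proof -
  have L: "elementary_on Cor_pos (\<lambda>C. Chol C $ i $ j)" for i j :: 'n
    by (rule elementary_map_matrix[THEN iffD1, OF elementary_Chol, rule_format])
  show ?thesis
    unfolding elementary_map_matrix
    by (auto simp: chol_to_hyp_def hs_to_hyp_nth intro!: elementary_if elementary_divide L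
        elementary_on.const Chol_diag_nz)
qed

lemma elementary_hyp_to_cor:
  "elementary_map UNIV (hyp_to_cor :: real^'n::{finite,linorder}^'n::{finite,linorder} \<Rightarrow> _)"
proof -
  have P: "elementary_on UNIV (\<lambda>Y. hyp_lift Y $ i $ j)" for i j :: 'n
    by (rule elementary_map_matrix[THEN iffD1, OF elementary_hyp_lift, rule_format])
  have nz: "hyp_lift Y $ i $ i \<noteq> 0" for Y and i :: 'n
    using hyperboloidD(1)[OF hyp_lift_hyperboloid, of Y i] by simp
  have "elementary_on UNIV (\<lambda>Y. hyp_to_hs (hyp_lift Y) $ i $ j)" for i j :: 'n
    by (auto simp: hyp_to_hs_def intro!: elementary_if elementary_divide P elementary_on.const nz)
  then show ?thesis
    unfolding elementary_map_matrix hyp_to_cor_def matrix_mult_transpose_nth inner_vec_def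
    by (auto intro!: elementary_intros)
qed

section \<open>Correlation matrices as a relatively open set\<close>

lemma subspace_Hol: "subspace (Hol :: (real^'n^'n) set)"
  unfolding Hol_def by (rule subspaceI) (auto simp: transpose_def vec_eq_iff)

text \<open>The minimum \<open>m\<close> of the quadratic form on the unit sphere, that is, the
  least eigenvalue of \<open>C\<close>, serves as radius: a perturbation changes the form on unit
  vectors by at most its Frobenius norm.\<close>

lemma affine_domain_Cor_pos: "affine_domain Hol (Cor_pos :: (real^'n^'n) set)"
  unfolding affine_domain_def
proof (intro conjI ballI subspace_Hol)
  have "mat 1 \<in> (Cor_pos :: (real^'n^'n) set)"
    by (simp add: Cor_pos_def transpose_mat) (simp add: mat_def)
  then show "(Cor_pos :: (real^'n^'n) set) \<noteq> {}" by blast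
  fix C assume C: "C \<in> (Cor_pos :: (real^'n^'n) set)"
  show "D - C \<in> Hol" if "D \<in> Cor_pos" for D
    using C that by (auto simp: Cor_pos_def Hol_def transpose_def vec_eq_iff)
  have cont: "continuous_on (sphere 0 1) (\<lambda>x. x \<bullet> (C *v x))"
    by (intro continuous_intros linear_continuous_on matrix_vector_mul_bounded_linear)
  have ne: "sphere 0 1 \<noteq> ({} :: (real^'n) set)"
    by simp
  obtain z where z: "z \<in> sphere 0 1"
      "\<And>x. x \<in> sphere 0 1 \<Longrightarrow> z \<bullet> (C *v z) \<le> x \<bullet> (C *v x)"
    using continuous_attains_inf[OF compact_sphere ne cont] by blast
  define m where "m = z \<bullet> (C *v z)"
  have "z \<noteq> 0" using z(1) by auto
  then have m: "0 < m" unfolding m_def by (rule Cor_posD(2)[OF C])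
  have "C + v \<in> Cor_pos" if v: "v \<in> Hol" "norm v < m" for v
  proof -
    have "0 < x \<bullet> ((C + v) *v x)" if "x \<noteq> 0" for x
    proof -
      define u where "u = x /\<^sub>R norm x"
      have u: "norm u = 1" "x = norm x *\<^sub>R u"
        using that by (simp_all add: u_def)
      have "\<bar>u \<bullet> (v *v u)\<bar> \<le> norm v"
        using Cauchy_Schwarz_ineq2[of u "v *v u"] norm_matrix_vector_le[of v u] u(1) by simp
      moreover have "m \<le> u \<bullet> (C *v u)"
        unfolding m_def using u(1) by (intro z(2)) simp
      ultimately have "0 < u \<bullet> ((C + v) *v u)"
        using v(2) by (simp add: matrix_vector_mult_add_rdistrib inner_add_right)
      then have "0 < norm x * (norm x * (u \<bullet> ((C + v) *v u)))"
        using that by simp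
      then show ?thesis
        by (subst (1 2) u(2)) (simp add: matrix_vector_mult_scaleR)
    qed
    then show ?thesis
      using v(1) C by (auto simp: Cor_pos_def Hol_def transpose_def vec_eq_iff)
  qed
  then show "\<exists>e>0. \<forall>v\<in>Hol. norm v < e \<longrightarrow> C + v \<in> Cor_pos"
    using m by blast
qed

lemma affine_chart_Cor_pos: "affine_chart Hol Cor_pos"
  by (simp add: affine_chart_def affine_domain_Cor_pos)

interpretation Cor: affine_chart Hol "Cor_pos :: (real^'n::{finite,linorder}^'n::{finite,linorder}) set"
  by (rule affine_chart_Cor_pos)

lemma rows_map_eq: "rows_map L = L"
  by (simp add: rows_map_def row_eq_nth vec_eq_iff)

lemma affine_domain_hs: "affine_domain UNIV {x :: real^'n::{finite,linorder}. x $ i \<noteq> 0}"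
proof (rule affine_domain_open)
  show "open {x :: real^'n::{finite,linorder}. x $ i \<noteq> 0}"
    by (intro open_Collect_neq continuous_intros)
  have "axis i 1 \<in> {x :: real^'n::{finite,linorder}. x $ i \<noteq> 0}" by simp
  then show "{x :: real^'n::{finite,linorder}. x $ i \<noteq> 0} \<noteq> {}" by blast
qed

lemma elementary_hs_to_hyp: "elementary_map {x :: real^'n::{finite,linorder}. x $ i \<noteq> 0} (hs_to_hyp i)"
proof -
  have "elementary_on U (\<lambda>x. (x :: real^'n::{finite,linorder}) $ j)" for U and j :: 'n
    using elementary_map_ident[of U] by (simp add: elementary_map_vec)
  then show ?thesis
    by (auto simp: elementary_map_vec hs_to_hyp_nth intro!: elementary_if elementary_divide elementary_on.const)
qed

text \<open>The chain rule through the open set \<open>x $ i \<noteq> 0\<close>. It turns the nested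
  pullbacks in the definition of the metric into the differential of the single map
  \<open>chol_to_hyp\<close>.\<close>

lemma dir_deriv_chol_to_hyp:
  assumes "C \<in> Cor_pos" "X \<in> Hol"
  shows "dir_deriv (hs_to_hyp i) (Chol C $ i) (dir_deriv Chol C X $ i) = dir_deriv chol_to_hyp C X $ i"
proof -
  have "dir_deriv chol_to_hyp C X $ i = dir_deriv (\<lambda>C. chol_to_hyp C $ i) C X"
    by (rule Cor.dir_deriv_bounded_linear[OF bounded_linear_vec_nth elementary_chol_to_hyp assms, symmetric])
  also have "\<dots> = dir_deriv (\<lambda>C. hs_to_hyp i (Chol C $ i)) C X"
    by (simp add: chol_to_hyp_def)
  also have "\<dots> = dir_deriv (hs_to_hyp i) (Chol C $ i) (dir_deriv (\<lambda>C. Chol C $ i) C X)"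
    by (rule dir_deriv_compose(1)[OF affine_domain_Cor_pos affine_domain_hs
          elementary_map_component[OF elementary_Chol] elementary_hs_to_hyp _ assms])
      (auto simp: Chol_diag_nz)
  also have "dir_deriv (\<lambda>C. Chol C $ i) C X = dir_deriv Chol C X $ i"
    by (rule Cor.dir_deriv_bounded_linear[OF bounded_linear_vec_nth elementary_Chol assms])
  finally show ?thesis by simp
qed

text \<open>The row of the least index is constant, so that it can be included with an arbitrary weight.\<close>

lemma chol_to_hyp_least:
  assumes "C \<in> Cor_pos" "index_pos i = 0"
  shows "chol_to_hyp C $ i = axis i 1"
proof -
  have e: "{..<i} = {}" using assms(2) by (simp add: index_pos_eq_0_iff)
  note P = hyperboloidD[OF chol_to_hyp_hyperboloid[OF assms(1), of i]]
  have "(chol_to_hyp C $ i $ i)\<^sup>2 = 1"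
    using P(2) by (simp add: hyp_form_def e power2_eq_square)
  then have "chol_to_hyp C $ i $ i = 1"
    using P(1) by (simp add: power2_eq_1_iff)
  moreover have "chol_to_hyp C $ i $ j = 0" if "j \<noteq> i" for j
    using e that P(3)[of j] by (cases j i rule: linorder_cases) auto
  ultimately show ?thesis by (auto simp: vec_eq_iff axis_def)
qed

lemma dir_deriv_chol_to_hyp_least:
  assumes "C \<in> Cor_pos" "X \<in> Hol" "index_pos i = 0"
  shows "dir_deriv chol_to_hyp C X $ i = 0"
proof -
  have "dir_deriv chol_to_hyp C X $ i = dir_deriv (\<lambda>C. chol_to_hyp C $ i) C X"
    by (rule Cor.dir_deriv_bounded_linear[OF bounded_linear_vec_nth elementary_chol_to_hyp assms(1,2), symmetric])
  also have "\<dots> = dir_deriv (\<lambda>C. axis i 1) C X"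
    by (rule Cor.dir_deriv_cong[OF assms(1,2)]) (rule chol_to_hyp_least[OF _ assms(3)])
  finally show ?thesis by (simp add: dir_deriv_def)
qed

definition phc_weight :: "(nat \<Rightarrow> real) \<Rightarrow> 'n::{finite,linorder} \<Rightarrow> real" where
  "phc_weight \<alpha> i = (if index_pos i = 0 then 1 else \<alpha> (index_pos i))"

lemma phc_metric_eq:
  fixes C :: "real^'n::{finite,linorder}^'n::{finite,linorder}"
  assumes "C \<in> Cor_pos" "X \<in> Hol" "Y \<in> Hol"
  shows "phc_metric \<alpha> C X Y = (\<Sum>i\<in>UNIV. phc_weight \<alpha> i *
    hyp_form i (dir_deriv chol_to_hyp C X $ i) (dir_deriv chol_to_hyp C Y $ i))"
proof -
  have "rows_map \<circ> Chol = (Chol :: real^'n::{finite,linorder}^'n::{finite,linorder} \<Rightarrow> _)"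
    by (simp add: fun_eq_iff rows_map_eq)
  then have "phc_metric \<alpha> C X Y = (\<Sum>i | 1 \<le> index_pos i. \<alpha> (index_pos i) *
      hyp_form i (dir_deriv chol_to_hyp C X $ i) (dir_deriv chol_to_hyp C Y $ i))"
    unfolding phc_metric_def pullback_def hs_product_metric_def hs_metric_def
    by (simp add: dir_deriv_chol_to_hyp[OF assms(1)] assms(2,3))
  also have "\<dots> = (\<Sum>i\<in>UNIV. phc_weight \<alpha> i *
    hyp_form i (dir_deriv chol_to_hyp C X $ i) (dir_deriv chol_to_hyp C Y $ i))"
    using dir_deriv_chol_to_hyp_least[OF assms(1,2)]
    by (intro sum.mono_neutral_cong_left) (auto simp: phc_weight_def hyp_form_simps)
  finally show ?thesis .
qed

lemma hyperbolic_product_chart_phc: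
  assumes "\<forall>k\<in>{1..<CARD('n::{finite,linorder})}. 0 < \<alpha> k"
  shows "hyperbolic_product_chart Hol (Cor_pos :: (real^'n::{finite,linorder}^'n::{finite,linorder}) set)
    chol_to_hyp hyp_to_cor (phc_weight \<alpha>) (phc_metric \<alpha>)"
proof (unfold_locales, goal_cases)
  case (6 i)
  then show ?case
    using assms index_pos_less_card[of i] by (auto simp: phc_weight_def)
qed (auto simp: elementary_chol_to_hyp elementary_hyp_to_cor hyp_to_cor_Cor_pos hyp_to_cor_chol_to_hyp
    chol_to_hyp_hyp_to_cor phc_metric_eq)

section \<open>Poly-hyperbolic-Cholesky metrics\<close>

lemma dir_deriv_hs_to_hyp_nth:
  fixes x v :: "real^'n::{finite,linorder}"
  assumes "x $ i \<noteq> 0"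
  shows "dir_deriv (hs_to_hyp i) x v $ j = (if j < i then v $ j / x $ i - x $ j * v $ i / (x $ i)\<^sup>2
    else if j = i then - v $ i / (x $ i)\<^sup>2 else 0)"
proof -
  interpret A: affine_chart UNIV "{x :: real^'n::{finite,linorder}. x $ i \<noteq> 0}"
    by (simp add: affine_chart_def affine_domain_hs)
  have "dir_deriv (hs_to_hyp i) x v $ j = dir_deriv (\<lambda>x. hs_to_hyp i x $ j) x v"
    using A.dir_deriv_bounded_linear[OF bounded_linear_vec_nth elementary_hs_to_hyp] assms by simp
  also have "\<dots> = (if j < i then v $ j / x $ i - x $ j * v $ i / (x $ i)\<^sup>2
    else if j = i then - v $ i / (x $ i)\<^sup>2 else 0)"
  proof -
    have "((\<lambda>t. (x $ j + t * v $ j) / (x $ i + t * v $ i)) has_real_derivative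
        v $ j / x $ i - x $ j * v $ i / (x $ i)\<^sup>2) (at 0)"
      using assms by (auto intro!: derivative_eq_intros simp: power2_eq_square field_simps)
    moreover have "((\<lambda>t. 1 / (x $ i + t * v $ i)) has_real_derivative - v $ i / (x $ i)\<^sup>2) (at 0)"
      using assms by (auto intro!: derivative_eq_intros simp: power2_eq_square field_simps)
    ultimately show ?thesis
      unfolding dir_deriv_def hs_to_hyp_nth
      by (auto intro!: vector_derivative_at simp: has_real_derivative_iff_has_vector_derivative)
  qed
  finally show ?thesis .
qed

lemma inner_eq_sum_lessThan:
  assumes "\<And>j. i < j \<Longrightarrow> (y :: real^'n::{finite,linorder}) $ j = 0"
  shows "x \<bullet> y = (\<Sum>j<i. x $ j * y $ j) + x $ i * y $ i"
proof -
  have "lower_triangular (\<chi> k. if k = i then y else 0)"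
    using assms by (auto simp: lower_triangular_def)
  from lower_triangular_inner[OF this, of x i] show ?thesis by simp
qed

text \<open>The hemisphere model is conformal: the hyperbolic metric is the round one divided by the
  square of the height \<open>x $ i\<close>. This is the origin of the factor
  \<open>matrix_inv (Diag L)\<close> in the closed formula.\<close>

lemma hs_metric_eq:
  assumes x: "0 < x $ i" "norm x = 1" "\<And>j. i < j \<Longrightarrow> x $ j = 0"
    and v: "x \<bullet> v = 0" "\<And>j. i < j \<Longrightarrow> v $ j = 0"
  shows "hs_metric i x v v = (norm v / x $ i)\<^sup>2"
proof -
  define a b where "a = x $ i" and "b = v $ i"
  have a: "a \<noteq> 0" using x(1) by (simp add: a_def)
  have 1: "(\<Sum>j<i. x $ j * x $ j) = 1 - a * a"
    using inner_eq_sum_lessThan[of i x x] x by (simp add: a_def norm_eq_1)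
  have 2: "(\<Sum>j<i. x $ j * v $ j) = - (a * b)"
    using inner_eq_sum_lessThan[of i v x] v by (simp add: a_def b_def)
  have 3: "(\<Sum>j<i. v $ j * v $ j) = (norm v)\<^sup>2 - b * b"
    using inner_eq_sum_lessThan[of i v v] v by (simp add: b_def power2_norm_eq_inner)
  have "(\<Sum>j<i. (v $ j / a - x $ j * b / a\<^sup>2) * (v $ j / a - x $ j * b / a\<^sup>2)) =
      (\<Sum>j<i. v $ j * v $ j / a\<^sup>2 - x $ j * v $ j * (2 * b / a ^ 3) + x $ j * x $ j * (b\<^sup>2 / a ^ 4))"
    using a by (intro sum.cong refl) (simp add: field_simps power2_eq_square power3_eq_cube power4_eq_xxxx)
  also have "\<dots> = ((norm v)\<^sup>2 - b * b) / a\<^sup>2 + a * b * (2 * b / a ^ 3) + (1 - a * a) * (b\<^sup>2 / a ^ 4)"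
    by (simp add: sum.distrib sum_subtractf sum_distrib_right[symmetric] sum_divide_distrib[symmetric] 1 2 3)
  finally have "hs_metric i x v v = ((norm v)\<^sup>2 - b * b) / a\<^sup>2 + a * b * (2 * b / a ^ 3) + (1 - a * a) * (b\<^sup>2 / a ^ 4)
      - b / a\<^sup>2 * (b / a\<^sup>2)"
    using x(1) by (simp add: hs_metric_def pullback_def hyp_form_def dir_deriv_hs_to_hyp_nth a_def b_def)
  also have "\<dots> = (norm v / a)\<^sup>2"
    using a by (simp add: field_simps power2_eq_square power3_eq_cube power4_eq_xxxx)
  finally show ?thesis by (simp add: a_def)
qed

section \<open>The differential of the Cholesky map\<close>

lemma matrix_add_rdistrib: "((A + B) ** C) = (A ** C) + (B ** (C :: 'a::semiring_1^'k^'m))"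
  by (simp add: matrix_matrix_mult_def vec_eq_iff sum.distrib distrib_right)

lemma bounded_bilinear_mult_transpose:
  "bounded_bilinear (\<lambda>A B :: real^'n::{finite,linorder}^'n::{finite,linorder}. A ** transpose B)"
  unfolding bilinear_conv_bounded_bilinear[symmetric]
  by (auto simp: bilinear_def linear_iff vec_eq_iff matrix_mult_transpose_nth inner_add_left inner_add_right)

text \<open>Obtained by differentiating \<open>Chol C ** transpose (Chol C) = C\<close>. The zero
  diagonal of \<open>X\<close> makes the derivative of each row tangent to its hemisphere.\<close>

lemma dir_deriv_Chol:
  assumes "C \<in> Cor_pos" "X \<in> Hol"
  shows "lower_triangular (dir_deriv Chol C X)"
    "Chol C ** transpose (dir_deriv Chol C X) + dir_deriv Chol C X ** transpose (Chol C) = X"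
    "Chol C $ i \<bullet> dir_deriv Chol C X $ i = 0"
proof -
  have entry: "dir_deriv Chol C X $ i $ j = dir_deriv (\<lambda>C. Chol C $ i $ j) C X" for i j
    using Cor.dir_deriv_bounded_linear[OF bounded_linear_vec_nth elementary_map_component[OF elementary_Chol] assms, of i j]
      Cor.dir_deriv_bounded_linear[OF bounded_linear_vec_nth elementary_Chol assms, of i] by simp
  have "dir_deriv Chol C X $ i $ j = 0" if "i < j" for i j
  proof -
    have "Chol D $ i $ j = 0" if "D \<in> Cor_pos" for D
      using Chol(1)[OF that] \<open>i < j\<close> by (simp add: lower_triangular_def)
    then show ?thesis
      using Cor.dir_deriv_cong[OF assms, of "\<lambda>C. Chol C $ i $ j" "\<lambda>_. 0"]
      by (simp add: entry Cor.dir_deriv_const)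
  qed
  then show "lower_triangular (dir_deriv Chol C X)"
    by (simp add: lower_triangular_def)
  have "X = dir_deriv (\<lambda>C. Chol C ** transpose (Chol C)) C X"
    using Cor.dir_deriv_cong[OF assms, of "\<lambda>C. Chol C ** transpose (Chol C)" "\<lambda>C. C", OF Chol(3)]
    by (simp add: Cor.dir_deriv_ident)
  then show eq: "Chol C ** transpose (dir_deriv Chol C X) + dir_deriv Chol C X ** transpose (Chol C) = X"
    using Cor.dir_deriv_bilinear[OF bounded_bilinear_mult_transpose elementary_Chol elementary_Chol assms]
    by simp
  have "(Chol C ** transpose (dir_deriv Chol C X) + dir_deriv Chol C X ** transpose (Chol C)) $ i $ i = 0"
    unfolding eq using assms(2) by (simp add: Hol_def)
  then show "Chol C $ i \<bullet> dir_deriv Chol C X $ i = 0"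
    by (simp add: matrix_mult_transpose_nth inner_commute)
qed

text \<open>Symmetrisation doubles the diagonal, which is why \<open>low_S\<close> halves
  it.\<close>

lemma low_S_symmetrized:
  assumes "lower_triangular A"
  shows "low_S (A + transpose A) = A"
  using assms by (auto simp: low_S_def vec_eq_iff transpose_def lower_triangular_def not_less)

text \<open>Forward substitution down the rows; it gives triangularity of
  \<open>matrix_inv L ** dir_deriv Chol C X\<close> without a study of
  \<open>matrix_inv L\<close>.\<close>

lemma lower_triangular_mult_cancel:
  assumes L: "lower_triangular L" "\<And>i. 0 < L $ i $ i" and LA: "lower_triangular (L ** A)"
  shows "lower_triangular A"
proof -
  have "\<forall>j>i. A $ i $ j = 0" for i
  proof (induction i rule: index_induct)
    case (less i)
    show ?case
    proof (intro allI impI)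
      fix j assume "i < j"
      have "A $ k $ j = 0" if "k < i" for k
        using less index_pos_less[OF that] that \<open>i < j\<close> by (meson less_trans)
      then have "(\<Sum>k<i. A $ k $ j * L $ i $ k) = 0"
        by (simp add: sum.neutral)
      moreover have "(\<Sum>k\<in>UNIV. A $ k $ j * L $ i $ k) = 0"
        using LA \<open>i < j\<close> by (simp add: lower_triangular_def matrix_matrix_mult_def mult.commute)
      ultimately show "A $ i $ j = 0"
        using lower_triangular_mult_nth[OF L(1), of "\<lambda>k. A $ k $ j" i] L(2)[of i] by simp
    qed
  qed
  then show ?thesis by (simp add: lower_triangular_def)
qed

text \<open>Multiplying the differentiated factorisation by the inverses from both sides gives
  \<open>A + transpose A\<close> with \<open>A\<close> lower triangular, from which
  \<open>low_S\<close> recovers \<open>A\<close>.\<close>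

lemma dir_deriv_Chol_eq:
  assumes "C \<in> Cor_pos" "X \<in> Hol"
  defines "L \<equiv> Chol C"
  shows "L ** low_S (matrix_inv L ** X ** transpose (matrix_inv L)) = dir_deriv Chol C X"
proof -
  define M where "M = matrix_inv L"
  define A where "A = M ** dir_deriv Chol C X"
  have L: "lower_triangular L" "\<And>i. 0 < L $ i $ i"
    unfolding L_def using Chol(1,2)[OF assms(1)] by blast+
  have LM: "L ** M = mat 1" "M ** L = mat 1"
    unfolding M_def using matrix_inv_inverse[OF lower_triangular_invertible[OF L]] by blast+
  have LA: "L ** A = dir_deriv Chol C X"
    by (simp add: A_def matrix_mul_assoc LM)
  have "lower_triangular A"
    using lower_triangular_mult_cancel[OF L] dir_deriv_Chol(1)[OF assms(1,2)] by (simp add: LA)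
  have "M ** X ** transpose M =
      M ** (L ** transpose (dir_deriv Chol C X) + dir_deriv Chol C X ** transpose L) ** transpose M"
    using dir_deriv_Chol(2)[OF assms(1,2)] by (simp add: L_def)
  also have "\<dots> = (M ** L) ** transpose (M ** dir_deriv Chol C X) + M ** dir_deriv Chol C X ** transpose (M ** L)"
    by (simp add: matrix_add_ldistrib matrix_add_rdistrib matrix_transpose_mul matrix_mul_assoc)
  also have "\<dots> = A + transpose A"
    by (simp add: LM A_def add.commute transpose_mat)
  finally show ?thesis
    using low_S_symmetrized[OF \<open>lower_triangular A\<close>] LA by (simp add: M_def)
qed

lemma matrix_inv_Diag_mult_nth:
  fixes M B :: "real^'n^'n"
  assumes "\<And>i. M $ i $ i \<noteq> 0"
  shows "(matrix_inv (Diag M) ** B) $ i = (1 / M $ i $ i) *\<^sub>R B $ i"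
proof -
  define R where "R = (\<chi> i j. if i = j then 1 / M $ i $ i else 0)"
  have diag: "((\<chi> i j. if i = j then f i else 0) ** A) $ i $ j = f i * A $ i $ j"
    for f :: "'n \<Rightarrow> real" and A :: "real^'n^'n" and i j
  proof -
    have "(\<Sum>k\<in>UNIV. (if i = k then f i else 0) * A $ k $ j) = (\<Sum>k\<in>UNIV. if k = i then f i * A $ i $ j else 0)"
      by (intro sum.cong) auto
    then show ?thesis by (simp add: matrix_matrix_mult_def)
  qed
  have D: "Diag M = (\<chi> i j. if i = j then M $ i $ i else 0)"
    by (simp add: Diag_def vec_eq_iff)
  have "Diag M ** R = mat 1"
    unfolding D using assms by (auto simp: vec_eq_iff diag R_def mat_def)
  then have R: "matrix_inv (Diag M) = R" by (rule matrix_inv_unique)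
  show ?thesis
    unfolding R R_def by (simp add: vec_eq_iff diag)
qed

lemma power2_norm_matrix: "(norm (A :: real^'n^'m))\<^sup>2 = (\<Sum>i\<in>UNIV. (norm (A $ i))\<^sup>2)"
  by (simp add: norm_vec_def L2_set_def sum_nonneg)

text \<open>By conformality, row \<open>i\<close> contributes the squared norm of its derivative
  divided by the square of \<open>L $ i $ i\<close>; summed over the rows this is a squared
  Frobenius norm.\<close>

lemma cphc_metric_formula:
  assumes "C \<in> Cor_pos" "X \<in> Hol"
  defines "L \<equiv> Chol C"
  shows "cphc_metric C X X = (norm (matrix_inv (Diag L) ** L **
    low_S (matrix_inv L ** X ** transpose (matrix_inv L))))\<^sup>2"
proof -
  let ?d = "dir_deriv Chol C X"
  have "cphc_metric C X X = (\<Sum>i\<in>UNIV. hyp_form i (dir_deriv chol_to_hyp C X $ i) (dir_deriv chol_to_hyp C X $ i))"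
    unfolding cphc_metric_def phc_metric_eq[OF assms(1,2,2)] by (simp add: phc_weight_def)
  also have "\<dots> = (\<Sum>i\<in>UNIV. hs_metric i (L $ i) (?d $ i) (?d $ i))"
    by (simp add: hs_metric_def pullback_def L_def dir_deriv_chol_to_hyp[OF assms(1,2)])
  also have "\<dots> = (\<Sum>i\<in>UNIV. (norm (?d $ i) / L $ i $ i)\<^sup>2)"
    unfolding L_def using Chol(1,2)[OF assms(1)] Chol_row_norm[OF assms(1)] dir_deriv_Chol(1,3)[OF assms(1,2)]
    by (intro sum.cong refl hs_metric_eq) (auto simp: lower_triangular_def)
  also have "\<dots> = (norm (matrix_inv (Diag L) ** ?d))\<^sup>2"
    using Chol_diag_nz[OF assms(1)] Chol(2)[OF assms(1)]
    by (simp add: power2_norm_matrix matrix_inv_Diag_mult_nth L_def power_divide)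
  also have "matrix_inv (Diag L) ** ?d = matrix_inv (Diag L) ** L **
      low_S (matrix_inv L ** X ** transpose (matrix_inv L))"
    unfolding L_def dir_deriv_Chol_eq[OF assms(1,2), symmetric] by (simp only: matrix_mul_assoc)
  finally show ?thesis .
qed

text \<open>With at most two indices there is at most one off-diagonal degree of freedom, hence no
  tangent plane. The curvature bound is then vacuous, which settles the case of a minimum over the
  empty set.\<close>

lemma Hol_dependent:
  fixes u v :: "real^'n::{finite,linorder}^'n::{finite,linorder}"
  assumes "CARD('n) \<le> 2" "u \<in> Hol" "v \<in> Hol" "u \<noteq> v"
  shows "\<not> independent {u, v}"
proof
  assume indep: "independent {u, v}"
  then have "v \<noteq> 0" and nspan: "u \<notin> span {v}"
    using assms(4) dependent_zero[of "{u, v}"] by (auto simp: independent_insert)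
  have sym: "x $ a $ b = x $ b $ a" and diag: "x $ a $ a = 0" if "x \<in> Hol" for x :: "real^'n::{finite,linorder}^'n::{finite,linorder}" and a b
    using that by (auto simp: Hol_def transpose_def vec_eq_iff)
  from \<open>v \<noteq> 0\<close> obtain i j where ij: "v $ i $ j \<noteq> 0" by (auto simp: vec_eq_iff)
  then have "i \<noteq> j" using diag[OF assms(3)] by auto
  have two: "a = i \<or> a = j" for a
  proof (rule ccontr)
    assume "\<not> (a = i \<or> a = j)"
    then have "card {a, i, j} = 3" using \<open>i \<noteq> j\<close> by simp
    moreover have "card {a, i, j} \<le> CARD('n)" by (rule card_mono) auto
    ultimately show False using assms(1) by simp
  qed
  define r where "r = u $ i $ j / v $ i $ j"
  have "u $ i $ j = r * v $ i $ j"
    using ij by (simp add: r_def)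
  then have "u $ a $ b = r * v $ a $ b" for a b
    using two[of a] two[of b] sym[OF assms(2), of i j] sym[OF assms(3), of i j] diag[OF assms(2)] diag[OF assms(3)]
    by auto
  then have "u = r *\<^sub>R v"
    by (simp add: vec_eq_iff)
  then show False
    using nspan span_scale[OF span_base[of v "{v}"]] by blast
qed

lemma three_indices:
  assumes "3 \<le> CARD('n::{finite,linorder})"
  obtains a b c :: "'n::{finite,linorder}" where "a < b" "b < c"
proof -
  define a :: 'n where "a = Min UNIV"
  define c :: 'n where "c = Max UNIV"
  have "card {a, c} \<le> 2" by (simp add: card_insert_if)
  then have "{a, c} \<noteq> UNIV" using assms by auto
  then obtain b where "b \<noteq> a" "b \<noteq> c" by auto
  moreover have "a \<le> b" "b \<le> c" by (simp_all add: a_def c_def)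
  ultimately show thesis using that[of a b c] by simp
qed

text \<open>On the hyperboloid \<open>- hyp_form\<close> is at least 1, so the inverse cosine in the
  distance is the hyperbolic one, taken at the hyperboloid images of the rows.\<close>

theorem theorem4p3:
  fixes \<alpha> :: "nat \<Rightarrow> real"
  assumes "\<forall>k\<in>{1..<CARD('n::{finite,linorder})}. 0 < \<alpha> k"
  shows
    "riemannian_symmetric_space Hol (Cor_pos :: (real^'n::{finite,linorder}^'n::{finite,linorder}) set) (phc_metric \<alpha>) \<and>
     sectional_curvatures Hol (Cor_pos :: (real^'n::{finite,linorder}^'n::{finite,linorder}) set) (phc_metric \<alpha>)
       \<subseteq> {- (1 / Min (\<alpha> ` {2..<CARD('n)})) .. 0} \<and>
     (3 \<le> CARD('n) \<longrightarrow> \<not> constant_curvature Hol (Cor_pos :: (real^'n::{finite,linorder}^'n::{finite,linorder}) set) (phc_metric \<alpha>)) \<and>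
     (\<forall>C\<in>(Cor_pos :: (real^'n::{finite,linorder}^'n::{finite,linorder}) set). Chol C \<in> unit_row_factors) \<and>
     (\<forall>C\<in>(Cor_pos :: (real^'n::{finite,linorder}^'n::{finite,linorder}) set). \<forall>X\<in>Hol. let L = Chol C in
        cphc_metric C X X =
          (norm (matrix_inv (Diag L) ** L **
             low_S (matrix_inv L ** X ** transpose (matrix_inv L))))\<^sup>2) \<and>
     (\<forall>C\<in>(Cor_pos :: (real^'n::{finite,linorder}^'n::{finite,linorder}) set). \<forall>C'\<in>Cor_pos. let L = Chol C; L' = Chol C' in
        (riemannian_dist Cor_pos cphc_metric C C')\<^sup>2 =
          (\<Sum>i | 1 \<le> index_pos i.
             (arcosh (- hyp_form i (hs_to_hyp i (row i L)) (hs_to_hyp i (row i L'))))\<^sup>2))"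
proof -
  let ?U = "Cor_pos :: (real^'n::{finite,linorder}^'n::{finite,linorder}) set"
  interpret hyperbolic_product_chart Hol ?U chol_to_hyp hyp_to_cor "phc_weight \<alpha>" "phc_metric \<alpha>"
    using hyperbolic_product_chart_phc[OF assms] .
  have "sectional_curvatures Hol ?U (phc_metric \<alpha>) \<subseteq> {- (1 / Min (\<alpha> ` {2..<CARD('n)})) .. 0}"
  proof
    fix K assume "K \<in> sectional_curvatures Hol ?U (phc_metric \<alpha>)"
    then obtain C u v where K: "K = sectional_curvature Hol (phc_metric \<alpha>) C u v"
      and C: "C \<in> ?U" and uv: "u \<in> Hol" "v \<in> Hol" "u \<noteq> v" "independent {u, v}"
      unfolding sectional_curvatures_def by blast
    have "3 \<le> CARD('n)"
      using Hol_dependent[of u v] uv by (metis not_less_eq_eq numeral_2_eq_2 numeral_3_eq_3)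
    then have "0 < Min (\<alpha> ` {2..<CARD('n)})"
      using assms by (subst Min_gr_iff) auto
    moreover have "Min (\<alpha> ` {2..<CARD('n)}) \<le> phc_weight \<alpha> i" if "2 \<le> index_pos i" for i :: 'n
      using that index_pos_less_card[of i] by (auto simp: phc_weight_def)
    ultimately show "K \<in> {- (1 / Min (\<alpha> ` {2..<CARD('n)})) .. 0}"
      unfolding K by (rule sectional_curvature_bounds[OF C uv])
  qed
  moreover have "\<not> constant_curvature Hol ?U (phc_metric \<alpha>)" if n: "3 \<le> CARD('n)"
  proof -
    obtain a b c :: 'n where abc: "a < b" "b < c"
      using three_indices[OF n] by blast
    \<comment> \<open>The factor of \<open>c\<close> has dimension at least 2 because
      \<open>a\<close> and \<open>b\<close> are smaller indices, and the factor of \<open>b\<close>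
      is nontrivial because \<open>a\<close> is smaller. The base point is the identity
      matrix.\<close>
    show ?thesis
      by (rule not_constant_curvature[OF hyp_to_cor_Cor_pos[of 0], of a c b a b]) (use abc in auto)
  qed
  moreover have "(riemannian_dist ?U cphc_metric C C')\<^sup>2 = (\<Sum>i | 1 \<le> index_pos i.
      (arcosh (- hyp_form i (hs_to_hyp i (row i (Chol C))) (hs_to_hyp i (row i (Chol C')))))\<^sup>2)"
    if C: "C \<in> ?U" and C': "C' \<in> ?U" for C C'
  proof -
    interpret canonical: hyperbolic_product_chart Hol ?U chol_to_hyp hyp_to_cor "phc_weight (\<lambda>_. 1)" cphc_metric
      unfolding cphc_metric_def by (rule hyperbolic_product_chart_phc) simp
    define d where "d i = arcosh (- hyp_form i (chol_to_hyp C $ i) (chol_to_hyp C' $ i))" for i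
    have "(riemannian_dist ?U cphc_metric C C')\<^sup>2 = (\<Sum>i\<in>UNIV. (d i)\<^sup>2)"
      unfolding canonical.riemannian_dist_eq[OF C C'] canonical.hyp_dist_def d_def
      by (simp add: phc_weight_def sum_nonneg)
    also have "\<dots> = (\<Sum>i | 1 \<le> index_pos i. (d i)\<^sup>2)"
    proof (rule sum.mono_neutral_right)
      show "\<forall>i\<in>UNIV - {i. 1 \<le> index_pos i}. (d i)\<^sup>2 = 0"
      proof
        fix i :: 'n assume "i \<in> UNIV - {i. 1 \<le> index_pos i}"
        then have "index_pos i = 0" by simp
        then have "chol_to_hyp C $ i = axis i 1" "chol_to_hyp C' $ i = axis i 1"
          using chol_to_hyp_least C C' by auto
        then have "hyp_form i (chol_to_hyp C $ i) (chol_to_hyp C' $ i) = - 1"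
          using F_row(2)[OF C, of i] by simp
        then show "(d i)\<^sup>2 = 0" by (simp add: d_def)
      qed
    qed auto
    finally show ?thesis
      by (simp add: d_def chol_to_hyp_def row_eq_nth)
  qed
  ultimately show ?thesis
    unfolding Let_def
    using riemannian_symmetric_space Chol_unit_row_factors cphc_metric_formula by blast
qed

end
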